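(* Let $S\subset\mathbb{H}^3$ be a $C^4$ smooth immersed oriented surface and let $\Sigma\subset\mathbb{L}(\mathbb{H}^3)$ be the Lagrangian surface formed by the oriented geodesics normal to $S$. Assume that the metric $\mathbb{G}_\Sigma$ induced on $\Sigma$ by the neutral Kähler metric $\mathbb{G}$ of $\mathbb{L}(\mathbb{H}^3)$ is non-degenerate. Then $S$ is Weingarten if and only if the Gauss curvature of $\mathbb{G}_\Sigma$ is zero.
   Context: $\mathbb{H}^3$ is hyperbolic 3-space in the upper half-space model $\{(x^0,x^1,x^2)\in\mathbb{R}^3: x^0>0\}$ with metric $\frac{(dx^0)^2+(dx^1)^2+(dx^2)^2}{(x^0)^2}$; put $z=x^1+ix^2$, $t=x^0$. $\mathbb{L}(\mathbb{H}^3)$ is the space of oriented geodesics of $\mathbb{H}^3$. It is a complex surface identified with $\mathbb{P}^1\times\mathbb{P}^1-\overline{\Delta}$, where $\overline{\Delta}=\{(\mu_1,\mu_2):\mu_1\bar\mu_2=-1\}$ and $(\mu_1,\mu_2)$ are holomorphic coordinates. The oriented geodesic with coordinates $(\mu_1,\mu_2)$ (for $\mu_2\neq 0$) is parameterized by arc-length $r\in\mathbb{R}$ as $$z=\frac{1-\mu_1\bar\mu_2}{2\bar\mu_2}+\left(\frac{1+\mu_1\bar\mu_2}{2\bar\mu_2}\right)\tanh r,\qquad t=\frac{|1+\bar\mu_1\mu_2|}{2|\mu_2|\cosh r}.$$ The neutral Kähler structure on $\mathbb{L}(\mathbb{H}^3)$ consists of the complex structure $\mathbb{J}$ for which $\mu_1,\mu_2$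 are holomorphic, the symplectic form $$\Omega=-\left[\frac{1}{(1+\mu_1\bar\mu_2)^2}d\mu_1\wedge d\bar\mu_2+\frac{1}{(1+\bar\mu_1\mu_2)^2}d\bar\mu_1\wedge d\mu_2\right],$$ and the metric $\mathbb{G}(\cdot,\cdot)=\Omega(\mathbb{J}\cdot,\cdot)$ of signature $(++--)$, which is given by $$\mathbb{G}=-i\left[\frac{1}{(1+\mu_1\bar\mu_2)^2}d\mu_1 d\bar\mu_2-\frac{1}{(1+\bar\mu_1\mu_2)^2}d\bar\mu_1 d\mu_2\right]$$ (symmetric products). A surface in $\mathbb{L}(\mathbb{H}^3)$ is Lagrangian if $\Omega$ pulls back to zero on it. A surface $S\subset\mathbb{H}^3$ is Weingarten if the eigenvalues $\lambda_1,\lambda_2$ of its second fundamental form (its principal curvatures) are functionally related: $d\lambda_1\wedge d\lambda_2=0$ on $S$. *)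

theory Defs
  imports "HOL-Analysis.Analysis"
begin

section \<open>Calculus in coordinates\<close>

abbreviation dir_deriv ::
  "('a::real_normed_vector \<Rightarrow> 'b::real_normed_vector) \<Rightarrow> 'a \<Rightarrow> 'a \<Rightarrow> 'b" where
  "dir_deriv f x v \<equiv> frechet_derivative f (at x) v"

text \<open>Intended for open \<open>U\<close> and finite-dimensional domains, where it is the usual notion.\<close>

primrec Ck_on :: "nat \<Rightarrow> ('a::real_normed_vector \<Rightarrow> 'b::real_normed_vector) \<Rightarrow> 'a set \<Rightarrow> bool" where
  "Ck_on 0 f U \<longleftrightarrow> continuous_on U f"
| "Ck_on (Suc k) f U \<longleftrightarrow>
     (\<forall>x\<in>U. f differentiable (at x)) \<and> (\<forall>v. Ck_on k (\<lambda>x. dir_deriv f x v) U)"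

text \<open>A (pseudo-Riemannian) metric on an open subset of a vector space is a function
  \<open>g\<close> with \<open>g p X Y\<close> the product of \<open>X\<close> and \<open>Y\<close> at \<open>p\<close>.  The Levi-Civita
  connection is \<open>D\<^sub>X Y + christoffel g p X Y\<close>; the defining equation is the Koszul formula for
  constant vector fields.\<close>

definition christoffel ::
  "('a::real_normed_vector \<Rightarrow> 'a \<Rightarrow> 'a \<Rightarrow> real) \<Rightarrow> 'a \<Rightarrow> 'a \<Rightarrow> 'a \<Rightarrow> 'a" where
  "christoffel g p X Y = (THE Z. \<forall>W. 2 * g p Z W =
     dir_deriv (\<lambda>q. g q Y W) p X + dir_deriv (\<lambda>q. g q X W) p Y - dir_deriv (\<lambda>q. g q X Y) p W)"

definition riemann ::
  "('a::real_normed_vector \<Rightarrow> 'a \<Rightarrow> 'a \<Rightarrow> real) \<Rightarrow> 'a \<Rightarrow> 'a \<Rightarrow> 'a \<Rightarrow> 'a \<Rightarrow> 'a" where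
  "riemann g p X Y Z =
     dir_deriv (\<lambda>q. christoffel g q Y Z) p X - dir_deriv (\<lambda>q. christoffel g q X Z) p Y
     + christoffel g p X (christoffel g p Y Z) - christoffel g p Y (christoffel g p X Z)"

definition gauss_curvature ::
  "(real \<times> real \<Rightarrow> real \<times> real \<Rightarrow> real \<times> real \<Rightarrow> real) \<Rightarrow> real \<times> real \<Rightarrow> real" where
  "gauss_curvature g p = (let X = (1, 0); Y = (0, 1) in
     g p (riemann g p X Y Y) X / (g p X X * g p Y Y - (g p X Y)\<^sup>2))"

section \<open>Hyperbolic space and its oriented geodesics\<close>

text \<open>A point of the half-space is the pair \<open>(t, z)\<close>, with \<open>z = x\<^sup>1 + i x\<^sup>2\<close>.\<close>

definition H3 :: "(real \<times> complex) set" where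
  "H3 = {p. fst p > 0}"

definition hyp_metric ::
  "real \<times> complex \<Rightarrow> real \<times> complex \<Rightarrow> real \<times> complex \<Rightarrow> real" where
  "hyp_metric p v w = (v \<bullet> w) / (fst p)\<^sup>2"

text \<open>The projective line is \<^typ>\<open>complex option\<close>, with \<^term>\<open>None\<close> the point at infinity.\<close>

fun on_antidiagonal :: "complex option \<times> complex option \<Rightarrow> bool" where
  "on_antidiagonal (Some m1, Some m2) \<longleftrightarrow> m1 * cnj m2 = -1"
| "on_antidiagonal (Some m1, None) \<longleftrightarrow> m1 = 0"
| "on_antidiagonal (None, Some m2) \<longleftrightarrow> m2 = 0"
| "on_antidiagonal (None, None) \<longleftrightarrow> False"

definition LH3 :: "(complex option \<times> complex option) set" where
  "LH3 = {l. \<not> on_antidiagonal l}"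

text \<open>Arc-length parametrization of an oriented geodesic.  Its ideal start point is
  \<open>-\<mu>\<^sub>1\<close> and its ideal end point is \<open>1 / cnj \<mu>\<^sub>2\<close>; this determines the cases where
  \<open>\<mu>\<^sub>2 = 0\<close> or a coordinate is infinite.\<close>

fun geodesic :: "complex option \<times> complex option \<Rightarrow> real \<Rightarrow> real \<times> complex" where
  "geodesic (Some m1, Some m2) r =
     (if m2 = 0 then (exp r, - m1)
      else (cmod (1 + cnj m1 * m2) / (2 * cmod m2 * cosh r),
            (1 - m1 * cnj m2) / (2 * cnj m2)
              + (1 + m1 * cnj m2) / (2 * cnj m2) * of_real (tanh r)))"
| "geodesic (Some m1, None) r =
     (cmod m1 / (2 * cosh r), - m1 / 2 + m1 / 2 * of_real (tanh r))"
| "geodesic (None, Some m2) r = (exp (- r), 1 / cnj m2)"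
| "geodesic (None, None) r = (exp (- r), 0)"

section \<open>The neutral Kaehler structure\<close>

text \<open>Four holomorphic charts cover the space of oriented geodesics: the first (second) flag of a
  chart \<open>c\<close> tells whether \<open>\<mu>\<^sub>1\<close> (\<open>\<mu>\<^sub>2\<close>) is replaced by its reciprocal.  The value of
  \<open>P1_coord\<close> is meaningful on the domain of the chart only.\<close>

definition P1_coord :: "bool \<Rightarrow> complex option \<Rightarrow> complex" where
  "P1_coord b x = (case x of None \<Rightarrow> 0 | Some m \<Rightarrow> if b then inverse m else m)"

definition L_coords :: "bool \<times> bool \<Rightarrow> complex option \<times> complex option \<Rightarrow> complex \<times> complex" where
  "L_coords c l = (P1_coord (fst c) (fst l), P1_coord (snd c) (snd l))"

text \<open>The chart used at \<open>l\<close>: the coordinates \<open>(\<mu>\<^sub>1, \<mu>\<^sub>2)\<close> unless one of them is infinite.\<close>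

definition chart_at :: "complex option \<times> complex option \<Rightarrow> bool \<times> bool" where
  "chart_at l = (fst l = None, snd l = None)"

text \<open>Tangent vectors are given by their components in a chart, where the complex structure
  is multiplication by \<open>i\<close>.\<close>

definition L_J :: "complex \<times> complex \<Rightarrow> complex \<times> complex" where
  "L_J X = (\<i> * fst X, \<i> * snd X)"

text \<open>The factor of \<open>d\<mu>\<^sub>1 \<and> d(cnj \<mu>\<^sub>2)\<close> in the symplectic form.  In a chart with an inverted
  coordinate it is the one obtained by substitution; see \<open>Omega_factor_chart\<close> below.\<close>

definition Omega_factor :: "bool \<times> bool \<Rightarrow> complex \<times> complex \<Rightarrow> complex" where
  "Omega_factor c m =
     (if fst c = snd c then 1 / (1 + fst m * cnj (snd m))\<^sup>2
      else - 1 / (fst m + cnj (snd m))\<^sup>2)"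

text \<open>The expression under \<^term>\<open>Re\<close> is real.\<close>

definition L_Omega :: "bool \<times> bool \<Rightarrow> complex \<times> complex \<Rightarrow>
    complex \<times> complex \<Rightarrow> complex \<times> complex \<Rightarrow> real" where
  "L_Omega c m X Y = Re (-
     (Omega_factor c m * (fst X * cnj (snd Y) - fst Y * cnj (snd X))
      + cnj (Omega_factor c m) * (cnj (fst X) * snd Y - cnj (fst Y) * snd X)))"

definition L_metric :: "bool \<times> bool \<Rightarrow> complex \<times> complex \<Rightarrow>
    complex \<times> complex \<Rightarrow> complex \<times> complex \<Rightarrow> real" where
  "L_metric c m X Y = L_Omega c m (L_J X) Y"

lemma Omega_factor_chart:
  assumes "m1 \<noteq> 0" "m2 \<noteq> 0"
  shows "Omega_factor (True, False) (inverse m1, m2) * (- 1 / m1\<^sup>2)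
           = Omega_factor (False, False) (m1, m2)"
    and "Omega_factor (False, True) (m1, inverse m2) * cnj (- 1 / m2\<^sup>2)
           = Omega_factor (False, False) (m1, m2)"
    and "Omega_factor (True, True) (inverse m1, inverse m2) * (- 1 / m1\<^sup>2) * cnj (- 1 / m2\<^sup>2)
           = Omega_factor (False, False) (m1, m2)"
proof -
  have a: "inverse m1 + cnj m2 = (1 + m1 * cnj m2) / m1"
    and b: "m1 + inverse (cnj m2) = (1 + m1 * cnj m2) / cnj m2"
    and c: "1 + inverse m1 * inverse (cnj m2) = (1 + m1 * cnj m2) / (m1 * cnj m2)"
    using assms by (simp_all add: field_simps)
  show "Omega_factor (True, False) (inverse m1, m2) * (- 1 / m1\<^sup>2)
           = Omega_factor (False, False) (m1, m2)"
    using assms by (simp add: Omega_factor_def a power_divide)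
  show "Omega_factor (False, True) (m1, inverse m2) * cnj (- 1 / m2\<^sup>2)
           = Omega_factor (False, False) (m1, m2)"
    using assms by (simp add: Omega_factor_def b power_divide)
  show "Omega_factor (True, True) (inverse m1, inverse m2) * (- 1 / m1\<^sup>2) * cnj (- 1 / m2\<^sup>2)
           = Omega_factor (False, False) (m1, m2)"
    using assms by (simp add: Omega_factor_def c power_divide power_mult_distrib)
qed

lemma L_metric_explicit:
  "of_real (L_metric (False, False) (m1, m2) X Y) = - \<i> *
     (1 / (1 + m1 * cnj m2)\<^sup>2 * (fst X * cnj (snd Y) + fst Y * cnj (snd X))
      - 1 / (1 + cnj m1 * m2)\<^sup>2 * (cnj (fst X) * snd Y + cnj (fst Y) * snd X))"
proof -
  define h where "h = 1 / (1 + m1 * cnj m2)\<^sup>2"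
  have h: "1 / (1 + cnj m1 * m2)\<^sup>2 = cnj h"
    by (simp add: h_def)
  show ?thesis
    unfolding h unfolding L_metric_def L_Omega_def Omega_factor_def h_def[symmetric] L_J_def
    by (simp add: h_def[symmetric] complex_eq_iff algebra_simps)
qed

section \<open>Immersed oriented surfaces in hyperbolic space\<close>

text \<open>A chart \<open>(U, \<phi>)\<close> is an open set of parameters together with a parametrization
  \<open>\<phi>\<close> of an open part of the surface.\<close>

type_synonym 'm surface_chart = "(real \<times> real) set \<times> (real \<times> real \<Rightarrow> 'm)"

locale C4_surface =
  fixes M :: "'m topology" and A :: "'m surface_chart set"
  assumes Hausdorff: "Hausdorff_space M"
    and second_countable: "second_countable M"
    and chart: "\<And>U \<phi>. (U, \<phi>) \<in> A \<Longrightarrow>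
      open U \<and> embedding_map (top_of_set U) M \<phi> \<and> openin M (\<phi> ` U)"
    and cover: "topspace M = (\<Union>(U, \<phi>)\<in>A. \<phi> ` U)"
    and transition: "\<And>U \<phi> V \<psi>. (U, \<phi>) \<in> A \<Longrightarrow> (V, \<psi>) \<in> A \<Longrightarrow>
      Ck_on 4 (\<lambda>u. the_inv_into V \<psi> (\<phi> u)) {u \<in> U. \<phi> u \<in> \<psi> ` V}"

text \<open>As the ambient space is oriented, an orientation of the surface is the same as a
  continuous unit normal field \<open>N\<close> along the immersion \<open>F\<close>.\<close>

locale oriented_C4_immersion = C4_surface M A
  for M :: "'m topology" and A :: "'m surface_chart set" +
  fixes F :: "'m \<Rightarrow> real \<times> complex" and N :: "'m \<Rightarrow> real \<times> complex"
  assumes in_H3: "\<And>x. x \<in> topspace M \<Longrightarrow> F x \<in> H3"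
    and C4: "\<And>U \<phi>. (U, \<phi>) \<in> A \<Longrightarrow> Ck_on 4 (F \<circ> \<phi>) U"
    and immersion: "\<And>U \<phi> u. (U, \<phi>) \<in> A \<Longrightarrow> u \<in> U \<Longrightarrow> inj (dir_deriv (F \<circ> \<phi>) u)"
    and N_continuous: "continuous_map M euclidean N"
    and N_unit: "\<And>x. x \<in> topspace M \<Longrightarrow> hyp_metric (F x) (N x) (N x) = 1"
    and N_normal: "\<And>U \<phi> u X. (U, \<phi>) \<in> A \<Longrightarrow> u \<in> U \<Longrightarrow>
      hyp_metric (F (\<phi> u)) (dir_deriv (F \<circ> \<phi>) u X) (N (\<phi> u)) = 0"

text \<open>In the following, \<open>f\<close> and \<open>n\<close> are the immersion and its unit normal in a chart.\<close>

definition first_form :: "(real \<times> real \<Rightarrow> real \<times> complex) \<Rightarrow>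
    real \<times> real \<Rightarrow> real \<times> real \<Rightarrow> real \<times> real \<Rightarrow> real" where
  "first_form f u X Y = hyp_metric (f u) (dir_deriv f u X) (dir_deriv f u Y)"

definition second_form :: "(real \<times> real \<Rightarrow> real \<times> complex) \<Rightarrow> (real \<times> real \<Rightarrow> real \<times> complex) \<Rightarrow>
    real \<times> real \<Rightarrow> real \<times> real \<Rightarrow> real \<times> real \<Rightarrow> real" where
  "second_form f n u X Y = hyp_metric (f u)
     (dir_deriv (\<lambda>v. dir_deriv f v Y) u X
      + christoffel hyp_metric (f u) (dir_deriv f u X) (dir_deriv f u Y)) (n u)"

definition principal_curvatures :: "(real \<times> real \<Rightarrow> real \<times> complex) \<Rightarrow>
    (real \<times> real \<Rightarrow> real \<times> complex) \<Rightarrow> real \<times> real \<Rightarrow> real set" where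
  "principal_curvatures f n u =
     {k. \<exists>X. X \<noteq> 0 \<and> (\<forall>Y. second_form f n u X Y = k * first_form f u X Y)}"

text \<open>The set above has one element at umbilic points, and two elements elsewhere.\<close>

definition lambda1 :: "(real \<times> real \<Rightarrow> real \<times> complex) \<Rightarrow>
    (real \<times> real \<Rightarrow> real \<times> complex) \<Rightarrow> real \<times> real \<Rightarrow> real" where
  "lambda1 f n u = Max (principal_curvatures f n u)"

definition lambda2 :: "(real \<times> real \<Rightarrow> real \<times> complex) \<Rightarrow>
    (real \<times> real \<Rightarrow> real \<times> complex) \<Rightarrow> real \<times> real \<Rightarrow> real" where
  "lambda2 f n u = Min (principal_curvatures f n u)"

definition weingarten :: "'m surface_chart set \<Rightarrow> ('m \<Rightarrow> real \<times> complex) \<Rightarrow>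
    ('m \<Rightarrow> real \<times> complex) \<Rightarrow> bool" where
  "weingarten A F N \<longleftrightarrow> (\<forall>(U, \<phi>)\<in>A. \<forall>u\<in>U. \<exists>D1 D2.
     (lambda1 (F \<circ> \<phi>) (N \<circ> \<phi>) has_derivative D1) (at u) \<and>
     (lambda2 (F \<circ> \<phi>) (N \<circ> \<phi>) has_derivative D2) (at u) \<and>
     (\<forall>X Y. D1 X * D2 Y - D1 Y * D2 X = 0))"

section \<open>The surface of normal geodesics\<close>

text \<open>\<open>\<Gamma>\<close> maps a point of the surface to the oriented geodesic through its image with velocity
  the unit normal.\<close>

definition normal_geodesics :: "'m topology \<Rightarrow> ('m \<Rightarrow> real \<times> complex) \<Rightarrow> ('m \<Rightarrow> real \<times> complex) \<Rightarrow>
    ('m \<Rightarrow> complex option \<times> complex option) \<Rightarrow> bool" where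
  "normal_geodesics M F N \<Gamma> \<longleftrightarrow> (\<forall>x\<in>topspace M. \<Gamma> x \<in> LH3 \<and>
     (\<exists>r. geodesic (\<Gamma> x) r = F x \<and> (geodesic (\<Gamma> x) has_vector_derivative N x) (at r)))"

definition induced_metric :: "(real \<times> real \<Rightarrow> complex option \<times> complex option) \<Rightarrow>
    real \<times> real \<Rightarrow> real \<times> real \<Rightarrow> real \<times> real \<Rightarrow> real" where
  "induced_metric \<gamma> u X Y = (let c = chart_at (\<gamma> u) in
     L_metric c (L_coords c (\<gamma> u))
       (dir_deriv (L_coords c \<circ> \<gamma>) u X) (dir_deriv (L_coords c \<circ> \<gamma>) u Y))"

definition nondegenerate :: "('a::real_vector \<Rightarrow> 'a \<Rightarrow> real) \<Rightarrow> bool" where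
  "nondegenerate b \<longleftrightarrow> (\<forall>X. (\<forall>Y. b X Y = 0) \<longrightarrow> X = 0)"

end

theory Submission
  imports Defs
begin

text \<open>Let \<open>\<lambda>\<^sub>1, \<lambda>\<^sub>2\<close> be the principal curvatures and \<open>\<theta>\<^sub>1, \<theta>\<^sub>2\<close> the coframe dual to a frame of
  principal directions. Moving along the surface with velocity \<open>X\<close> changes the normal geodesic by
  the Jacobi field with initial values \<open>X\<close> and \<open>\<nabla>\<^sub>X N\<close>, and the neutral metric pairs the one,
  turned by a right angle, with the other. Since \<open>\<nabla>\<^sub>X N = - \<lambda>\<^sub>i X\<close> in a principal direction, the
  induced metric is \<open>(\<lambda>\<^sub>2 - \<lambda>\<^sub>1) \<theta>\<^sub>1 \<theta>\<^sub>2\<close> up to a constant factor: it degenerates exactly at the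
  umbilic points, and elsewhere its null directions are the principal ones.

  In a space of constant curvature the Codazzi equations say \<open>d ((\<lambda>\<^sub>2 - \<lambda>\<^sub>1) \<theta>\<^sub>1) = d\<lambda>\<^sub>2 \<and> \<theta>\<^sub>1\<close>
  and \<open>d ((\<lambda>\<^sub>1 - \<lambda>\<^sub>2) \<theta>\<^sub>2) = d\<lambda>\<^sub>1 \<and> \<theta>\<^sub>2\<close>. For the null coframe \<open>a = (\<lambda>\<^sub>2 - \<lambda>\<^sub>1) \<theta>\<^sub>1\<close>, \<open>b = \<theta>\<^sub>2\<close>
  of the induced metric they become \<open>da = - w \<and> a\<close> and \<open>db = w \<and> b\<close> with the single form
  \<open>w = - d\<lambda>\<^sub>2 / (\<lambda>\<^sub>2 - \<lambda>\<^sub>1)\<close>. These are the structure equations of a Lorentz surface, so the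
  curvature is the quotient of \<open>dw = - d\<lambda>\<^sub>1 \<and> d\<lambda>\<^sub>2 / (\<lambda>\<^sub>2 - \<lambda>\<^sub>1)\<^sup>2\<close> by \<open>a \<and> b\<close>, and it vanishes
  exactly where \<open>d\<lambda>\<^sub>1 \<and> d\<lambda>\<^sub>2\<close> does.

  The argument is carried out in the Euclidean geometry of the half-space. If \<open>f = (t, z)\<close> is the
  immersion and \<open>\<nu>\<close> its Euclidean unit normal, then \<open>\<lambda>\<^sub>i = t k\<^sub>i + \<nu>\<^sub>0\<close> with the Euclidean
  principal curvatures \<open>k\<^sub>i\<close>, and the principal directions agree. The vector-valued forms
  \<open>k\<^sub>i df + d\<nu>\<close> have rank one; with \<open>k\<^sub>2 df + d\<nu> = e\<^sub>1 a\<close> for a unit vector field \<open>e\<^sub>1\<close>, the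
  Codazzi equation is the scalar product of \<open>e\<^sub>1\<close> with the exterior derivative of this identity
  (\<open>codazzi\<close>). The lemma \<open>null_coframe.gauss_curvature_eq_0_iff\<close> computes the curvature from the
  structure equations, and \<open>induced_metric_eq\<close> identifies the induced metric with
  \<open>(det (\<nu>, df, d\<nu>)) / t\<close>, symmetrized. For the latter, an oriented geodesic is encoded by two
  null Hermitian matrices, its ideal end points seen as points of the light cone; up to a
  constant multiple of a power of \<open>t\<close>, the metric is the symmetrized determinant of these two
  matrices and their derivatives, whichever of the four charts is used.

  Concerning regularity, the normal is of class \<open>C\<^sup>3\<close> (\<open>C3_unit_normal\<close>), and \<open>\<lambda>\<^sub>1, \<lambda>\<^sub>2\<close> are of
  class \<open>C\<^sup>2\<close> because the discriminant is positive away from umbilic points.\<close>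

section \<open>Functions of class \<open>C\<^sup>k\<close>\<close>

lemma dir_deriv_eqI: "(f has_derivative f') (at x) \<Longrightarrow> dir_deriv f x v = f' v"
  using frechet_derivative_at by metis

lemma dir_deriv_cong:
  assumes "open U" "x \<in> U" "\<And>y. y \<in> U \<Longrightarrow> f y = g y"
  shows "dir_deriv f x v = dir_deriv g x v"
proof (cases "f differentiable (at x)")
  case True
  then have "(f has_derivative frechet_derivative f (at x)) (at x)"
    by (simp add: frechet_derivative_works)
  then have "(g has_derivative frechet_derivative f (at x)) (at x)"
    using has_derivative_transform_within_open[OF _ assms(1,2)] assms(3) by blast
  then show ?thesis by (metis frechet_derivative_at)
next
  case False
  then have "\<And>f'. (f has_derivative f') (at x) = False" "\<And>f'. (g has_derivative f') (at x) = False"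
    using has_derivative_transform_within_open[OF _ assms(1,2)] assms(3)
    unfolding differentiable_def by (metis, metis)
  then show ?thesis unfolding frechet_derivative_def by simp
qed

lemma Ck_on_cong:
  assumes "open U" "\<And>y. y \<in> U \<Longrightarrow> f y = g y" "Ck_on k f U"
  shows "Ck_on k g U"
  using assms(2,3)
proof (induction k arbitrary: f g)
  case 0
  then show ?case by (auto cong: continuous_on_cong)
next
  case (Suc k)
  have "g differentiable at x" if "x \<in> U" for x
    using Suc.prems that unfolding Ck_on.simps differentiable_def
    by (metis has_derivative_transform_within_open[OF _ assms(1) that])
  moreover have "Ck_on k (\<lambda>x. dir_deriv g x v) U" for v
  proof (rule Suc.IH)
    show "Ck_on k (\<lambda>x. dir_deriv f x v) U" using Suc.prems by simp
    show "dir_deriv f y v = dir_deriv g y v" if "y \<in> U" for y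
      using dir_deriv_cong[OF assms(1) that] Suc.prems(1) by blast
  qed
  ultimately show ?case by simp
qed

lemma Ck_on_subset:
  assumes "V \<subseteq> U" "Ck_on k f U"
  shows "Ck_on k f V"
  using assms(2) by (induction k arbitrary: f) (use assms(1) continuous_on_subset in auto)

lemma Ck_on_SucD: "Ck_on (Suc k) f U \<Longrightarrow> Ck_on k f U"
proof (induction k arbitrary: f)
  case 0
  then show ?case
    by (auto intro!: continuous_at_imp_continuous_on differentiable_imp_continuous_within)
qed auto

lemma Ck_on_mono: "j \<le> k \<Longrightarrow> Ck_on k f U \<Longrightarrow> Ck_on j f U"
  by (induction k rule: dec_induct) (use Ck_on_SucD in blast)+

lemma Ck_on_imp_continuous_on: "Ck_on k f U \<Longrightarrow> continuous_on U f"
  using Ck_on_mono[of 0 k] by simp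

lemma Ck_on_has_derivative:
  assumes "Ck_on k f U" "0 < k" "x \<in> U"
  shows "(f has_derivative dir_deriv f x) (at x)"
  using assms by (cases k) (auto simp: frechet_derivative_works[symmetric])

lemma Ck_on_dir_deriv: "Ck_on (Suc k) f U \<Longrightarrow> Ck_on k (\<lambda>x. dir_deriv f x v) U"
  by simp

text \<open>All closure properties follow the same scheme: the derivative is an expression in the
  functions and their derivatives, and it is enough to know it on an open set.\<close>

lemma Ck_on_SucI:
  assumes "open U" "\<And>x. x \<in> U \<Longrightarrow> (f has_derivative f' x) (at x)"
    and "\<And>v. Ck_on k (\<lambda>x. f' x v) U"
  shows "Ck_on (Suc k) f U"
proof -
  have "Ck_on k (\<lambda>x. dir_deriv f x v) U" for v
    by (rule Ck_on_cong[OF assms(1) _ assms(3)]) (simp add: dir_deriv_eqI[OF assms(2)])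
  with assms(2) show ?thesis by (auto simp: differentiable_def)
qed

lemma Ck_on_const: "Ck_on k (\<lambda>x. c) U"
  by (induction k arbitrary: c) auto

lemma Ck_on_linear:
  assumes "bounded_linear L" "open U" "Ck_on k f U"
  shows "Ck_on k (\<lambda>x. L (f x)) U"
  using assms(3)
proof (induction k arbitrary: f)
  case 0
  then show ?case using assms(1) by (auto intro: bounded_linear.continuous_on)
next
  case (Suc k)
  show ?case
    by (rule Ck_on_SucI[OF assms(2)], rule bounded_linear.has_derivative[OF assms(1)],
        rule Ck_on_has_derivative[OF Suc.prems], auto intro!: Suc.IH Ck_on_dir_deriv[OF Suc.prems])
qed

lemma Ck_on_add:
  assumes "open U" "Ck_on k f U" "Ck_on k g U"
  shows "Ck_on k (\<lambda>x. f x + g x) U"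
  using assms(2,3)
proof (induction k arbitrary: f g)
  case 0
  then show ?case by (auto intro: continuous_intros)
next
  case (Suc k)
  show ?case
  proof (rule Ck_on_SucI[OF assms(1)])
    show "((\<lambda>x. f x + g x) has_derivative (\<lambda>v. dir_deriv f x v + dir_deriv g x v)) (at x)"
      if "x \<in> U" for x
      using Suc.prems that by (intro has_derivative_add Ck_on_has_derivative[of "Suc k"]) auto
    show "Ck_on k (\<lambda>x. dir_deriv f x v + dir_deriv g x v) U" for v
      using Suc by simp
  qed
qed

lemma Ck_on_bilinear:
  assumes "bounded_bilinear B" "open U" "Ck_on k f U" "Ck_on k g U"
  shows "Ck_on k (\<lambda>x. B (f x) (g x)) U"
  using assms(3,4)
proof (induction k arbitrary: f g)
  case 0
  then show ?case using assms(1) by (auto intro: bounded_bilinear.continuous_on)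
next
  case (Suc k)
  show ?case
  proof (rule Ck_on_SucI[OF assms(2)])
    show "((\<lambda>x. B (f x) (g x)) has_derivative
        (\<lambda>v. B (f x) (dir_deriv g x v) + B (dir_deriv f x v) (g x))) (at x)" if "x \<in> U" for x
      using Suc.prems that
      by (intro bounded_bilinear.FDERIV[OF assms(1)] Ck_on_has_derivative[of "Suc k"]) auto
    show "Ck_on k (\<lambda>x. B (f x) (dir_deriv g x v) + B (dir_deriv f x v) (g x)) U" for v
      by (intro Ck_on_add assms(2) Suc.IH Ck_on_dir_deriv[OF Suc.prems(1)]
          Ck_on_dir_deriv[OF Suc.prems(2)] Ck_on_SucD[OF Suc.prems(1)] Ck_on_SucD[OF Suc.prems(2)])
  qed
qed

lemmas Ck_on_mult = Ck_on_bilinear[OF bounded_bilinear_mult]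
  and Ck_on_inner = Ck_on_bilinear[OF bounded_bilinear_inner]
  and Ck_on_scaleR = Ck_on_bilinear[OF bounded_bilinear_scaleR]
  and Ck_on_minus = Ck_on_linear[OF bounded_linear_minus[OF bounded_linear_ident]]
  and Ck_on_fst = Ck_on_linear[OF bounded_linear_fst]

lemma Ck_on_diff:
  assumes "open U" "Ck_on k f U" "Ck_on k g U"
  shows "Ck_on k (\<lambda>x. f x - g x) U"
  using Ck_on_add[OF assms(1,2) Ck_on_minus[OF assms(1,3)]] by simp

lemma Ck_on_Pair:
  assumes "open U" "Ck_on k f U" "Ck_on k g U"
  shows "Ck_on k (\<lambda>x. (f x, g x)) U"
proof -
  have "bounded_linear (\<lambda>x::'b. (x, 0::'c))" "bounded_linear (\<lambda>x::'c. (0::'b, x))"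
    by (auto intro!: bounded_linear_Pair bounded_linear_ident bounded_linear_zero)
  from Ck_on_add[OF assms(1) Ck_on_linear[OF this(1) assms(1,2)] Ck_on_linear[OF this(2)
    assms(1,3)]]
  show ?thesis by simp
qed

lemma Ck_on_inverse:
  fixes f :: "'a::real_normed_vector \<Rightarrow> real"
  assumes "open U" "Ck_on k f U" "\<And>x. x \<in> U \<Longrightarrow> f x \<noteq> 0"
  shows "Ck_on k (\<lambda>x. inverse (f x)) U"
  using assms(2)
proof (induction k)
  case 0
  then show ?case using assms(3) by (auto intro: continuous_intros)
next
  case (Suc k)
  show ?case
  proof (rule Ck_on_SucI[OF assms(1)])
    show "((\<lambda>x. inverse (f x)) has_derivative
        (\<lambda>v. - (inverse (f x) * dir_deriv f x v * inverse (f x)))) (at x)" if "x \<in> U" for x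
      using Suc.prems that assms(3)
      by (intro Deriv.has_derivative_inverse Ck_on_has_derivative[of "Suc k"]) auto
    show "Ck_on k (\<lambda>x. - (inverse (f x) * dir_deriv f x v * inverse (f x))) U" for v
      by (intro Ck_on_minus Ck_on_mult assms(1) Suc.IH Ck_on_dir_deriv Ck_on_SucD[OF Suc.prems]
          Suc.prems)
  qed
qed

lemma Ck_on_divide:
  fixes f g :: "'a::real_normed_vector \<Rightarrow> real"
  assumes "open U" "Ck_on k f U" "Ck_on k g U" "\<And>x. x \<in> U \<Longrightarrow> g x \<noteq> 0"
  shows "Ck_on k (\<lambda>x. f x / g x) U"
  using Ck_on_mult[OF assms(1,2) Ck_on_inverse[OF assms(1,3,4)]] by (simp add: divide_inverse)

lemma Ck_on_sqrt:
  fixes f :: "'a::real_normed_vector \<Rightarrow> real"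
  assumes "open U" "Ck_on k f U" "\<And>x. x \<in> U \<Longrightarrow> f x > 0"
  shows "Ck_on k (\<lambda>x. sqrt (f x)) U"
  using assms(2)
proof (induction k)
  case 0
  then show ?case by (auto intro: continuous_intros)
next
  case (Suc k)
  show ?case
  proof (rule Ck_on_SucI[OF assms(1)])
    show "((\<lambda>x. sqrt (f x)) has_derivative
        (\<lambda>v. dir_deriv f x v / (2 * sqrt (f x)))) (at x)" if "x \<in> U" for x
      using has_derivative_real_sqrt[OF assms(3)[OF that] Ck_on_has_derivative[OF Suc.prems _ that]]
      by (simp add: field_simps)
    show "Ck_on k (\<lambda>x. dir_deriv f x v / (2 * sqrt (f x))) U" for v
      by (intro Ck_on_divide Ck_on_mult Ck_on_const assms(1) Suc.IH Ck_on_dir_deriv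
          Ck_on_SucD[OF Suc.prems] Suc.prems) (use assms(3) less_imp_neq in fastforce)
  qed
qed

lemma DERIV_along_line:
  fixes f :: "'a::real_normed_vector \<Rightarrow> real"
  assumes "f differentiable (at (q + a *\<^sub>R X))"
  shows "((\<lambda>a. f (q + a *\<^sub>R X)) has_real_derivative dir_deriv f (q + a *\<^sub>R X) X) (at a)"
proof -
  have D: "(f has_derivative dir_deriv f (q + a *\<^sub>R X)) (at (q + a *\<^sub>R X))"
    using assms by (simp add: frechet_derivative_works)
  have "((\<lambda>a. q + a *\<^sub>R X) has_derivative (\<lambda>h. h *\<^sub>R X)) (at a)"
    by (auto intro!: derivative_eq_intros)
  then have "((\<lambda>a. f (q + a *\<^sub>R X)) has_derivative
      (\<lambda>h. dir_deriv f (q + a *\<^sub>R X) (h *\<^sub>R X))) (at a)"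
    by (rule has_derivative_compose) (rule D)
  then show ?thesis
    by (rule has_derivative_imp_has_field_derivative)
      (simp add: linear_scale[OF has_derivative_linear[OF D]])
qed

text \<open>The second difference of \<open>f\<close> over a parallelogram is, by two applications of the mean value
  theorem, a mixed second derivative at some point of it.\<close>

lemma second_difference:
  fixes f :: "'a::real_normed_vector \<Rightarrow> real"
  assumes f: "\<And>a b. 0 \<le> a \<Longrightarrow> a \<le> s \<Longrightarrow> 0 \<le> b \<Longrightarrow> b \<le> s \<Longrightarrow>
      f differentiable (at (p + a *\<^sub>R X + b *\<^sub>R Y)) \<and>
      (\<lambda>q. dir_deriv f q X) differentiable (at (p + a *\<^sub>R X + b *\<^sub>R Y))"
    and s: "0 < s"
  obtains a b where "0 < a" "a < s" "0 < b" "b < s"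
    "f (p + s *\<^sub>R X + s *\<^sub>R Y) - f (p + s *\<^sub>R X) - f (p + s *\<^sub>R Y) + f p
      = s\<^sup>2 * dir_deriv (\<lambda>q. dir_deriv f q X) (p + a *\<^sub>R X + b *\<^sub>R Y) Y"
proof -
  have d1: "((\<lambda>a. f (p + a *\<^sub>R X + b *\<^sub>R Y)) has_real_derivative
      dir_deriv f (p + a *\<^sub>R X + b *\<^sub>R Y) X) (at a)"
    if "0 \<le> a" "a \<le> s" "0 \<le> b" "b \<le> s" for a b
    using DERIV_along_line[of f "p + b *\<^sub>R Y" a X] f[OF that] by (simp add: algebra_simps)
  have d2: "((\<lambda>b. dir_deriv f (p + a *\<^sub>R X + b *\<^sub>R Y) X) has_real_derivative
      dir_deriv (\<lambda>q. dir_deriv f q X) (p + a *\<^sub>R X + b *\<^sub>R Y) Y) (at b)"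
    if "0 \<le> a" "a \<le> s" "0 \<le> b" "b \<le> s" for a b
    using DERIV_along_line[of "\<lambda>q. dir_deriv f q X" "p + a *\<^sub>R X" b Y] f[OF that] by simp
  define \<phi> where "\<phi> a = f (p + a *\<^sub>R X + s *\<^sub>R Y) - f (p + a *\<^sub>R X + 0 *\<^sub>R Y)" for a
  have "\<exists>a>0. a < s \<and> \<phi> s - \<phi> 0 = (s - 0) *
      (dir_deriv f (p + a *\<^sub>R X + s *\<^sub>R Y) X - dir_deriv f (p + a *\<^sub>R X + 0 *\<^sub>R Y) X)"
    unfolding \<phi>_def
    by (rule MVT2[OF s, where f = "\<lambda>a. f (p + a *\<^sub>R X + s *\<^sub>R Y) - f (p + a *\<^sub>R X + 0 *\<^sub>R Y)"])
      (rule DERIV_diff; rule d1; use s in simp)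
  then obtain a where a: "0 < a" "a < s" "\<phi> s - \<phi> 0 = s *
      (dir_deriv f (p + a *\<^sub>R X + s *\<^sub>R Y) X - dir_deriv f (p + a *\<^sub>R X + 0 *\<^sub>R Y) X)"
    by auto
  have "\<exists>b>0. b < s \<and>
      dir_deriv f (p + a *\<^sub>R X + s *\<^sub>R Y) X - dir_deriv f (p + a *\<^sub>R X + 0 *\<^sub>R Y) X
      = (s - 0) * dir_deriv (\<lambda>q. dir_deriv f q X) (p + a *\<^sub>R X + b *\<^sub>R Y) Y"
    by (rule MVT2[OF s, where f = "\<lambda>b. dir_deriv f (p + a *\<^sub>R X + b *\<^sub>R Y) X"])
      (rule d2; use a in simp)
  then obtain b where "0 < b" "b < s"
      "dir_deriv f (p + a *\<^sub>R X + s *\<^sub>R Y) X - dir_deriv f (p + a *\<^sub>R X + 0 *\<^sub>R Y) X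
      = s * dir_deriv (\<lambda>q. dir_deriv f q X) (p + a *\<^sub>R X + b *\<^sub>R Y) Y"
    by auto
  with a that show thesis
    by (simp add: \<phi>_def power2_eq_square)
qed

text \<open>If the mixed derivatives differed at \<open>p\<close>, then by continuity they would have different
  values everywhere near \<open>p\<close>; but each of them attains the same second difference on a small
  parallelogram.\<close>

lemma dir_deriv_commute_real:
  fixes f :: "'a::real_normed_vector \<Rightarrow> real"
  assumes U: "open U" "p \<in> U" and f: "Ck_on 2 f U"
  shows "dir_deriv (\<lambda>q. dir_deriv f q X) p Y = dir_deriv (\<lambda>q. dir_deriv f q Y) p X"
proof (rule ccontr)
  define h where "h q = dir_deriv (\<lambda>q. dir_deriv f q X) q Y" for q
  define k where "k q = dir_deriv (\<lambda>q. dir_deriv f q Y) q X" for q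
  assume "\<not> ?thesis"
  then have ne: "h p \<noteq> k p" by (simp add: h_def k_def)
  have cont: "continuous_on U h" "continuous_on U k"
    using f by (simp_all add: numeral_2_eq_2 h_def[abs_def] k_def[abs_def])
  have df: "f differentiable (at q)" "(\<lambda>q. dir_deriv f q v) differentiable (at q)"
    if "q \<in> U" for q v
    using f that by (simp_all add: numeral_2_eq_2)
  define e where "e = \<bar>h p - k p\<bar> / 2"
  have e: "e > 0" using ne by (simp add: e_def)
  have "\<forall>\<^sub>F q in at p. dist (h q) (h p) < e \<and> dist (k q) (k p) < e \<and> q \<in> U"
    using cont e U unfolding continuous_on_eq_continuous_at[OF U(1)]
    by (auto intro!: eventually_conj tendstoD eventually_at_in_open' simp: continuous_at)
  then obtain d where d: "d > 0"
    "\<And>q. q \<noteq> p \<Longrightarrow> dist q p < d \<Longrightarrow> dist (h q) (h p) < e \<and> dist (k q) (k p) < e \<and> q \<in> U"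
    unfolding eventually_at by auto
  have d': "dist (h q) (h p) < e" "dist (k q) (k p) < e" "q \<in> U" if "dist q p < d" for q
    using d(2)[of q] that e U(2) by (cases "q = p"; auto)+
  define s where "s = d / (norm X + norm Y + 1)"
  have pos: "norm X + norm Y + 1 > 0" by (simp add: add_nonneg_pos)
  then have s: "s > 0" using d by (simp add: s_def)
  have near: "dist (p + a *\<^sub>R X + b *\<^sub>R Y) p < d" if "0 \<le> a" "a \<le> s" "0 \<le> b" "b \<le> s" for a b
  proof -
    have "dist (p + a *\<^sub>R X + b *\<^sub>R Y) p \<le> norm (a *\<^sub>R X) + norm (b *\<^sub>R Y)"
      by (metis add.assoc add_diff_cancel_left' dist_norm norm_triangle_ineq)
    also have "\<dots> \<le> s * norm X + s * norm Y"
      using that by (intro add_mono) (auto intro: mult_right_mono)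
    also have "\<dots> < s * (norm X + norm Y + 1)" using s by (simp add: algebra_simps)
    also have "\<dots> = d" using pos by (simp add: s_def)
    finally show ?thesis .
  qed
  obtain a b where ab: "0 < a" "a < s" "0 < b" "b < s"
    "f (p + s *\<^sub>R X + s *\<^sub>R Y) - f (p + s *\<^sub>R X) - f (p + s *\<^sub>R Y) + f p
      = s\<^sup>2 * h (p + a *\<^sub>R X + b *\<^sub>R Y)"
    unfolding h_def
    by (rule second_difference[of s f p X Y]) (use df d'(3) near s in auto)
  have near': "dist (p + b *\<^sub>R Y + a *\<^sub>R X) p < d" if "0 \<le> a" "a \<le> s" "0 \<le> b" "b \<le> s" for a b
    using near[OF that] by (simp add: algebra_simps)
  obtain a' b' where ab': "0 < a'" "a' < s" "0 < b'" "b' < s"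
    "f (p + s *\<^sub>R Y + s *\<^sub>R X) - f (p + s *\<^sub>R Y) - f (p + s *\<^sub>R X) + f p
      = s\<^sup>2 * k (p + a' *\<^sub>R Y + b' *\<^sub>R X)"
    unfolding k_def
    by (rule second_difference[of s f p Y X])
      (use df d'(3) near' s in auto)
  have swap: "p + s *\<^sub>R Y + s *\<^sub>R X = p + s *\<^sub>R X + s *\<^sub>R Y" by simp
  have "s\<^sup>2 * h (p + a *\<^sub>R X + b *\<^sub>R Y) = s\<^sup>2 * k (p + a' *\<^sub>R Y + b' *\<^sub>R X)"
    using ab(5) ab'(5)[unfolded swap] by linarith
  then have "h (p + a *\<^sub>R X + b *\<^sub>R Y) = k (p + a' *\<^sub>R Y + b' *\<^sub>R X)"
    using s by simp
  moreover have "dist (h (p + a *\<^sub>R X + b *\<^sub>R Y)) (h p) < e"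
    "dist (k (p + a' *\<^sub>R Y + b' *\<^sub>R X)) (k p) < e"
    using ab ab' by (intro d' near near'; simp)+
  ultimately show False
    using dist_triangle_less_add[of "h p" "h (p + a *\<^sub>R X + b *\<^sub>R Y)" e "k p" e]
    by (simp add: dist_commute dist_real_def e_def)
qed

lemma dir_deriv_commute:
  fixes f :: "'a::real_normed_vector \<Rightarrow> 'b::real_inner"
  assumes U: "open U" "p \<in> U" and f: "Ck_on 2 f U"
  shows "dir_deriv (\<lambda>q. dir_deriv f q X) p Y = dir_deriv (\<lambda>q. dir_deriv f q Y) p X"
proof -
  have 1: "dir_deriv (\<lambda>q. f q \<bullet> c) q v = dir_deriv f q v \<bullet> c" if "q \<in> U" for c q v
  proof -
    have "(f has_derivative dir_deriv f q) (at q)" by (rule Ck_on_has_derivative[OF f _ that]) simp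
    from dir_deriv_eqI[OF has_derivative_inner_left[OF this]] show ?thesis .
  qed
  have 2: "dir_deriv (\<lambda>q. dir_deriv (\<lambda>q. f q \<bullet> c) q v) p w
      = dir_deriv (\<lambda>q. dir_deriv f q v) p w \<bullet> c" for c v w
  proof -
    have "((\<lambda>q. dir_deriv f q v) has_derivative dir_deriv (\<lambda>q. dir_deriv f q v) p) (at p)"
      using Ck_on_has_derivative[OF Ck_on_dir_deriv, of 1] f U by (simp add: numeral_2_eq_2)
    from dir_deriv_eqI[OF has_derivative_inner_left[OF this]]
    have "dir_deriv (\<lambda>q. dir_deriv f q v \<bullet> c) p w
        = dir_deriv (\<lambda>q. dir_deriv f q v) p w \<bullet> c" .
    moreover have "dir_deriv (\<lambda>q. dir_deriv (\<lambda>q. f q \<bullet> c) q v) p w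
        = dir_deriv (\<lambda>q. dir_deriv f q v \<bullet> c) p w"
      by (rule dir_deriv_cong[OF U]) (rule 1)
    ultimately show ?thesis by (rule trans[rotated])
  qed
  have "dir_deriv (\<lambda>q. dir_deriv f q X) p Y \<bullet> c = dir_deriv (\<lambda>q. dir_deriv f q Y) p X \<bullet> c" for c
    using dir_deriv_commute_real[OF U, where f = "\<lambda>q. f q \<bullet> c" and X = X and Y = Y]
      Ck_on_inner[OF U(1) f Ck_on_const[of 2 c]] unfolding 2 by blast
  then show ?thesis using vector_eq_rdot by blast
qed

section \<open>Curvature of a metric given by a null coframe\<close>

lemma linear_real_pair:
  assumes "linear (f :: real \<times> real \<Rightarrow> real)"
  shows "f v = fst v * f (1, 0) + snd v * f (0, 1)"
proof -
  have "v = fst v *\<^sub>R (1, 0) + snd v *\<^sub>R (0, 1)" by (simp add: prod_eq_iff)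
  then have "f v = f (fst v *\<^sub>R (1, 0) + snd v *\<^sub>R (0, 1))" by simp
  also have "\<dots> = fst v * f (1, 0) + snd v * f (0, 1)"
    unfolding linear_add[OF assms] linear_scale[OF assms] by simp
  finally show ?thesis .
qed

text \<open>The product rule for a form evaluated on a vector field; it separates the derivative of the
  form from that of the field.\<close>

lemma has_derivative_form_apply:
  fixes a :: "'a::real_normed_vector \<Rightarrow> real \<times> real \<Rightarrow> real"
  assumes V: "open V" "p \<in> V" and lin: "\<And>q. q \<in> V \<Longrightarrow> linear (a q)"
    and a: "\<And>v. (\<lambda>q. a q v) differentiable (at p)" and C: "C differentiable (at p)"
  shows "((\<lambda>q. a q (C q)) has_derivative
      (\<lambda>X. dir_deriv (\<lambda>q. a q (C p)) p X + a p (dir_deriv C p X))) (at p)"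
proof -
  have e: "a q v = fst v * a q (1, 0) + snd v * a q (0, 1)" if "q \<in> V" for q v
    by (rule linear_real_pair[OF lin[OF that]])
  have 1: "((\<lambda>q. a q v) has_derivative dir_deriv (\<lambda>q. a q v) p) (at p)" for v
    using a by (simp add: frechet_derivative_works)
  have 2: "(C has_derivative dir_deriv C p) (at p)"
    using C by (simp add: frechet_derivative_works)
  have 3: "dir_deriv (\<lambda>q. a q v) p X
      = fst v * dir_deriv (\<lambda>q. a q (1, 0)) p X + snd v * dir_deriv (\<lambda>q. a q (0, 1)) p X" for v X
  proof -
    have "((\<lambda>q. fst v * a q (1, 0) + snd v * a q (0, 1)) has_derivative
        (\<lambda>X. fst v * dir_deriv (\<lambda>q. a q (1, 0)) p X
          + snd v * dir_deriv (\<lambda>q. a q (0, 1)) p X)) (at p)"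
      by (auto intro!: derivative_eq_intros 1)
    moreover have "dir_deriv (\<lambda>q. a q v) p X
        = dir_deriv (\<lambda>q. fst v * a q (1, 0) + snd v * a q (0, 1)) p X"
      by (rule dir_deriv_cong[OF V]) (rule e)
    ultimately show ?thesis by (simp add: dir_deriv_eqI)
  qed
  have "((\<lambda>q. fst (C q) * a q (1, 0) + snd (C q) * a q (0, 1)) has_derivative
      (\<lambda>X. dir_deriv (\<lambda>q. a q (C p)) p X + a p (dir_deriv C p X))) (at p)"
    by (rule derivative_eq_intros 1 2 refl)+
      (simp add: fun_eq_iff 3[of "C p"] e[OF V(2), of "dir_deriv C p _"])
  then show ?thesis
    by (rule has_derivative_transform_within_open[OF _ V]) (simp add: e[symmetric])
qed

text \<open>For \<open>g = 2 a b\<close> the Levi-Civita connection is diagonal in the dual frame, so it is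
  described by the single form \<open>w\<close> with \<open>da = - w \<and> a\<close> and \<open>db = w \<and> b\<close>. These structure
  equations determine \<open>w\<close>, and \<open>dw\<close> is the curvature.\<close>

locale null_coframe =
  fixes V :: "(real \<times> real) set"
    and g :: "real \<times> real \<Rightarrow> real \<times> real \<Rightarrow> real \<times> real \<Rightarrow> real"
    and a b w :: "real \<times> real \<Rightarrow> real \<times> real \<Rightarrow> real"
  assumes V: "open V"
    and g: "\<And>q X Y. q \<in> V \<Longrightarrow> g q X Y = a q X * b q Y + a q Y * b q X"
    and lin: "\<And>q. q \<in> V \<Longrightarrow> linear (a q)" "\<And>q. q \<in> V \<Longrightarrow> linear (b q)"
    and C2: "\<And>X. Ck_on 2 (\<lambda>q. a q X) V" "\<And>X. Ck_on 2 (\<lambda>q. b q X) V"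
    and C1: "\<And>X. Ck_on 1 (\<lambda>q. w q X) V"
    and independent: "\<And>q. q \<in> V \<Longrightarrow> a q (1, 0) * b q (0, 1) - a q (0, 1) * b q (1, 0) \<noteq> 0"
    and da: "\<And>q X Y. q \<in> V \<Longrightarrow> dir_deriv (\<lambda>q. a q Y) q X - dir_deriv (\<lambda>q. a q X) q Y
      = w q Y * a q X - w q X * a q Y"
    and db: "\<And>q X Y. q \<in> V \<Longrightarrow> dir_deriv (\<lambda>q. b q Y) q X - dir_deriv (\<lambda>q. b q X) q Y
      = w q X * b q Y - w q Y * b q X"
begin

lemma coframe_eqI:
  assumes "q \<in> V" "a q Z = a q Z'" "b q Z = b q Z'"
  shows "Z = Z'"
proof -
  note e = linear_real_pair[OF lin(1)[OF assms(1)]] linear_real_pair[OF lin(2)[OF assms(1)]]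
  have "(fst Z - fst Z') * (a q (1, 0) * b q (0, 1) - a q (0, 1) * b q (1, 0)) = 0"
    "(snd Z - snd Z') * (a q (1, 0) * b q (0, 1) - a q (0, 1) * b q (1, 0)) = 0"
    using assms(2,3) unfolding e[of Z] e[of Z'] by algebra+
  then show ?thesis using independent[OF assms(1)] by (simp add: prod_eq_iff)
qed

text \<open>The components of the covariant derivative of a constant field in the dual frame; inverting
  the coframe by Cramer's rule turns them into a vector.\<close>

definition nabla_a where
  "nabla_a q X Y = dir_deriv (\<lambda>q. a q Y) q X + w q X * a q Y"

definition nabla_b where
  "nabla_b q X Y = dir_deriv (\<lambda>q. b q Y) q X - w q X * b q Y"

definition levi_civita where
  "levi_civita q X Y = (let d = a q (1, 0) * b q (0, 1) - a q (0, 1) * b q (1, 0) in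
     ((nabla_a q X Y * b q (0, 1) - a q (0, 1) * nabla_b q X Y) / d,
      (a q (1, 0) * nabla_b q X Y - b q (1, 0) * nabla_a q X Y) / d))"

lemma a_levi_civita: "q \<in> V \<Longrightarrow> a q (levi_civita q X Y) = nabla_a q X Y"
  and b_levi_civita: "q \<in> V \<Longrightarrow> b q (levi_civita q X Y) = nabla_b q X Y"
proof -
  assume q: "q \<in> V"
  define d where "d = a q (1, 0) * b q (0, 1) - a q (0, 1) * b q (1, 0)"
  have d: "d \<noteq> 0" using independent[OF q] by (simp add: d_def)
  have "d * a q (levi_civita q X Y) = d * nabla_a q X Y"
    "d * b q (levi_civita q X Y) = d * nabla_b q X Y"
    unfolding linear_real_pair[OF lin(1)[OF q], of "levi_civita q X Y"]
      linear_real_pair[OF lin(2)[OF q], of "levi_civita q X Y"]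
    unfolding levi_civita_def Let_def d_def[symmetric] fst_conv snd_conv
    using d by (simp_all add: distrib_left) (simp_all add: d_def algebra_simps)
  with d show "a q (levi_civita q X Y) = nabla_a q X Y"
    "b q (levi_civita q X Y) = nabla_b q X Y" by simp_all
qed

lemma diff_a: "q \<in> V \<Longrightarrow> ((\<lambda>q. a q X) has_derivative dir_deriv (\<lambda>q. a q X) q) (at q)"
  and diff_b: "q \<in> V \<Longrightarrow> ((\<lambda>q. b q X) has_derivative dir_deriv (\<lambda>q. b q X) q) (at q)"
  and diff_w: "q \<in> V \<Longrightarrow> ((\<lambda>q. w q X) has_derivative dir_deriv (\<lambda>q. w q X) q) (at q)"
  by (rule Ck_on_has_derivative[OF C2(1)] Ck_on_has_derivative[OF C2(2)]
      Ck_on_has_derivative[OF C1]; simp)+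

lemma dir_deriv_g:
  assumes "q \<in> V"
  shows "dir_deriv (\<lambda>q. g q X Y) q W
    = dir_deriv (\<lambda>q. a q X) q W * b q Y + a q X * dir_deriv (\<lambda>q. b q Y) q W
      + dir_deriv (\<lambda>q. a q Y) q W * b q X + a q Y * dir_deriv (\<lambda>q. b q X) q W"
proof -
  have "dir_deriv (\<lambda>q. g q X Y) q W = dir_deriv (\<lambda>q. a q X * b q Y + a q Y * b q X) q W"
    by (rule dir_deriv_cong[OF V assms]) (rule g)
  also have "\<dots> = dir_deriv (\<lambda>q. a q X) q W * b q Y + a q X * dir_deriv (\<lambda>q. b q Y) q W
      + dir_deriv (\<lambda>q. a q Y) q W * b q X + a q Y * dir_deriv (\<lambda>q. b q X) q W"
    by (rule dir_deriv_eqI) (auto intro!: derivative_eq_intros diff_a diff_b assms)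
  finally show ?thesis .
qed

lemma nondegenerate_g:
  assumes "q \<in> V" "\<And>W. g q Z W = g q Z' W"
  shows "Z = Z'"
proof (rule coframe_eqI[OF assms(1)])
  note e = linear_real_pair[OF lin(1)[OF assms(1)]] linear_real_pair[OF lin(2)[OF assms(1)]]
  let ?d = "a q (1, 0) * b q (0, 1) - a q (0, 1) * b q (1, 0)"
  have 1: "(a q Z - a q Z') * b q W + (b q Z - b q Z') * a q W = 0" for W
    using assms(2)[of W] g[OF assms(1)] by (simp add: algebra_simps)
  have "(a q Z - a q Z') * ?d = 0" "(b q Z - b q Z') * ?d = 0"
    using 1[of "(1, 0)"] 1[of "(0, 1)"] by algebra+
  then show "a q Z = a q Z'" "b q Z = b q Z'" using independent[OF assms(1)] by simp_all
qed

text \<open>The structure equations make the connection torsion-free, and it preserves \<open>g\<close> because \<open>w\<close>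
  acts on the two factors with opposite signs; this is the Koszul formula.\<close>

lemma christoffel_eq:
  assumes q: "q \<in> V"
  shows "christoffel g q X Y = levi_civita q X Y"
  unfolding christoffel_def
proof (rule the_equality)
  show koszul: "\<forall>W. 2 * g q (levi_civita q X Y) W = dir_deriv (\<lambda>q. g q Y W) q X
      + dir_deriv (\<lambda>q. g q X W) q Y - dir_deriv (\<lambda>q. g q X Y) q W"
  proof
    fix W
    have da': "dir_deriv (\<lambda>q. a q Y) q X
        = dir_deriv (\<lambda>q. a q X) q Y + w q Y * a q X - w q X * a q Y"
      and db': "dir_deriv (\<lambda>q. b q Y) q X
        = dir_deriv (\<lambda>q. b q X) q Y + w q X * b q Y - w q Y * b q X" for X Y
      using da[OF q, of Y X] db[OF q, of Y X] by simp_all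
    show "2 * g q (levi_civita q X Y) W = dir_deriv (\<lambda>q. g q Y W) q X
      + dir_deriv (\<lambda>q. g q X W) q Y - dir_deriv (\<lambda>q. g q X Y) q W"
      unfolding g[OF q] a_levi_civita[OF q] b_levi_civita[OF q] dir_deriv_g[OF q] nabla_a_def
        nabla_b_def
      unfolding da'[of X Y] da'[of X W] da'[of Y W] db'[of X Y] db'[of X W] db'[of Y W]
      by (simp add: algebra_simps)
  qed
  fix Z assume Z: "\<forall>W. 2 * g q Z W = dir_deriv (\<lambda>q. g q Y W) q X
      + dir_deriv (\<lambda>q. g q X W) q Y - dir_deriv (\<lambda>q. g q X Y) q W"
  show "Z = levi_civita q X Y"
  proof (rule nondegenerate_g[OF q])
    show "g q Z W = g q (levi_civita q X Y) W" for W
      using spec[OF koszul, of W] spec[OF Z, of W] by linarith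
  qed
qed

lemma C1_deriv:
  "Ck_on 1 (\<lambda>q. dir_deriv (\<lambda>q. a q X) q Y) V" "Ck_on 1 (\<lambda>q. dir_deriv (\<lambda>q. b q X) q Y) V"
  using Ck_on_dir_deriv[of 1 "\<lambda>q. a q X" V Y] Ck_on_dir_deriv[of 1 "\<lambda>q. b q X" V Y] C2[of X]
  unfolding numeral_2_eq_2 One_nat_def by blast+

lemma differentiable_levi_civita:
  assumes "q \<in> V"
  shows "(\<lambda>q. levi_civita q X Y) differentiable (at q)"
proof -
  have C1': "Ck_on 1 (\<lambda>q. a q X) V" "Ck_on 1 (\<lambda>q. b q X) V" for X
    using Ck_on_mono[OF _ C2(1), of 1] Ck_on_mono[OF _ C2(2), of 1] by simp_all
  have "Ck_on 1 (\<lambda>q. levi_civita q X Y) V"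
    unfolding levi_civita_def Let_def nabla_a_def nabla_b_def
    by (intro Ck_on_Pair Ck_on_divide Ck_on_mult Ck_on_add Ck_on_diff V C1 C1' C1_deriv independent)
  from Ck_on_has_derivative[OF this _ assms] show ?thesis
    by (intro differentiableI) simp
qed

definition dw where
  "dw q X Y = dir_deriv (\<lambda>q. w q Y) q X - dir_deriv (\<lambda>q. w q X) q Y"

text \<open>The terms with the connection applied to itself cancel against those in which the coframe
  is differentiated along the Christoffel vector.\<close>

lemma a_riemann:
  assumes p: "p \<in> V"
  shows "a p (riemann g p X Y Z) = dw p X Y * a p Z"
proof -
  have chr': "dir_deriv (\<lambda>q. christoffel g q Y Z) p X
    = dir_deriv (\<lambda>q. levi_civita q Y Z) p X" for X Y Z
    by (rule dir_deriv_cong[OF V p]) (rule christoffel_eq)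
  have 1: "a p (dir_deriv (\<lambda>q. levi_civita q Y Z) p X)
      = dir_deriv (\<lambda>q. dir_deriv (\<lambda>q. a q Z) q Y) p X + dir_deriv (\<lambda>q. w q Y) p X * a p Z
        + w p Y * dir_deriv (\<lambda>q. a q Z) p X - dir_deriv (\<lambda>q. a q (levi_civita p Y Z)) p X" for X Y
  proof -
    have "((\<lambda>q. a q (levi_civita q Y Z)) has_derivative
        (\<lambda>X. dir_deriv (\<lambda>q. a q (levi_civita p Y Z)) p X
          + a p (dir_deriv (\<lambda>q. levi_civita q Y Z) p X))) (at p)"
      by (rule has_derivative_form_apply[where a = a and C = "\<lambda>q. levi_civita q Y Z", OF V p])
        (rule lin differentiableI[OF diff_a] differentiable_levi_civita p | assumption)+
    from dir_deriv_eqI[OF this]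
    have "dir_deriv (\<lambda>q. a q (levi_civita p Y Z)) p X + a p (dir_deriv (\<lambda>q. levi_civita q Y Z) p X)
        = dir_deriv (\<lambda>q. a q (levi_civita q Y Z)) p X" by simp
    also have "\<dots> = dir_deriv (\<lambda>q. nabla_a q Y Z) p X"
      by (rule dir_deriv_cong[OF V p]) (rule a_levi_civita)
    also have "((\<lambda>q. dir_deriv (\<lambda>q. a q Z) q Y) has_derivative
        dir_deriv (\<lambda>q. dir_deriv (\<lambda>q. a q Z) q Y) p) (at p)"
      by (rule Ck_on_has_derivative[OF C1_deriv(1) _ p]) simp
    then have "dir_deriv (\<lambda>q. nabla_a q Y Z) p X
      = dir_deriv (\<lambda>q. dir_deriv (\<lambda>q. a q Z) q Y) p X
        + (w p Y * dir_deriv (\<lambda>q. a q Z) p X + dir_deriv (\<lambda>q. w q Y) p X * a p Z)"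
      unfolding nabla_a_def
      by (intro dir_deriv_eqI has_derivative_add has_derivative_mult diff_a diff_w p)
    finally show ?thesis by simp
  qed
  have sym: "dir_deriv (\<lambda>q. dir_deriv (\<lambda>q. a q Z) q Y) p X
    = dir_deriv (\<lambda>q. dir_deriv (\<lambda>q. a q Z) q X) p Y"
    by (rule dir_deriv_commute_real[OF V p C2(1)])
  show ?thesis
    unfolding riemann_def chr' christoffel_eq[OF p]
    unfolding linear_add[OF lin(1)[OF p]] linear_diff[OF lin(1)[OF p]]
    unfolding 1 sym a_levi_civita[OF p]
    by (simp add: nabla_a_def a_levi_civita[OF p] dw_def algebra_simps)
qed

lemma b_riemann:
  assumes p: "p \<in> V"
  shows "b p (riemann g p X Y Z) = - dw p X Y * b p Z"
proof -
  have chr': "dir_deriv (\<lambda>q. christoffel g q Y Z) p X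
    = dir_deriv (\<lambda>q. levi_civita q Y Z) p X" for X Y Z
    by (rule dir_deriv_cong[OF V p]) (rule christoffel_eq)
  have 1: "b p (dir_deriv (\<lambda>q. levi_civita q Y Z) p X)
      = dir_deriv (\<lambda>q. dir_deriv (\<lambda>q. b q Z) q Y) p X - dir_deriv (\<lambda>q. w q Y) p X * b p Z
        - w p Y * dir_deriv (\<lambda>q. b q Z) p X - dir_deriv (\<lambda>q. b q (levi_civita p Y Z)) p X" for X Y
  proof -
    have "((\<lambda>q. b q (levi_civita q Y Z)) has_derivative
        (\<lambda>X. dir_deriv (\<lambda>q. b q (levi_civita p Y Z)) p X
          + b p (dir_deriv (\<lambda>q. levi_civita q Y Z) p X))) (at p)"
      by (rule has_derivative_form_apply[where a = b and C = "\<lambda>q. levi_civita q Y Z", OF V p])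
        (rule lin differentiableI[OF diff_b] differentiable_levi_civita p | assumption)+
    from dir_deriv_eqI[OF this]
    have "dir_deriv (\<lambda>q. b q (levi_civita p Y Z)) p X + b p (dir_deriv (\<lambda>q. levi_civita q Y Z) p X)
        = dir_deriv (\<lambda>q. b q (levi_civita q Y Z)) p X" by simp
    also have "\<dots> = dir_deriv (\<lambda>q. nabla_b q Y Z) p X"
      by (rule dir_deriv_cong[OF V p]) (rule b_levi_civita)
    also have "((\<lambda>q. dir_deriv (\<lambda>q. b q Z) q Y) has_derivative
        dir_deriv (\<lambda>q. dir_deriv (\<lambda>q. b q Z) q Y) p) (at p)"
      by (rule Ck_on_has_derivative[OF C1_deriv(2) _ p]) simp
    then have "dir_deriv (\<lambda>q. nabla_b q Y Z) p X
      = dir_deriv (\<lambda>q. dir_deriv (\<lambda>q. b q Z) q Y) p X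
        - (w p Y * dir_deriv (\<lambda>q. b q Z) p X + dir_deriv (\<lambda>q. w q Y) p X * b p Z)"
      unfolding nabla_b_def
      by (intro dir_deriv_eqI has_derivative_diff has_derivative_mult diff_b diff_w p)
    finally show ?thesis by simp
  qed
  have sym: "dir_deriv (\<lambda>q. dir_deriv (\<lambda>q. b q Z) q Y) p X
    = dir_deriv (\<lambda>q. dir_deriv (\<lambda>q. b q Z) q X) p Y"
    by (rule dir_deriv_commute_real[OF V p C2(2)])
  show ?thesis
    unfolding riemann_def chr' christoffel_eq[OF p]
    unfolding linear_add[OF lin(2)[OF p]] linear_diff[OF lin(2)[OF p]]
    unfolding 1 sym b_levi_civita[OF p]
    by (simp add: nabla_b_def b_levi_civita[OF p] dw_def algebra_simps)
qed

lemma gauss_curvature_eq_0_iff: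
  assumes p: "p \<in> V"
  shows "gauss_curvature g p = 0 \<longleftrightarrow> dw p (1, 0) (0, 1) = 0"
proof -
  let ?d = "a p (1, 0) * b p (0, 1) - a p (0, 1) * b p (1, 0)"
  have "g p (riemann g p (1, 0) (0, 1) (0, 1)) (1, 0) = - dw p (1, 0) (0, 1) * ?d"
    unfolding g[OF p] a_riemann[OF p] b_riemann[OF p] by (simp add: algebra_simps)
  moreover have "g p (1, 0) (1, 0) * g p (0, 1) (0, 1) - (g p (1, 0) (0, 1))\<^sup>2 = - ?d\<^sup>2"
    unfolding g[OF p] by (simp add: power2_eq_square algebra_simps)
  ultimately show ?thesis
    using independent[OF p] unfolding gauss_curvature_def Let_def by simp
qed

end

section \<open>The induced metric on the normal congruence\<close>

text \<open>The triple product of \<open>\<real> \<times> \<complex> = \<real>\<^sup>3\<close>.\<close>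

definition det3 :: "real \<times> complex \<Rightarrow> real \<times> complex \<Rightarrow> real \<times> complex \<Rightarrow> real" where
  "det3 u v w = fst u * Im (cnj (snd v) * snd w) - fst v * Im (cnj (snd u) * snd w)
     + fst w * Im (cnj (snd u) * snd v)"

text \<open>The determinant of four Hermitian matrices with diagonal \<open>a, b\<close> and upper corner \<open>w\<close>, as
  vectors \<open>(a, b, Re w, Im w)\<close> of Minkowski space, expanded along the first two columns. It is
  invariant under the action of \<open>SL\<^sub>2(\<complex>)\<close> by isometries of hyperbolic space.\<close>

definition herm_det where
  "herm_det a1 w1 b1 a2 w2 b2 a3 w3 b3 a4 w4 b4 =
       (a1 * b2 - a2 * b1) * Im (cnj w3 * w4) - (a1 * b3 - a3 * b1) * Im (cnj w2 * w4)
     + (a1 * b4 - a4 * b1) * Im (cnj w2 * w3) + (a2 * b3 - a3 * b2) * Im (cnj w1 * w4)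
     - (a2 * b4 - a4 * b2) * Im (cnj w1 * w3) + (a3 * b4 - a4 * b3) * Im (cnj w1 * (w2::complex))"

text \<open>For spinors \<open>P, Q\<close> the determinant of \<open>Q Q\<^sup>*\<close>, \<open>P P\<^sup>*\<close> and derivatives of these matrices
  is, up to sign, the imaginary part of \<open>(P \<and> dP) (Q \<and> dQ) cnj (P \<and> Q)\<^sup>2\<close>: the derivatives of
  scalar factors drop out. The four identities are the cases in which the end point \<open>1 / cnj \<mu>\<^sub>2\<close>
  is given by \<open>Q = (1, cnj m\<^sub>2)\<close> or \<open>(cnj m\<^sub>2, 1)\<close>, and the start point \<open>- \<mu>\<^sub>1\<close> by
  \<open>P = (- m\<^sub>1, 1)\<close> or \<open>(- 1, m\<^sub>1)\<close>; a letter T stands for an inverted coordinate.\<close>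

lemma herm_det_chart_FF:
  "herm_det a (complex_of_real a * m2) (a * (cmod m2)\<^sup>2) (b * (cmod m1)\<^sup>2) (- (complex_of_real b
    * m1)) b
     da (of_real da * m2 + of_real a * d2) (da * (cmod m2)\<^sup>2 + 2 * a * Re (cnj m2 * d2))
     (db * (cmod m1)\<^sup>2 + 2 * b * Re (cnj m1 * d1)) (- (of_real db * m1 + of_real b * d1)) db
   = - (a\<^sup>2 * b\<^sup>2) * Im (d1 * cnj d2 * cnj ((1 + m1 * cnj m2)\<^sup>2))"
  unfolding herm_det_def cmod_power2
  by (simp add: power2_eq_square algebra_simps)

lemma herm_det_chart_TT:
  "herm_det (b * (cmod m2)\<^sup>2) (of_real b * cnj m2) b a (- (complex_of_real a * cnj m1)) (a *
    (cmod m1)\<^sup>2)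
     (db * (cmod m2)\<^sup>2 + 2 * b * Re (cnj m2 * d2)) (of_real db * cnj m2 + of_real b * cnj d2) db
     da (- (of_real da * cnj m1 + of_real a * cnj d1)) (da * (cmod m1)\<^sup>2 + 2 * a * Re (cnj m1 * d1))
   = - (a\<^sup>2 * b\<^sup>2) * Im (d1 * cnj d2 * cnj ((1 + m1 * cnj m2)\<^sup>2))"
  unfolding herm_det_def cmod_power2
  by (simp add: power2_eq_square algebra_simps)

lemma herm_det_chart_TF:
  "herm_det a (complex_of_real a * m2) (a * (cmod m2)\<^sup>2) b (- (complex_of_real b * cnj m1)) (b *
    (cmod m1)\<^sup>2)
     da (of_real da * m2 + of_real a * d2) (da * (cmod m2)\<^sup>2 + 2 * a * Re (cnj m2 * d2))
     db (- (of_real db * cnj m1 + of_real b * cnj d1)) (db * (cmod m1)\<^sup>2 + 2 * b * Re (cnj m1 * d1))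
   = (a\<^sup>2 * b\<^sup>2) * Im (d1 * cnj d2 * cnj ((m1 + cnj m2)\<^sup>2))"
  unfolding herm_det_def cmod_power2
  by (simp add: power2_eq_square algebra_simps)

lemma herm_det_chart_FT:
  "herm_det (a * (cmod m2)\<^sup>2) (of_real a * cnj m2) a (b * (cmod m1)\<^sup>2) (- (complex_of_real b *
    m1)) b
     (da * (cmod m2)\<^sup>2 + 2 * a * Re (cnj m2 * d2)) (of_real da * cnj m2 + of_real a * cnj d2) da
     (db * (cmod m1)\<^sup>2 + 2 * b * Re (cnj m1 * d1)) (- (of_real db * m1 + of_real b * d1)) db
   = (a\<^sup>2 * b\<^sup>2) * Im (d1 * cnj d2 * cnj ((m1 + cnj m2)\<^sup>2))"
  unfolding herm_det_def cmod_power2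
  by (simp add: power2_eq_square algebra_simps)

text \<open>The entries \<open>a, w, b\<close> of the null Hermitian matrix of the ideal point to which the geodesic
  from \<open>x\<close> with Euclidean unit direction \<open>u\<close> converges; this point is \<open>w / b\<close>. With \<open>- u\<close> one
  gets the ideal point from which the geodesic starts.\<close>

definition null_a where
  "null_a x u = (1 - fst u) * (cmod (snd x))\<^sup>2 + 2 * fst x * Re (cnj (snd x) * snd u) + (1
    + fst u) * (fst x :: real)\<^sup>2"
definition null_w where
  "null_w x u = of_real (1 - fst u) * snd x + complex_of_real (fst x) * snd u"
definition null_b where
  "null_b u = 1 - (fst u :: real)"
definition dnull_a where
  "dnull_a x u dx du = - fst du * (cmod (snd x))\<^sup>2 + (1 - fst u) * (2 * Re (cnj (snd x) * snd dx))
    + 2 * (fst dx * Re (cnj (snd x) * snd u) + fst x * Re (cnj (snd dx) * snd u)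
      + fst x * Re (cnj (snd x) * snd du))
    + fst du * (fst x)\<^sup>2 + 2 * (1 + fst u) * fst x * fst dx"
definition dnull_w where
  "dnull_w x u dx du = of_real (1 - fst u) * snd dx - of_real (fst du) * snd x +
     of_real (fst dx) * snd u + of_real (fst x) * snd du"

text \<open>Horizontal translations act by unipotent matrices.\<close>

lemma herm_det_shear:
  "herm_det (a1 + 2 * Re (cnj z * w1) + (cmod z)\<^sup>2 * b1) (w1 + of_real b1 * z) b1
     (a2 + 2 * Re (cnj z * w2) + (cmod z)\<^sup>2 * b2) (w2 + of_real b2 * z) b2
     (a3 + 2 * Re (cnj z * w3) + (cmod z)\<^sup>2 * b3) (w3 + of_real b3 * z) b3
     (a4 + 2 * Re (cnj z * w4) + (cmod z)\<^sup>2 * b4) (w4 + of_real b4 * z) b4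
   = herm_det a1 w1 b1 a2 w2 b2 a3 w3 b3 a4 w4 b4"
  unfolding herm_det_def cmod_power2
  by (simp add: power2_eq_square algebra_simps)

lemma herm_det_at_0:
  "herm_det ((1 + n0) * t\<^sup>2) (of_real t * n) (1 - n0) ((1
    - n0) * t\<^sup>2) (- (complex_of_real t * n)) (1 + n0)
     (c0 * t\<^sup>2 + 2 * t * x0) (of_real (1 - n0) * x + of_real x0 * n + of_real t * c) (- c0)
     (2 * t * y0 - d0 * t\<^sup>2) (of_real (1 + n0) * y - of_real y0 * n - of_real t * d) d0
   + herm_det ((1 + n0) * t\<^sup>2) (of_real t * n) (1 - n0) ((1
     - n0) * t\<^sup>2) (- (complex_of_real t * n)) (1 + n0)
     (d0 * t\<^sup>2 + 2 * t * y0) (of_real (1 - n0) * y + of_real y0 * n + of_real t * d) (- d0)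
     (2 * t * x0 - c0 * t\<^sup>2) (of_real (1 + n0) * x - of_real x0 * n - of_real t * c) c0
   = - 8 * t^3 * (det3 (n0, n) (x0, x) (d0, d) + det3 (n0, n) (y0, y) (c0, c))"
  unfolding herm_det_def det3_def
  by (simp add: power2_eq_square power3_eq_cube algebra_simps)

text \<open>By translation it is enough to compute at points above the origin. The hypotheses enter
  because a motion along the normal geodesic itself with constant Euclidean direction does not
  fix the geodesic.\<close>

lemma herm_det_null:
  fixes x u dX dY eX eY :: "real \<times> complex"
  assumes X: "u \<bullet> dX = 0" and Y: "u \<bullet> dY = 0"
  shows "herm_det (null_a x u) (null_w x u) (null_b u) (null_a x (- u)) (null_w x (- u)) (null_b
    (- u))
      (dnull_a x u dX eX) (dnull_w x u dX eX) (- fst eX)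
      (dnull_a x (- u) dY (- eY)) (dnull_w x (- u) dY (- eY)) (fst eY)
    + herm_det (null_a x u) (null_w x u) (null_b u) (null_a x (- u)) (null_w x (- u)) (null_b (- u))
      (dnull_a x u dY eY) (dnull_w x u dY eY) (- fst eY)
      (dnull_a x (- u) dX (- eX)) (dnull_w x (- u) dX (- eX)) (fst eX)
    = - 8 * (fst x)^3 * (det3 u dX eY + det3 u dY eX)"
proof -
  obtain t z where x: "x = (t, z)" by (cases x)
  obtain n0 n where u: "u = (n0, n)" by (cases u)
  have null: "null_a x u = (1 + n0) * t\<^sup>2 + 2 * Re (cnj z * (of_real t * n)) + (cmod z)\<^sup>2 * (1
    - n0)"
    "null_w x u = of_real t * n + of_real (1 - n0) * z" "null_b u = 1 - n0"
    "null_a x (- u) = (1 - n0) * t\<^sup>2 + 2 * Re (cnj z * (- (of_real t * n))) + (cmod z)\<^sup>2 * (1 + n0)"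
    "null_w x (- u) = - (of_real t * n) + of_real (1 + n0) * z" "null_b (- u) = 1 + n0"
    by (simp_all add: null_a_def null_w_def null_b_def x u algebra_simps)
  have dnull: "dnull_a x u v e = (fst e * t\<^sup>2 + 2 * t * fst v)
      + 2 * Re (cnj z * (of_real (1 - n0) * snd v + of_real (fst v) * n + of_real t * snd e))
      + (cmod z)\<^sup>2 * (- fst e)"
    "dnull_a x (- u) v (- e) = (2 * t * fst v - fst e * t\<^sup>2)
      + 2 * Re (cnj z * (of_real (1 + n0) * snd v - of_real (fst v) * n - of_real t * snd e))
      + (cmod z)\<^sup>2 * fst e"
    if "u \<bullet> v = 0" for v e
  proof -
    have "Re n * Re (snd v) = - (n0 * fst v) - Im n * Im (snd v)"
      using that by (simp add: u inner_prod_def inner_complex_def)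
    then have *: "Re (cnj (snd v) * n) = - n0 * fst v" by (simp add: algebra_simps)
    show "dnull_a x u v e = (fst e * t\<^sup>2 + 2 * t * fst v)
      + 2 * Re (cnj z * (of_real (1 - n0) * snd v + of_real (fst v) * n + of_real t * snd e))
      + (cmod z)\<^sup>2 * (- fst e)"
      unfolding dnull_a_def x u fst_conv snd_conv * by (simp add: algebra_simps power2_eq_square)
    have *: "Re (cnj (snd v) * - n) = n0 * fst v" using * by simp
    show "dnull_a x (- u) v (- e) = (2 * t * fst v - fst e * t\<^sup>2)
      + 2 * Re (cnj z * (of_real (1 + n0) * snd v - of_real (fst v) * n - of_real t * snd e))
      + (cmod z)\<^sup>2 * fst e"
      unfolding dnull_a_def x u fst_conv snd_conv * fst_uminus snd_uminus
      by (simp add: algebra_simps power2_eq_square)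
  qed
  have dnull_w: "dnull_w x u v e
      = (of_real (1 - n0) * snd v + of_real (fst v) * n + of_real t * snd e)
        + of_real (- fst e) * z"
    "dnull_w x (- u) v (- e)
      = (of_real (1 + n0) * snd v - of_real (fst v) * n - of_real t * snd e)
        + of_real (fst e) * z" for v e
    by (simp_all add: dnull_w_def x u algebra_simps)
  show ?thesis
    unfolding null dnull[OF X] dnull[OF Y] dnull_w herm_det_shear herm_det_at_0
    by (simp add: x u)
qed

lemma null_cone:
  assumes "u \<bullet> u = 1"
  shows "null_a x u * null_b u = (cmod (null_w x u))\<^sup>2"
proof -
  obtain t z where x: "x = (t, z)" by (cases x)
  obtain n0 n where u: "u = (n0, n)" by (cases u)
  have n: "(Re n)\<^sup>2 = 1 - n0\<^sup>2 - (Im n)\<^sup>2"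
    using assms by (simp add: u inner_prod_def inner_complex_def power2_eq_square)
  show ?thesis
    unfolding null_a_def null_b_def null_w_def x u fst_conv snd_conv cmod_power2
    by (simp add: algebra_simps n power2_eq_square)
      (simp add: algebra_simps n[unfolded power2_eq_square])
qed

lemma geodesic_circle_deriv:
  fixes c d :: complex
  shows
  "((\<lambda>r. (K / cosh r, c + d * of_real (tanh r))) has_vector_derivative
     (- (K / cosh r) * tanh r, d * of_real (1 - (tanh r)\<^sup>2))) (at r)"
proof -
  have 1: "((\<lambda>r. K / cosh r) has_real_derivative - (K / cosh r) * tanh r) (at r)"
    by (auto intro!: derivative_eq_intros simp: tanh_def power2_eq_square)
  have "(tanh has_real_derivative 1 - (tanh r)\<^sup>2) (at r)"
    by (auto intro!: derivative_eq_intros)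
  then have "(tanh has_vector_derivative 1 - (tanh r)\<^sup>2) (at r)"
    by (simp add: has_real_derivative_iff_has_vector_derivative)
  from bounded_linear.has_vector_derivative[OF bounded_linear_of_real this]
  have "((\<lambda>r. complex_of_real (tanh r)) has_vector_derivative of_real (1 - (tanh r)\<^sup>2)) (at r)" .
  then have "((\<lambda>r. c + d * of_real (tanh r)) has_vector_derivative d * of_real (1
    - (tanh r)\<^sup>2)) (at r)"
    using has_vector_derivative_add[OF has_vector_derivative_const
        bounded_linear.has_vector_derivative[OF bounded_linear_mult_right[of d]], of _ _ _ c]
          by simp
  with 1 show ?thesis
    by (auto intro!: has_vector_derivative_Pair simp: has_real_derivative_iff_has_vector_derivative)
qed

lemma geodesic_line_deriv:
  "((\<lambda>r. (exp (s * r), c :: complex)) has_vector_derivative (s * exp (s * r), 0)) (at (r :: real))"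
proof -
  have "((\<lambda>r. exp (s * r)) has_real_derivative s * exp (s * r)) (at r)"
    by (auto intro!: derivative_eq_intros)
  then show ?thesis
    by (auto intro!: has_vector_derivative_Pair derivative_eq_intros
        simp: has_real_derivative_iff_has_vector_derivative)
qed

text \<open>Half-circles from \<open>c - d\<close> to \<open>c + d\<close>. The entry \<open>a\<close> comes from the equation of the cone.\<close>

lemma circle_null:
  assumes x: "x = (K / cosh r, c + d * of_real (tanh r))" and K: "fst x > 0"
    and n: "((\<lambda>r. (K / cosh r, c + d * of_real (tanh r))) has_vector_derivative fst x *\<^sub>R u) (at r)"
    and u: "u \<bullet> u = 1"
  shows "null_b u > 0" "null_w x u = of_real (null_b u) * (c + d)"
    "null_a x u = null_b u * (cmod (c + d))\<^sup>2"
    "null_b (- u) > 0" "null_w x (- u) = of_real (null_b (- u)) * (c - d)"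
    "null_a x (- u) = null_b (- u) * (cmod (c - d))\<^sup>2"
proof -
  have "fst x *\<^sub>R u = (- (K / cosh r) * tanh r, d * of_real (1 - (tanh r)\<^sup>2))"
    using vector_derivative_unique_at[OF n geodesic_circle_deriv] .
  then have "fst x * fst u = - fst x * tanh r" and 2:
    "of_real (fst x) * snd u = d * of_real (1 - (tanh r)\<^sup>2)"
    unfolding prod_eq_iff by (simp_all add: x scaleR_conv_of_real)
  then have "fst x * fst u = fst x * (- tanh r)" by simp
  then have 1: "fst u = - tanh r" using K unfolding mult_cancel_left by simp
  have "- 1 < tanh r" "tanh r < 1" using tanh_real_bounds[of r] by auto
  then show b: "null_b u > 0" "null_b (- u) > 0" by (auto simp: null_b_def 1)
  show w: "null_w x u = of_real (null_b u) * (c + d)"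
    "null_w x (- u) = of_real (null_b (- u)) * (c - d)"
    unfolding null_w_def null_b_def fst_uminus snd_uminus mult_minus_right 1 2
    by (simp_all add: x algebra_simps power2_eq_square)
  show "null_a x u = null_b u * (cmod (c + d))\<^sup>2"
    using null_cone[OF u, of x] b(1) by (simp add: w norm_mult power2_eq_square)
  show "null_a x (- u) = null_b (- u) * (cmod (c - d))\<^sup>2"
    using null_cone[of "- u" x] u b(2) by (simp add: w norm_mult power2_eq_square)
qed

lemma line_null:
  fixes x u :: "real \<times> complex"
  assumes x: "x = (exp (s * r), c)"
    and n: "((\<lambda>r. (exp (s * r), c)) has_vector_derivative fst x *\<^sub>R u) (at r)"
  shows "u = (s, 0)"
proof -
  have "fst x *\<^sub>R u = (s * exp (s * r), 0)"
    using vector_derivative_unique_at[OF n geodesic_line_deriv] .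
  then show ?thesis unfolding prod_eq_iff by (simp add: x)
qed

lemma geodesic_null:
  assumes l: "l \<in> LH3" and x: "geodesic l r = x" "fst x > 0"
    and n: "(geodesic l has_vector_derivative fst x *\<^sub>R u) (at r)" and u: "u \<bullet> u = 1"
  shows "case snd l of
      Some m \<Rightarrow> null_a x u > 0 \<and> null_w x u = of_real (null_a x u) * m \<and>
        null_b u = null_a x u * (cmod m)\<^sup>2
    | None \<Rightarrow> null_b u > 0 \<and> null_w x u = 0 \<and> null_a x u = 0" (is ?E)
    and "case fst l of
      Some m \<Rightarrow> null_b (- u) > 0 \<and> null_w x (- u) = - (of_real (null_b (- u)) * m) \<and>
        null_a x (- u) = null_b (- u) * (cmod m)\<^sup>2
    | None \<Rightarrow> null_a x (- u) > 0 \<and> null_w x (- u) = 0 \<and> null_b (- u) = 0" (is ?S)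
proof -
  have "?E \<and> ?S"
  proof (cases "\<exists>m1 m2. l = (Some m1, Some m2)")
    case True
    then obtain m1 m2 where lm: "l = (Some m1, Some m2)" by blast
    show ?thesis
    proof (cases "m2 = 0")
      case True
      have g: "geodesic l = (\<lambda>r. (exp (1 * r), - m1))" by (simp add: lm True fun_eq_iff)
      have "u = (1, 0)" by (rule line_null[where s = 1 and r = r and c = "- m1" and x = x])
          (use n x in \<open>simp_all add: g\<close>)
      then show ?thesis
        using x by (auto simp: lm True null_a_def null_b_def null_w_def power2_eq_square)
    next
      case False
      define c where "c = (1 - m1 * cnj m2) / (2 * cnj m2)"
      define d where "d = (1 + m1 * cnj m2) / (2 * cnj m2)"
      have g: "geodesic l = (\<lambda>r. ((cmod (1 + cnj m1 * m2) / (2 * cmod m2)) / cosh r, c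
        + d * of_real (tanh r)))"
        by (simp add: lm False fun_eq_iff c_def d_def)
      have cd: "c + d = 1 / cnj m2" "c - d = - m1"
        using False by (simp_all add: c_def d_def field_simps)
      have X: "x = ((cmod (1 + cnj m1 * m2) / (2 * cmod m2)) / cosh r, c + d * of_real (tanh r))"
        using x(1) g by metis
      have m2: "complex_of_real (b / (cmod m2)\<^sup>2) * m2 = of_real b * (1 / cnj m2)" for b
        using False by (auto simp: field_simps simp flip: complex_norm_square)
      note N = circle_null[OF X x(2) n[unfolded g] u, unfolded cd]
      have "null_a x u = null_b u / (cmod m2)\<^sup>2"
        using N(3) by (simp add: norm_divide power_divide)
      then show ?thesis using False N m2[of "null_b u"] by (simp add: lm)
    qed
  next
    case False
    then consider m1 where "l = (Some m1, None)" | m2 where "l = (None, Some m2)" |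
      "l = (None, None)"
      by (cases l; cases "fst l"; cases "snd l") auto
    then show ?thesis
    proof cases
      case (1 m1)
      have g: "geodesic l = (\<lambda>r. (cmod m1 / 2 / cosh r, - m1 / 2 + m1 / 2 * of_real (tanh r)))"
        by (simp add: 1 fun_eq_iff)
      from circle_null[OF _ x(2) n[unfolded g] u] x(1) show ?thesis by (auto simp: g 1)
    next
      case (2 m2)
      have g: "geodesic l = (\<lambda>r. (exp (- 1 * r), 1 / cnj m2))" by (simp add: 2 fun_eq_iff)
      have "u = (- 1, 0)" by (rule line_null[where s = "- 1" and r = r and c =
        "1 / cnj m2" and x = x])
          (use n x in \<open>simp_all add: g\<close>)
      moreover have m2: "m2 \<noteq> 0" using l by (auto simp: 2 LH3_def)
      ultimately have N: "null_b u = 2" "null_w x u = 2 * (1 / cnj m2)"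
          "null_a x u = 2 / (cmod m2)\<^sup>2" "null_b (- u) = 0" "null_w x (- u) = 0"
          "null_a x (- u) = 2 * (fst x)\<^sup>2"
        using x(1) by (auto simp: 2 null_a_def null_b_def null_w_def norm_divide power_divide)
      have "complex_of_real (2 / (cmod m2)\<^sup>2) * m2 = 2 * (1 / cnj m2)"
        using m2 by (auto simp: field_simps simp flip: complex_norm_square)
      then show ?thesis using x(2) m2 by (simp add: 2 N)
    next
      case 3
      have g: "geodesic l = (\<lambda>r. (exp (- 1 * r), 0))" by (simp add: 3 fun_eq_iff)
      have "u = (- 1, 0)" by (rule line_null[where s = "- 1" and r = r and c = 0 and x = x])
          (use n x in \<open>simp_all add: g\<close>)
      then show ?thesis
        using x by (auto simp: 3 null_a_def null_b_def null_w_def power2_eq_square)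
    qed
  qed
  then show ?E ?S by auto
qed

text \<open>A coordinate \<open>k\<close> is a quotient of entries of the null matrix and therefore differentiable;
  in turn, the differentials of the entries are those of \<open>\<alpha> (1, k, k cnj k)\<close>.\<close>

lemma null_ratio:
  fixes \<alpha> \<beta> :: "'a::real_normed_vector \<Rightarrow> real" and \<omega> k :: "'a \<Rightarrow> complex"
  assumes \<alpha>: "(\<alpha> has_derivative d\<alpha>) (at u)" and \<beta>: "(\<beta> has_derivative d\<beta>) (at u)"
    and \<omega>: "(\<omega> has_derivative d\<omega>) (at u)" and U: "open U" "u \<in> U" and ne: "\<alpha> u \<noteq> 0"
    and k: "\<And>v. v \<in> U \<Longrightarrow> \<alpha> v \<noteq> 0 \<Longrightarrow> \<omega> v = of_real (\<alpha> v) * k v \<and> \<beta> v = \<alpha> v * (cmod (k v))\<^sup>2"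
  obtains dk where "(k has_derivative dk) (at u)"
    "\<And>X. d\<omega> X = of_real (d\<alpha> X) * k u + of_real (\<alpha> u) * dk X"
    "\<And>X. d\<beta> X = d\<alpha> X * (cmod (k u))\<^sup>2 + 2 * \<alpha> u * Re (cnj (k u) * dk X)"
proof -
  have "isCont \<alpha> u" using \<alpha> has_derivative_continuous by blast
  then have "\<forall>\<^sub>F v in at u. \<alpha> v \<noteq> 0"
    using ne by (simp add: isCont_def tendsto_imp_eventually_ne)
  moreover have "\<forall>\<^sub>F v in at u. v \<in> U" using U by (simp add: eventually_at_in_open')
  ultimately have ev: "\<forall>\<^sub>F v in at u. v \<in> U \<and> \<alpha> v \<noteq> 0" by eventually_elim simp
  have of: "((\<lambda>v. complex_of_real (\<alpha> v)) has_derivative (\<lambda>X. of_real (d\<alpha> X))) (at u)"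
    using bounded_linear.has_derivative[OF bounded_linear_of_real \<alpha>] .
  have "((\<lambda>v. \<omega> v / of_real (\<alpha> v)) has_derivative
      (\<lambda>X. - \<omega> u * (inverse (of_real (\<alpha> u)) * of_real (d\<alpha> X) * inverse (of_real (\<alpha> u)))
        + d\<omega> X / of_real (\<alpha> u))) (at u)" (is "(_ has_derivative ?D) _")
    by (rule has_derivative_divide[OF \<omega> of]) (use ne in simp)
  then have kD: "(k has_derivative ?D) (at u)"
    by (rule has_derivative_transform_eventually)
      (use ev k[OF U(2) ne] ne k in \<open>auto elim!: eventually_mono\<close>)
  have "((\<lambda>v. of_real (\<alpha> v) * k v) has_derivative (\<lambda>X. of_real (\<alpha> u) * ?D X
    + of_real (d\<alpha> X) * k u)) (at u)"
    by (rule has_derivative_mult[OF of kD])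
  then have "(\<omega> has_derivative (\<lambda>X. of_real (\<alpha> u) * ?D X + of_real (d\<alpha> X) * k u)) (at u)"
    by (rule has_derivative_transform_eventually)
      (use ev k[OF U(2) ne] k in \<open>auto elim!: eventually_mono\<close>)
  from fun_cong[OF has_derivative_unique[OF \<omega> this]]
  have 1: "d\<omega> X = of_real (d\<alpha> X) * k u + of_real (\<alpha> u) * ?D X" for X
    by (simp only: add.commute)
  have "((\<lambda>v. \<alpha> v * (k v \<bullet> k v)) has_derivative
      (\<lambda>X. \<alpha> u * (k u \<bullet> ?D X + ?D X \<bullet> k u) + d\<alpha> X * (k u \<bullet> k u))) (at u)"
    by (rule has_derivative_mult[OF \<alpha> has_derivative_inner[OF kD kD]])
  then have "(\<beta> has_derivative (\<lambda>X. \<alpha> u * (k u \<bullet> ?D X + ?D X \<bullet> k u) + d\<alpha> X * (k u \<bullet> k u))) (at u)"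
    by (rule has_derivative_transform_eventually)
      (use ev k[OF U(2) ne] k in \<open>auto elim!: eventually_mono simp: power2_norm_eq_inner\<close>)
  note \<beta>' = fun_cong[OF has_derivative_unique[OF \<beta> this]]
  have R: "z \<bullet> w + w \<bullet> z = 2 * Re (cnj z * w)" for z w :: complex
    by (simp add: inner_complex_def algebra_simps)
  have 2: "d\<beta> X = d\<alpha> X * (cmod (k u))\<^sup>2 + 2 * \<alpha> u * Re (cnj (k u) * ?D X)" for X
    unfolding \<beta>' power2_norm_eq_inner R by (simp only: ac_simps)
  show thesis by (rule that[OF kD 1 2])
qed

lemma null_has_derivative:
  assumes f: "(f has_derivative df) (at u)" and \<nu>: "(\<nu> has_derivative d\<nu>) (at u)"
  shows "((\<lambda>v. null_a (f v) (\<nu> v)) has_derivative (\<lambda>X. dnull_a (f u) (\<nu> u) (df X) (d\<nu> X))) (at u)"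
    and "((\<lambda>v. null_w (f v) (\<nu> v)) has_derivative (\<lambda>X. dnull_w (f u) (\<nu> u) (df X) (d\<nu> X))) (at u)"
    and "((\<lambda>v. null_b (\<nu> v)) has_derivative (\<lambda>X. - fst (d\<nu> X))) (at u)"
proof -
  have R: "Re (cnj z * w) = z \<bullet> w" for z w by (simp add: inner_complex_def)
  note D = has_derivative_fst[OF f] has_derivative_snd[OF f] has_derivative_fst[OF \<nu>]
    has_derivative_snd[OF \<nu>]
  show "((\<lambda>v. null_a (f v) (\<nu> v)) has_derivative (\<lambda>X. dnull_a (f u) (\<nu> u) (df X) (d\<nu> X))) (at u)"
    unfolding null_a_def dnull_a_def R power2_norm_eq_inner
    by (rule derivative_eq_intros D refl)+ (simp add: fun_eq_iff algebra_simps inner_commute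
      power2_eq_square)
  show "((\<lambda>v. null_w (f v) (\<nu> v)) has_derivative (\<lambda>X. dnull_w (f u) (\<nu> u) (df X) (d\<nu> X))) (at u)"
    unfolding null_w_def dnull_w_def
    by (rule derivative_eq_intros D refl bounded_linear.has_derivative[OF bounded_linear_of_real])+
      (simp add: fun_eq_iff algebra_simps)
  show "((\<lambda>v. null_b (\<nu> v)) has_derivative (\<lambda>X. - fst (d\<nu> X))) (at u)"
    unfolding null_b_def by (rule derivative_eq_intros D refl)+ simp
qed

text \<open>The sum of the two null matrices represents the point \<open>x\<close> itself. This fixes the scale of
  their product, and hence the factor of the symplectic form.\<close>

lemma null_sum:
  "(null_a x u + null_a x (- u)) * (null_b u + null_b (- u)) - (cmod (null_w x u
    + null_w x (- u)))\<^sup>2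
    = 4 * (fst x)\<^sup>2"
proof -
  have "null_a x u + null_a x (- u) = 2 * ((cmod (snd x))\<^sup>2 + (fst x)\<^sup>2)"
    "null_b u + null_b (- u) = 2" "null_w x u + null_w x (- u) = 2 * snd x"
    by (simp_all add: null_a_def null_b_def null_w_def algebra_simps)
  then show ?thesis by (simp add: norm_mult power2_eq_square algebra_simps)
qed

lemma L_metric_eq:
  "L_metric c m X Y = 2 * Im (Omega_factor c m * (fst X * cnj (snd Y) + fst Y * cnj (snd X)))"
  by (simp add: L_metric_def L_Omega_def L_J_def algebra_simps)

lemma Im_divide_square:
  assumes "a * b * (cmod p)\<^sup>2 = 4 * t\<^sup>2" "t > 0"
  shows "Im (1 / p\<^sup>2 * S) = a\<^sup>2 * b\<^sup>2 * Im (S * cnj (p\<^sup>2)) / (16 * t^4)"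
proof -
  have "a * b * (cmod p)\<^sup>2 \<noteq> 0" using assms by simp
  then have p: "a \<noteq> 0" "b \<noteq> 0" "cmod p \<noteq> 0" "p \<noteq> 0" by auto
  have "16 * t^4 = (a * b * (cmod p)\<^sup>2)\<^sup>2" unfolding assms(1) by (simp add: power_mult_distrib)
  then have t: "16 * t^4 = a\<^sup>2 * b\<^sup>2 * cmod p ^ 4" by (simp add: power_mult_distrib)
  have "1 / p\<^sup>2 = cnj (p\<^sup>2) / of_real (cmod p ^ 4)"
  proof -
    have "of_real (cmod p ^ 4) = (of_real ((cmod p)\<^sup>2) :: complex)\<^sup>2" by simp
    also have "\<dots> = p\<^sup>2 * cnj (p\<^sup>2)" unfolding complex_norm_square by (simp add: power_mult_distrib)
    finally show ?thesis using p by (simp add: field_simps)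
  qed
  then have "1 / p\<^sup>2 * S = S * cnj (p\<^sup>2) / of_real (cmod p ^ 4)" by simp
  then have "Im (1 / p\<^sup>2 * S) = Im (S * cnj (p\<^sup>2)) / cmod p ^ 4"
    by (simp only: Im_divide_of_real)
  then show ?thesis unfolding t using p by simp
qed

text \<open>The chart used at \<open>u\<close> matters only at \<open>u\<close>, where the coordinates need only be
  differentiable once. All four charts lead to the same determinant.\<close>

lemma induced_metric_eq:
  fixes f \<nu> :: "real \<times> real \<Rightarrow> real \<times> complex"
  assumes U: "open U" "u \<in> U"
    and f: "(f has_derivative df) (at u)" and \<nu>: "(\<nu> has_derivative d\<nu>) (at u)"
    and pos: "\<And>v. v \<in> U \<Longrightarrow> fst (f v) > 0" and unit: "\<And>v. v \<in> U \<Longrightarrow> \<nu> v \<bullet> \<nu> v = 1"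
    and tangent: "\<And>X. \<nu> u \<bullet> df X = 0"
    and \<gamma>: "\<And>v. v \<in> U \<Longrightarrow> \<gamma> v \<in> LH3"
      "\<And>v. v \<in> U \<Longrightarrow> \<exists>r. geodesic (\<gamma> v) r = f v \<and>
        (geodesic (\<gamma> v) has_vector_derivative fst (f v) *\<^sub>R \<nu> v) (at r)"
  shows "induced_metric \<gamma> u X Y = (det3 (\<nu> u) (df X) (d\<nu> Y) + det3 (\<nu> u) (df Y) (d\<nu> X)) / fst (f u)"
proof -
  have \<nu>': "((\<lambda>v. - \<nu> v) has_derivative (\<lambda>X. - d\<nu> X)) (at u)" using \<nu> by (rule has_derivative_minus)
  note dA = null_has_derivative[OF f \<nu>]
    and dB = null_has_derivative[OF f \<nu>', unfolded fst_uminus minus_minus]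
  define c where "c = chart_at (\<gamma> u)"
  define k2 where "k2 v = P1_coord (snd c) (snd (\<gamma> v))" for v
  define k1 where "k1 v = P1_coord (fst c) (fst (\<gamma> v))" for v
  have E: "case snd (\<gamma> v) of
      Some m \<Rightarrow> null_a (f v) (\<nu> v) > 0 \<and> null_w (f v) (\<nu> v) = of_real (null_a (f v) (\<nu> v)) * m \<and>
        null_b (\<nu> v) = null_a (f v) (\<nu> v) * (cmod m)\<^sup>2
    | None \<Rightarrow> null_b (\<nu> v) > 0 \<and> null_w (f v) (\<nu> v) = 0 \<and> null_a (f v) (\<nu> v) = 0"
    and S: "case fst (\<gamma> v) of
      Some m \<Rightarrow> null_b (- \<nu> v) > 0 \<and> null_w (f v) (- \<nu> v) = - (of_real (null_b (- \<nu> v)) * m) \<and>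
        null_a (f v) (- \<nu> v) = null_b (- \<nu> v) * (cmod m)\<^sup>2
    | None \<Rightarrow> null_a (f v) (- \<nu> v) > 0 \<and> null_w (f v) (- \<nu> v) = 0 \<and> null_b (- \<nu> v) = 0"
    if "v \<in> U" for v
    using geodesic_null[OF \<gamma>(1)[OF that] _ pos[OF that] _ unit[OF that]] \<gamma>(2)[OF that] by blast+
  have inv: "cnj m = of_real ((cmod m)\<^sup>2) * inverse m" for m :: complex
    unfolding complex_norm_square by (cases "m = 0") (simp_all add: field_simps)
  \<comment> \<open>In an inverted coordinate the roles of the diagonal entries are exchanged.\<close>
  let ?Eside = "\<lambda>d2. (k2 has_derivative d2) (at u) \<and>
    (if snd c then null_w (f u) (\<nu> u) = of_real (null_b (\<nu> u)) * cnj (k2 u) \<and>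
        null_a (f u) (\<nu> u) = null_b (\<nu> u) * (cmod (k2 u))\<^sup>2 \<and>
        (\<forall>X. dnull_w (f u) (\<nu> u) (df X) (d\<nu> X)
          = of_real (- fst (d\<nu> X)) * cnj (k2 u) + of_real (null_b (\<nu> u)) * cnj (d2 X)) \<and>
        (\<forall>X. dnull_a (f u) (\<nu> u) (df X) (d\<nu> X)
          = - fst (d\<nu> X) * (cmod (k2 u))\<^sup>2 + 2 * null_b (\<nu> u) * Re (cnj (k2 u) * d2 X))
     else null_w (f u) (\<nu> u) = of_real (null_a (f u) (\<nu> u)) * k2 u \<and>
        null_b (\<nu> u) = null_a (f u) (\<nu> u) * (cmod (k2 u))\<^sup>2 \<and>
        (\<forall>X. dnull_w (f u) (\<nu> u) (df X) (d\<nu> X) = of_real (dnull_a (f u) (\<nu> u) (df X) (d\<nu> X)) * k2 u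
          + of_real (null_a (f u) (\<nu> u)) * d2 X) \<and>
        (\<forall>X. - fst (d\<nu> X) = dnull_a (f u) (\<nu> u) (df X) (d\<nu> X) * (cmod (k2 u))\<^sup>2
          + 2 * null_a (f u) (\<nu> u) * Re (cnj (k2 u) * d2 X)))"
  have Eside: "\<exists>d2. ?Eside d2"
  proof (cases "snd (\<gamma> u)")
    case None
    then have c: "snd c" by (simp add: c_def chart_at_def)
    have k: "cnj (null_w (f v) (\<nu> v)) = of_real (null_b (\<nu> v)) * k2 v \<and>
        null_a (f v) (\<nu> v) = null_b (\<nu> v) * (cmod (k2 v))\<^sup>2" if "v \<in> U" "null_b (\<nu> v) \<noteq> 0" for v
      using E[OF that(1)] that(2) c
      by (auto simp: k2_def P1_coord_def inv norm_inverse power_inverse split: option.splits)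
        (simp add: norm_mult power2_eq_square)
    have ne: "null_b (\<nu> u) \<noteq> 0" using E[OF U(2)] None by simp
    from null_ratio[OF dA(3) dA(1) bounded_linear.has_derivative[OF bounded_linear_cnj dA(2)] U
      ne k]
    obtain d2 where d2: "(k2 has_derivative d2) (at u)"
      "\<And>X. cnj (dnull_w (f u) (\<nu> u) (df X) (d\<nu> X))
          = of_real (- fst (d\<nu> X)) * k2 u + of_real (null_b (\<nu> u)) * d2 X"
      "\<And>X. dnull_a (f u) (\<nu> u) (df X) (d\<nu> X)
          = - fst (d\<nu> X) * (cmod (k2 u))\<^sup>2 + 2 * null_b (\<nu> u) * Re (cnj (k2 u) * d2 X)"
      by metis
    have "dnull_w (f u) (\<nu> u) (df X) (d\<nu> X)
          = of_real (- fst (d\<nu> X)) * cnj (k2 u) + of_real (null_b (\<nu> u)) * cnj (d2 X)" for X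
      using arg_cong[OF d2(2), of cnj X] by simp
    moreover have "null_w (f u) (\<nu> u) = of_real (null_b (\<nu> u)) * cnj (k2 u)"
      using arg_cong[OF conjunct1[OF k[OF U(2) ne]], of cnj] by simp
    ultimately show ?thesis using d2 k[OF U(2) ne] c by (intro exI[of _ d2]) auto
  next
    case (Some m)
    then have c: "\<not> snd c" by (simp add: c_def chart_at_def)
    have k: "null_w (f v) (\<nu> v) = of_real (null_a (f v) (\<nu> v)) * k2 v \<and>
        null_b (\<nu> v) = null_a (f v) (\<nu> v) * (cmod (k2 v))\<^sup>2" if "v \<in> U"
          "null_a (f v) (\<nu> v) \<noteq> 0" for v
      using E[OF that(1)] that(2) c by (auto simp: k2_def P1_coord_def split: option.splits)
    have ne: "null_a (f u) (\<nu> u) \<noteq> 0" using E[OF U(2)] Some by simp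
    from null_ratio[OF dA(1) dA(3) dA(2) U ne k] show ?thesis
      using k[OF U(2) ne] c by metis
  qed
  let ?Sside = "\<lambda>d1. (k1 has_derivative d1) (at u) \<and>
    (if fst c then null_w (f u) (- \<nu> u) = - (of_real (null_a (f u) (- \<nu> u)) * cnj (k1 u)) \<and>
        null_b (- \<nu> u) = null_a (f u) (- \<nu> u) * (cmod (k1 u))\<^sup>2 \<and>
        (\<forall>X. dnull_w (f u) (- \<nu> u) (df X) (- d\<nu> X)
          = - (of_real (dnull_a (f u) (- \<nu> u) (df X) (- d\<nu> X)) * cnj (k1 u)
            + of_real (null_a (f u) (- \<nu> u)) * cnj (d1 X))) \<and>
        (\<forall>X. fst (d\<nu> X) = dnull_a (f u) (- \<nu> u) (df X) (- d\<nu> X) * (cmod (k1 u))\<^sup>2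
          + 2 * null_a (f u) (- \<nu> u) * Re (cnj (k1 u) * d1 X))
     else null_w (f u) (- \<nu> u) = - (of_real (null_b (- \<nu> u)) * k1 u) \<and>
        null_a (f u) (- \<nu> u) = null_b (- \<nu> u) * (cmod (k1 u))\<^sup>2 \<and>
        (\<forall>X. dnull_w (f u) (- \<nu> u) (df X) (- d\<nu> X)
          = - (of_real (fst (d\<nu> X)) * k1 u + of_real (null_b (- \<nu> u)) * d1 X)) \<and>
        (\<forall>X. dnull_a (f u) (- \<nu> u) (df X) (- d\<nu> X)
          = fst (d\<nu> X) * (cmod (k1 u))\<^sup>2 + 2 * null_b (- \<nu> u) * Re (cnj (k1 u) * d1 X)))"
  have Sside: "\<exists>d1. ?Sside d1"
  proof (cases "fst (\<gamma> u)")
    case None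
    then have c: "fst c" by (simp add: c_def chart_at_def)
    have k: "- cnj (null_w (f v) (- \<nu> v)) = of_real (null_a (f v) (- \<nu> v)) * k1 v \<and>
        null_b (- \<nu> v) = null_a (f v) (- \<nu> v) * (cmod (k1 v))\<^sup>2"
      if "v \<in> U" "null_a (f v) (- \<nu> v) \<noteq> 0" for v
      using S[OF that(1)] that(2) c
      by (auto simp: k1_def P1_coord_def inv norm_inverse power_inverse split: option.splits)
        (simp add: norm_mult power2_eq_square)
    have ne: "null_a (f u) (- \<nu> u) \<noteq> 0" using S[OF U(2)] None by simp
    from null_ratio[OF dB(1) dB(3)
        has_derivative_minus[OF bounded_linear.has_derivative[OF bounded_linear_cnj dB(2)]] U ne k]
    obtain d1 where d1: "(k1 has_derivative d1) (at u)"
      "\<And>X. - cnj (dnull_w (f u) (- \<nu> u) (df X) (- d\<nu> X))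
          = of_real (dnull_a (f u) (- \<nu> u) (df X) (- d\<nu> X)) * k1 u
            + of_real (null_a (f u) (- \<nu> u)) * d1 X"
      "\<And>X. fst (d\<nu> X) = dnull_a (f u) (- \<nu> u) (df X) (- d\<nu> X) * (cmod (k1 u))\<^sup>2
          + 2 * null_a (f u) (- \<nu> u) * Re (cnj (k1 u) * d1 X)"
      by metis
    have "dnull_w (f u) (- \<nu> u) (df X) (- d\<nu> X)
          = - (of_real (dnull_a (f u) (- \<nu> u) (df X) (- d\<nu> X)) * cnj (k1 u)
            + of_real (null_a (f u) (- \<nu> u)) * cnj (d1 X))" for X
      using arg_cong[OF d1(2), of "\<lambda>z. - cnj z" X] by simp
    moreover have "null_w (f u) (- \<nu> u) = - (of_real (null_a (f u) (- \<nu> u)) * cnj (k1 u))"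
      using arg_cong[OF conjunct1[OF k[OF U(2) ne]], of "\<lambda>z. - cnj z"] by simp
    ultimately show ?thesis using d1 k[OF U(2) ne] c by (intro exI[of _ d1]) auto
  next
    case (Some m)
    then have c: "\<not> fst c" by (simp add: c_def chart_at_def)
    have k: "- null_w (f v) (- \<nu> v) = of_real (null_b (- \<nu> v)) * k1 v \<and>
        null_a (f v) (- \<nu> v) = null_b (- \<nu> v) * (cmod (k1 v))\<^sup>2" if "v \<in> U"
          "null_b (- \<nu> v) \<noteq> 0" for v
      using S[OF that(1)] that(2) c by (auto simp: k1_def P1_coord_def split: option.splits)
    have ne: "null_b (- \<nu> u) \<noteq> 0" using S[OF U(2)] Some by simp
    from null_ratio[OF dB(3) dB(1) has_derivative_minus[OF dB(2)] U ne k]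
    obtain d1 where d1: "(k1 has_derivative d1) (at u)"
      "\<And>X. - dnull_w (f u) (- \<nu> u) (df X) (- d\<nu> X)
          = of_real (fst (d\<nu> X)) * k1 u + of_real (null_b (- \<nu> u)) * d1 X"
      "\<And>X. dnull_a (f u) (- \<nu> u) (df X) (- d\<nu> X)
          = fst (d\<nu> X) * (cmod (k1 u))\<^sup>2 + 2 * null_b (- \<nu> u) * Re (cnj (k1 u) * d1 X)"
      by metis
    have "dnull_w (f u) (- \<nu> u) (df X) (- d\<nu> X)
          = - (of_real (fst (d\<nu> X)) * k1 u + of_real (null_b (- \<nu> u)) * d1 X)" for X
      using d1(2)[of X] by (metis minus_minus)
    moreover have "null_w (f u) (- \<nu> u) = - (of_real (null_b (- \<nu> u)) * k1 u)"
      using conjunct1[OF k[OF U(2) ne]] by (metis minus_minus)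
    ultimately show ?thesis using d1 k[OF U(2) ne] c by (intro exI[of _ d1]) auto
  qed
  define dS where "dS Z W = herm_det (null_a (f u) (\<nu> u)) (null_w (f u) (\<nu> u)) (null_b (\<nu> u))
      (null_a (f u) (- \<nu> u)) (null_w (f u) (- \<nu> u)) (null_b (- \<nu> u))
      (dnull_a (f u) (\<nu> u) (df Z) (d\<nu> Z)) (dnull_w (f u) (\<nu> u) (df Z) (d\<nu> Z)) (- fst (d\<nu> Z))
      (dnull_a (f u) (- \<nu> u) (df W) (- d\<nu> W)) (dnull_w (f u) (- \<nu> u) (df W) (- d\<nu> W)) (fst (d\<nu> W))"
    for Z W
  from Sside obtain d1 where D1: "?Sside d1" by blast
  from Eside obtain d2 where D2: "?Eside d2" by blast
  have d: "(k1 has_derivative d1) (at u)" "(k2 has_derivative d2) (at u)"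
    using D1 D2 by blast+
  note D1 = conjunct2[OF D1] and D2 = conjunct2[OF D2]
  have "\<exists>p s a b. Omega_factor c (k1 u, k2 u) = s * (1 / p\<^sup>2) \<and>
      a * b * (cmod p)\<^sup>2 = 4 * (fst (f u))\<^sup>2 \<and>
        (\<forall>Z W. dS Z W = - (a\<^sup>2 * b\<^sup>2) * Im (s * (d1 W * cnj (d2 Z)) * cnj (p\<^sup>2)))"
  proof (cases "snd c"; cases "fst c")
    assume c: "snd c" "fst c"
    note S = D1[unfolded if_P[OF c(2)]] D2[unfolded if_P[OF c(1)]]
    have "Omega_factor c (k1 u, k2 u) = 1 * (1 / (1 + k1 u * cnj (k2 u))\<^sup>2)"
      using c by (simp add: Omega_factor_def)
    moreover have "null_a (f u) (- \<nu> u) * null_b (\<nu> u) * (cmod (1 + k1 u * cnj (k2 u)))\<^sup>2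
      = 4 * (fst (f u))\<^sup>2"
      unfolding null_sum[of "f u" "\<nu> u", symmetric] using S
      by (simp add: cmod_power2) (simp add: power2_eq_square algebra_simps)
    moreover have "dS Z W = - ((null_a (f u) (- \<nu> u))\<^sup>2 * (null_b (\<nu> u))\<^sup>2)
        * Im (1 * (d1 W * cnj (d2 Z)) * cnj ((1 + k1 u * cnj (k2 u))\<^sup>2))" for Z W
      unfolding dS_def S(1)[THEN conjunct1] S(2)[THEN conjunct1]
        S(1)[THEN conjunct2, THEN conjunct1] S(2)[THEN conjunct2, THEN conjunct1]
        S(1)[THEN conjunct2, THEN conjunct2, THEN conjunct1, THEN spec, of W]
        S(2)[THEN conjunct2, THEN conjunct2, THEN conjunct1, THEN spec, of Z]
        S(1)[THEN conjunct2, THEN conjunct2, THEN conjunct2, THEN spec, of W]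
        S(2)[THEN conjunct2, THEN conjunct2, THEN conjunct2, THEN spec, of Z] herm_det_chart_TT
      by (simp del: complex_cnj_mult complex_cnj_power complex_cnj_add)
    ultimately show ?thesis by blast
  next
    assume c: "snd c" "\<not> fst c"
    note S = D1[unfolded if_not_P[OF c(2)]] D2[unfolded if_P[OF c(1)]]
    have "Omega_factor c (k1 u, k2 u) = - 1 * (1 / (k1 u + cnj (k2 u))\<^sup>2)"
      using c by (simp add: Omega_factor_def)
    moreover have "null_b (\<nu> u) * null_b (- \<nu> u) * (cmod (k1 u + cnj (k2 u)))\<^sup>2 = 4 * (fst (f u))\<^sup>2"
      unfolding null_sum[of "f u" "\<nu> u", symmetric] using S
      by (simp add: cmod_power2) (simp add: power2_eq_square algebra_simps)
    moreover have "dS Z W = - ((null_b (\<nu> u))\<^sup>2 * (null_b (- \<nu> u))\<^sup>2)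
        * Im (- 1 * (d1 W * cnj (d2 Z)) * cnj ((k1 u + cnj (k2 u))\<^sup>2))" for Z W
      unfolding dS_def S(1)[THEN conjunct1] S(2)[THEN conjunct1]
        S(1)[THEN conjunct2, THEN conjunct1] S(2)[THEN conjunct2, THEN conjunct1]
        S(1)[THEN conjunct2, THEN conjunct2, THEN conjunct1, THEN spec, of W]
        S(2)[THEN conjunct2, THEN conjunct2, THEN conjunct1, THEN spec, of Z]
        S(1)[THEN conjunct2, THEN conjunct2, THEN conjunct2, THEN spec, of W]
        S(2)[THEN conjunct2, THEN conjunct2, THEN conjunct2, THEN spec, of Z] herm_det_chart_FT
      by (simp add: algebra_simps del: complex_cnj_mult complex_cnj_power complex_cnj_add)
    ultimately show ?thesis by blast
  next
    assume c: "\<not> snd c" "fst c"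
    note S = D1[unfolded if_P[OF c(2)]] D2[unfolded if_not_P[OF c(1)]]
    have "Omega_factor c (k1 u, k2 u) = - 1 * (1 / (k1 u + cnj (k2 u))\<^sup>2)"
      using c by (simp add: Omega_factor_def)
    moreover have "null_a (f u) (\<nu> u) * null_a (f u) (- \<nu> u) * (cmod (k1 u + cnj (k2 u)))\<^sup>2
      = 4 * (fst (f u))\<^sup>2"
      unfolding null_sum[of "f u" "\<nu> u", symmetric] using S
      by (simp add: cmod_power2) (simp add: power2_eq_square algebra_simps)
    moreover have "dS Z W = - ((null_a (f u) (\<nu> u))\<^sup>2 * (null_a (f u) (- \<nu> u))\<^sup>2)
        * Im (- 1 * (d1 W * cnj (d2 Z)) * cnj ((k1 u + cnj (k2 u))\<^sup>2))" for Z W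
      unfolding dS_def S(1)[THEN conjunct1] S(2)[THEN conjunct1]
        S(1)[THEN conjunct2, THEN conjunct1] S(2)[THEN conjunct2, THEN conjunct1]
        S(1)[THEN conjunct2, THEN conjunct2, THEN conjunct1, THEN spec, of W]
        S(2)[THEN conjunct2, THEN conjunct2, THEN conjunct1, THEN spec, of Z]
        S(1)[THEN conjunct2, THEN conjunct2, THEN conjunct2, THEN spec, of W]
        S(2)[THEN conjunct2, THEN conjunct2, THEN conjunct2, THEN spec, of Z] herm_det_chart_TF
      by (simp add: algebra_simps del: complex_cnj_mult complex_cnj_power complex_cnj_add)
    ultimately show ?thesis by blast
  next
    assume c: "\<not> snd c" "\<not> fst c"
    note S = D1[unfolded if_not_P[OF c(2)]] D2[unfolded if_not_P[OF c(1)]]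
    have "Omega_factor c (k1 u, k2 u) = 1 * (1 / (1 + k1 u * cnj (k2 u))\<^sup>2)"
      using c by (simp add: Omega_factor_def)
    moreover have "null_a (f u) (\<nu> u) * null_b (- \<nu> u) * (cmod (1 + k1 u * cnj (k2 u)))\<^sup>2
      = 4 * (fst (f u))\<^sup>2"
      unfolding null_sum[of "f u" "\<nu> u", symmetric] using S
      by (simp add: cmod_power2) (simp add: power2_eq_square algebra_simps)
    moreover have "dS Z W = - ((null_a (f u) (\<nu> u))\<^sup>2 * (null_b (- \<nu> u))\<^sup>2)
        * Im (1 * (d1 W * cnj (d2 Z)) * cnj ((1 + k1 u * cnj (k2 u))\<^sup>2))" for Z W
      unfolding dS_def S(1)[THEN conjunct1] S(2)[THEN conjunct1]
        S(1)[THEN conjunct2, THEN conjunct1] S(2)[THEN conjunct2, THEN conjunct1]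
        S(1)[THEN conjunct2, THEN conjunct2, THEN conjunct1, THEN spec, of W]
        S(2)[THEN conjunct2, THEN conjunct2, THEN conjunct1, THEN spec, of Z]
        S(1)[THEN conjunct2, THEN conjunct2, THEN conjunct2, THEN spec, of W]
        S(2)[THEN conjunct2, THEN conjunct2, THEN conjunct2, THEN spec, of Z] herm_det_chart_FF
      by (simp del: complex_cnj_mult complex_cnj_power complex_cnj_add)
    ultimately show ?thesis by blast
  qed
  then obtain p s a b where h: "Omega_factor c (k1 u, k2 u) = s * (1 / p\<^sup>2)"
    and ab: "a * b * (cmod p)\<^sup>2 = 4 * (fst (f u))\<^sup>2"
    and dS: "\<And>Z W. dS Z W = - (a\<^sup>2 * b\<^sup>2) * Im (s * (d1 W * cnj (d2 Z)) * cnj (p\<^sup>2))"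
    by blast
  have "L_coords c \<circ> \<gamma> = (\<lambda>v. (k1 v, k2 v))" by (simp add: fun_eq_iff L_coords_def k1_def k2_def)
  then have D: "dir_deriv (L_coords c \<circ> \<gamma>) u Z = (d1 Z, d2 Z)" for Z
    using dir_deriv_eqI[OF has_derivative_Pair[OF d]] by simp
  have t: "fst (f u) > 0" by (rule pos[OF U(2)])
  have "induced_metric \<gamma> u X Y = 2 * Im (1 / p\<^sup>2 * (s * (d1 X * cnj (d2 Y) + d1 Y * cnj (d2 X))))"
    unfolding induced_metric_def Let_def c_def[symmetric] D L_metric_eq fst_conv snd_conv
    using h by (simp add: L_coords_def k1_def k2_def mult.assoc mult.commute mult.left_commute)
  also have "\<dots> = 2 * (a\<^sup>2 * b\<^sup>2 * Im (s * (d1 X * cnj (d2 Y)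
    + d1 Y * cnj (d2 X)) * cnj (p\<^sup>2)) / (16 * fst (f u) ^ 4))"
    by (simp only: Im_divide_square[OF ab t])
  also have "\<dots> = - (dS X Y + dS Y X) / (8 * fst (f u) ^ 4)"
    unfolding dS by (simp add: algebra_simps add_divide_distrib diff_divide_distrib)
  also have "dS X Y + dS Y X = - 8 * fst (f u) ^ 3 * (det3 (\<nu> u) (df X) (d\<nu> Y)
    + det3 (\<nu> u) (df Y) (d\<nu> X))"
    unfolding dS_def by (rule herm_det_null[OF tangent tangent])
  finally show ?thesis using t by (simp add: power_numeral_reduce)
qed

section \<open>The principal frame\<close>

definition cross :: "real \<times> complex \<Rightarrow> real \<times> complex \<Rightarrow> real \<times> complex" where
  "cross v w = (Im (cnj (snd v) * snd w), \<i> * (of_real (fst v) * snd w - of_real (fst w) * snd v))"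

lemma cross_orth: "cross v w \<bullet> v = 0" "cross v w \<bullet> w = 0" "v \<bullet> cross v w = 0" "w \<bullet> cross v w = 0"
  by (simp_all add: cross_def inner_prod_def inner_complex_def algebra_simps)

lemma cross_cross: "cross u (cross v w) = (u \<bullet> w) *\<^sub>R v - (u \<bullet> v) *\<^sub>R w"
  by (simp add: cross_def inner_prod_def inner_complex_def prod_eq_iff complex_eq_iff algebra_simps)

lemma cross_norm: "cross v w \<bullet> cross v w = (v \<bullet> v) * (w \<bullet> w) - (v \<bullet> w)\<^sup>2"
  by (simp add: cross_def inner_prod_def inner_complex_def power2_eq_square algebra_simps)

lemma cross_minus: "cross v w = - cross w v"
  by (simp add: cross_def prod_eq_iff algebra_simps)

lemma cross_zero: "cross v 0 = 0"
  by (simp add: cross_def zero_prod_def)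

lemma bounded_bilinear_cross: "bounded_bilinear cross"
proof -
  have "bilinear cross"
    unfolding bilinear_def linear_iff
    by (simp add: cross_def prod_eq_iff complex_eq_iff algebra_simps)
  then show ?thesis by (rule bilinear_conv_bounded_bilinear[THEN iffD1])
qed

lemma det3_cross: "det3 u v w = cross u v \<bullet> w"
  by (simp add: det3_def cross_def inner_prod_def inner_complex_def algebra_simps)

lemma parallel_cross:
  assumes "e = cross u v" "e \<bullet> e = 1" "x \<bullet> u = 0" "x \<bullet> v = 0"
  shows "x = (x \<bullet> e) *\<^sub>R e"
proof -
  have "cross x e = 0" unfolding assms(1) cross_cross using assms(3,4) by simp
  then have "cross e x = 0" using cross_minus[of e x] by simp
  then have "(e \<bullet> x) *\<^sub>R e - (e \<bullet> e) *\<^sub>R x = 0" unfolding cross_cross[symmetric]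
    by (simp add: cross_zero)
  then show ?thesis using assms(2) by (simp add: inner_commute)
qed

lemma parallel_normal:
  assumes "u \<bullet> u = 1" "u \<bullet> v = 0" "u \<bullet> w = 0"
  shows "cross v w = (u \<bullet> cross v w) *\<^sub>R u"
proof -
  have "cross u (cross v w) = 0" unfolding cross_cross using assms by simp
  then have "cross u (cross u (cross v w)) = 0" by (simp add: cross_zero)
  then show ?thesis unfolding cross_cross[of u u] using assms(1) by simp
qed

lemma orthonormal_expansion:
  assumes "u \<bullet> u = 1" "v \<bullet> v = 1" "u \<bullet> v = 0"
  shows "cross u v \<bullet> cross u v = 1"
    and "x = (x \<bullet> u) *\<^sub>R u + (x \<bullet> v) *\<^sub>R v + (x \<bullet> cross u v) *\<^sub>R cross u v"
proof -
  show e: "cross u v \<bullet> cross u v = 1" using assms by (simp add: cross_norm)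
  define y where "y = x - (x \<bullet> u) *\<^sub>R u - (x \<bullet> v) *\<^sub>R v"
  have "y = (y \<bullet> cross u v) *\<^sub>R cross u v"
    by (rule parallel_cross[OF refl e])
      (use assms in \<open>simp_all add: y_def inner_diff_left inner_commute[of v u]\<close>)
  also have "y \<bullet> cross u v = x \<bullet> cross u v"
    by (simp add: y_def inner_diff_left cross_orth)
  finally show "x = (x \<bullet> u) *\<^sub>R u + (x \<bullet> v) *\<^sub>R v + (x \<bullet> cross u v) *\<^sub>R cross u v"
    unfolding y_def by (simp add: algebra_simps)
qed

text \<open>A patch of a surface without umbilic points. Here \<open>k1\<close> and \<open>k2\<close> are the principal
  curvatures with respect to the Euclidean metric of the half-space, and \<open>\<nu>\<close> is the Euclidean
  unit normal; \<open>l1\<close> and \<open>l2\<close> below are the hyperbolic principal curvatures.\<close>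

locale principal_patch =
  fixes V :: "(real \<times> real) set" and f \<nu> :: "real \<times> real \<Rightarrow> real \<times> complex"
    and k1 k2 :: "real \<times> real \<Rightarrow> real"
  assumes V: "open V"
    and f3: "Ck_on 3 f V" and \<nu>3: "Ck_on 3 \<nu> V" and k1: "Ck_on 2 k1 V" and k2: "Ck_on 2 k2 V"
    and pos: "\<And>q. q \<in> V \<Longrightarrow> fst (f q) > 0"
    and inj: "\<And>q X. q \<in> V \<Longrightarrow> X \<noteq> 0 \<Longrightarrow> dir_deriv f q X \<noteq> 0"
    and unit: "\<And>q. q \<in> V \<Longrightarrow> \<nu> q \<bullet> \<nu> q = 1"
    and tangent: "\<And>q X. q \<in> V \<Longrightarrow> \<nu> q \<bullet> dir_deriv f q X = 0"
    and distinct: "\<And>q. q \<in> V \<Longrightarrow> k1 q \<noteq> k2 q"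
    and ev1: "\<And>q. q \<in> V \<Longrightarrow> \<exists>X. X \<noteq> 0 \<and> k1 q *\<^sub>R dir_deriv f q X + dir_deriv \<nu> q X = 0"
    and ev2: "\<And>q. q \<in> V \<Longrightarrow> \<exists>X. X \<noteq> 0 \<and> k2 q *\<^sub>R dir_deriv f q X + dir_deriv \<nu> q X = 0"
begin

definition T1 where "T1 q X = k1 q *\<^sub>R dir_deriv f q X + dir_deriv \<nu> q X"
definition T2 where "T2 q X = k2 q *\<^sub>R dir_deriv f q X + dir_deriv \<nu> q X"
definition l1 where "l1 q = fst (f q) * k1 q + fst (\<nu> q)"
definition l2 where "l2 q = fst (f q) * k2 q + fst (\<nu> q)"

lemma f2: "Ck_on 2 f V" and \<nu>2: "Ck_on 2 \<nu> V"
  using Ck_on_mono[OF _ f3, of 2] Ck_on_mono[OF _ \<nu>3, of 2] by (simp_all del: Ck_on.simps)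

lemma df2: "Ck_on 2 (\<lambda>q. dir_deriv f q X) V" and d\<nu>2: "Ck_on 2 (\<lambda>q. dir_deriv \<nu> q X) V"
  using Ck_on_dir_deriv[of 2 f V X] Ck_on_dir_deriv[of 2 \<nu> V X] f3 \<nu>3
  by (simp_all del: Ck_on.simps add: numeral_3_eq_3 numeral_2_eq_2)

lemma l1_C2: "Ck_on 2 l1 V" and l2_C2: "Ck_on 2 l2 V"
  unfolding l1_def[abs_def] l2_def[abs_def]
  by (intro Ck_on_add Ck_on_mult Ck_on_fst V f2 \<nu>2 k1 k2)+

lemma T1_C2: "Ck_on 2 (\<lambda>q. T1 q X) V" and T2_C2: "Ck_on 2 (\<lambda>q. T2 q X) V"
  unfolding T1_def T2_def by (intro Ck_on_add Ck_on_scaleR V df2 d\<nu>2 k1 k2)+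

lemma D:
  assumes "q \<in> V"
  shows "(f has_derivative dir_deriv f q) (at q)" "(\<nu> has_derivative dir_deriv \<nu> q) (at q)"
    "(k1 has_derivative dir_deriv k1 q) (at q)" "(k2 has_derivative dir_deriv k2 q) (at q)"
    "((\<lambda>q. dir_deriv f q X) has_derivative dir_deriv (\<lambda>q. dir_deriv f q X) q) (at q)"
    "((\<lambda>q. dir_deriv \<nu> q X) has_derivative dir_deriv (\<lambda>q. dir_deriv \<nu> q X) q) (at q)"
    "(l1 has_derivative dir_deriv l1 q) (at q)" "(l2 has_derivative dir_deriv l2 q) (at q)"
    "((\<lambda>q. T1 q X) has_derivative dir_deriv (\<lambda>q. T1 q X) q) (at q)"
    "((\<lambda>q. T2 q X) has_derivative dir_deriv (\<lambda>q. T2 q X) q) (at q)"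
  using assms
  by (auto intro: Ck_on_has_derivative[OF f2] Ck_on_has_derivative[OF \<nu>2] Ck_on_has_derivative[OF
    k1]
     Ck_on_has_derivative[OF k2] Ck_on_has_derivative[OF df2] Ck_on_has_derivative[OF d\<nu>2]
     Ck_on_has_derivative[OF l1_C2] Ck_on_has_derivative[OF l2_C2] Ck_on_has_derivative[OF T1_C2]
     Ck_on_has_derivative[OF T2_C2])

lemma linear_D:
  assumes "q \<in> V"
  shows "linear (dir_deriv f q)" "linear (dir_deriv \<nu> q)" "linear (dir_deriv l1 q)"
    "linear (dir_deriv l2 q)"
  using D[OF assms] has_derivative_linear by blast+

lemma linear_T: "q \<in> V \<Longrightarrow> linear (T1 q)" "q \<in> V \<Longrightarrow> linear (T2 q)"
  unfolding T1_def[abs_def] T2_def[abs_def]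
  by (intro linear_compose_add linear_compose_scale_right linear_D; assumption)+

lemma \<nu>_d\<nu>: assumes "q \<in> V" shows "\<nu> q \<bullet> dir_deriv \<nu> q X = 0"
proof -
  have "((\<lambda>q. \<nu> q \<bullet> \<nu> q) has_derivative (\<lambda>X. \<nu> q \<bullet> dir_deriv \<nu> q X + dir_deriv \<nu> q X \<bullet> \<nu> q)) (at q)"
    by (intro has_derivative_inner D assms)
  moreover have "dir_deriv (\<lambda>q. \<nu> q \<bullet> \<nu> q) q X = dir_deriv (\<lambda>q. 1::real) q X"
    by (rule dir_deriv_cong[OF V assms]) (rule unit)
  ultimately show ?thesis by (simp add: dir_deriv_eqI inner_commute)
qed

lemma second_form_symmetric:
  assumes q: "q \<in> V"
  shows "dir_deriv \<nu> q X \<bullet> dir_deriv f q Y = - (\<nu> q \<bullet> dir_deriv (\<lambda>q. dir_deriv f q Y) q X)"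
    and "dir_deriv \<nu> q X \<bullet> dir_deriv f q Y = dir_deriv \<nu> q Y \<bullet> dir_deriv f q X"
proof -
  have 1: "dir_deriv \<nu> q X \<bullet> dir_deriv f q Y =
    - (\<nu> q \<bullet> dir_deriv (\<lambda>q. dir_deriv f q Y) q X)" for X Y
  proof -
    have "((\<lambda>q. \<nu> q \<bullet> dir_deriv f q Y) has_derivative
        (\<lambda>X. \<nu> q \<bullet> dir_deriv (\<lambda>q. dir_deriv f q Y) q X + dir_deriv \<nu> q X \<bullet> dir_deriv f q Y)) (at q)"
      by (intro has_derivative_inner D q)
    moreover have "dir_deriv (\<lambda>q. \<nu> q \<bullet> dir_deriv f q Y) q X = dir_deriv (\<lambda>q. 0::real) q X"
      by (rule dir_deriv_cong[OF V q]) (rule tangent)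
    ultimately show ?thesis by (simp add: dir_deriv_eqI)
  qed
  then show "dir_deriv \<nu> q X \<bullet> dir_deriv f q Y = - (\<nu> q \<bullet> dir_deriv (\<lambda>q. dir_deriv f q Y) q X)" .
  show "dir_deriv \<nu> q X \<bullet> dir_deriv f q Y = dir_deriv \<nu> q Y \<bullet> dir_deriv f q X"
    unfolding 1 dir_deriv_commute[OF V q f2, of Y X] ..
qed

lemma T_normal: "q \<in> V \<Longrightarrow> T1 q X \<bullet> \<nu> q = 0" "q \<in> V \<Longrightarrow> T2 q X \<bullet> \<nu> q = 0"
  using tangent[of q X] \<nu>_d\<nu>[of q X] by (simp_all add: T1_def T2_def inner_add_right inner_commute)

lemma T_symmetric:
  "q \<in> V \<Longrightarrow> T1 q X \<bullet> dir_deriv f q Y = T1 q Y \<bullet> dir_deriv f q X"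
  "q \<in> V \<Longrightarrow> T2 q X \<bullet> dir_deriv f q Y = T2 q Y \<bullet> dir_deriv f q X"
  using second_form_symmetric(2)[of q X Y]
  by (simp_all add: T1_def T2_def inner_add_left inner_commute[of "dir_deriv f q X"])

lemma df_eq_T_diff: "q \<in> V \<Longrightarrow> (k2 q - k1 q) *\<^sub>R dir_deriv f q X = T2 q X - T1 q X"
  by (simp add: T1_def T2_def algebra_simps)

definition e1 where "e1 c q = T2 q c /\<^sub>R norm (T2 q c)"
definition e2 where "e2 c q = cross (\<nu> q) (e1 c q)"

text \<open>The symmetry of the second fundamental form makes the values of \<open>T2\<close> orthogonal to the
  direction that \<open>T2\<close> annihilates, and to the normal; so they are parallel to the other principal
  direction. Normalizing a nonzero value is a way to get a differentiable principal frame.\<close>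

lemma frame:
  assumes q: "q \<in> V" and c: "T2 q c \<noteq> 0"
  shows "e1 c q \<bullet> e1 c q = 1" "\<nu> q \<bullet> e1 c q = 0" "e2 c q \<bullet> e2 c q = 1" "e1 c q \<bullet> e2 c q = 0"
    and "T2 q X = (e1 c q \<bullet> T2 q X) *\<^sub>R e1 c q" "T1 q X = (e2 c q \<bullet> T1 q X) *\<^sub>R e2 c q"
proof -
  show e1: "e1 c q \<bullet> e1 c q = 1"
    using c by (simp add: e1_def power2_norm_eq_inner[symmetric] power2_eq_square)
  show n: "\<nu> q \<bullet> e1 c q = 0" using T_normal(2)[OF q, of c] by (simp add: e1_def inner_commute)
  note on = orthonormal_expansion[OF unit[OF q] e1 n, folded e2_def]
  show "e2 c q \<bullet> e2 c q = 1" by (rule on(1))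
  show "e1 c q \<bullet> e2 c q = 0" by (simp add: e2_def cross_orth)
  obtain X2 where X2: "X2 \<noteq> 0" "T2 q X2 = 0" using ev2[OF q] unfolding T2_def by blast
  obtain X1 where X1: "X1 \<noteq> 0" "T1 q X1 = 0" using ev1[OF q] unfolding T1_def by blast
  have T2_X2: "T2 q X \<bullet> dir_deriv f q X2 = 0" for X using T_symmetric(2)[OF q, of X X2] X2 by simp
  have T1_X1: "T1 q X \<bullet> dir_deriv f q X1 = 0" for X using T_symmetric(1)[OF q, of X X1] X1 by simp
  have "dir_deriv f q X2 = (dir_deriv f q X2 \<bullet> e2 c q) *\<^sub>R e2 c q"
    using on(2)[of "dir_deriv f q X2"] T2_X2[of c] tangent[OF q, of X2]
    by (simp add: e1_def inner_commute)
  moreover have "dir_deriv f q X2 \<noteq> 0" by (rule inj[OF q X2(1)])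
  ultimately obtain s where s: "dir_deriv f q X2 = s *\<^sub>R e2 c q" "s \<noteq> 0" by force
  have T2_e2: "T2 q X \<bullet> e2 c q = 0" for X using T2_X2[of X] s by simp
  then show "T2 q X = (e1 c q \<bullet> T2 q X) *\<^sub>R e1 c q"
    using on(2)[of "T2 q X"] T_normal(2)[OF q] by (simp add: inner_commute)
  have "(k2 q - k1 q) *\<^sub>R (dir_deriv f q X1 \<bullet> e2 c q) = 0"
    using df_eq_T_diff[OF q, of X1] T2_e2[of X1] X1(2)
      by (metis diff_zero inner_scaleR_left scaleR_conv_of_real of_real_eq_id id_apply)
  then have "dir_deriv f q X1 \<bullet> e2 c q = 0" using distinct[OF q] by simp
  then have "dir_deriv f q X1 = (dir_deriv f q X1 \<bullet> e1 c q) *\<^sub>R e1 c q"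
    using on(2)[of "dir_deriv f q X1"] tangent[OF q, of X1] by (simp add: inner_commute)
  moreover have "dir_deriv f q X1 \<noteq> 0" by (rule inj[OF q X1(1)])
  ultimately obtain r where r: "dir_deriv f q X1 = r *\<^sub>R e1 c q" "r \<noteq> 0" by force
  have "T1 q X \<bullet> e1 c q = 0" using T1_X1[of X] r by simp
  then show "T1 q X = (e2 c q \<bullet> T1 q X) *\<^sub>R e2 c q"
    using on(2)[of "T1 q X"] T_normal(1)[OF q] by (simp add: inner_commute)
qed

text \<open>The scalar product of \<open>e\<close> with the exterior derivative of \<open>T = e a\<close>, where \<open>T = k df + d\<nu>\<close>:
  on the left only \<open>dk \<and> df\<close> survives since \<open>f\<close> and \<open>\<nu>\<close> have symmetric second derivatives, and on
  the right only \<open>da\<close> since \<open>e\<close> has constant length.\<close>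

lemma codazzi:
  assumes W: "open W" "W \<subseteq> V" "q \<in> W" and e: "Ck_on 1 e W" "\<And>q. q \<in> W \<Longrightarrow> e q \<bullet> e q = 1"
    and k: "Ck_on 2 k V"
    and T: "\<And>q X. T q X = k q *\<^sub>R dir_deriv f q X + dir_deriv \<nu> q X"
    and Te: "\<And>q X. q \<in> W \<Longrightarrow> T q X = (e q \<bullet> T q X) *\<^sub>R e q"
  shows "dir_deriv (\<lambda>q. e q \<bullet> T q Y) q X - dir_deriv (\<lambda>q. e q \<bullet> T q X) q Y
    = dir_deriv k q X * (e q \<bullet> dir_deriv f q Y) - dir_deriv k q Y * (e q \<bullet> dir_deriv f q X)"
proof -
  have q: "q \<in> V" using W by auto
  have e': "(e has_derivative dir_deriv e q) (at q)"
    by (rule Ck_on_has_derivative[OF e(1) _ W(3)]) simp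
  have k': "(k has_derivative dir_deriv k q) (at q)" by (rule Ck_on_has_derivative[OF k _ q]) simp
  have ee: "dir_deriv e q X \<bullet> e q = 0" for X
  proof -
    have "((\<lambda>q. e q \<bullet> e q) has_derivative (\<lambda>X. e q \<bullet> dir_deriv e q X
      + dir_deriv e q X \<bullet> e q)) (at q)"
      by (intro has_derivative_inner e')
    moreover have "dir_deriv (\<lambda>q. e q \<bullet> e q) q X = dir_deriv (\<lambda>q. 1::real) q X"
      by (rule dir_deriv_cong[OF W(1,3)]) (rule e(2))
    ultimately show ?thesis by (simp add: dir_deriv_eqI inner_commute)
  qed
  have 1: "dir_deriv (\<lambda>q. e q \<bullet> T q Y) q X = dir_deriv k q X * (e q \<bullet> dir_deriv f q Y)
      + e q \<bullet> (k q *\<^sub>R dir_deriv (\<lambda>q. dir_deriv f q Y) q X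
        + dir_deriv (\<lambda>q. dir_deriv \<nu> q Y) q X)" for X Y
  proof -
    have "((\<lambda>q. T q Y) has_derivative (\<lambda>X. (k q *\<^sub>R dir_deriv (\<lambda>q. dir_deriv f q Y) q X
        + dir_deriv k q X *\<^sub>R dir_deriv f q Y) + dir_deriv (\<lambda>q. dir_deriv \<nu> q Y) q X)) (at q)"
      unfolding T by (intro has_derivative_add has_derivative_scaleR k' D q)
    from dir_deriv_eqI[OF has_derivative_inner[OF e' this], of X]
    have "dir_deriv (\<lambda>q. e q \<bullet> T q Y) q X = e q \<bullet> ((k q *\<^sub>R dir_deriv (\<lambda>q. dir_deriv f q Y) q X
        + dir_deriv k q X *\<^sub>R dir_deriv f q Y) + dir_deriv (\<lambda>q. dir_deriv \<nu> q Y) q X)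
        + dir_deriv e q X \<bullet> T q Y" .
    moreover have "dir_deriv e q X \<bullet> T q Y = 0" by (subst Te[OF W(3)]) (simp add: ee)
    ultimately show ?thesis by (simp add: inner_add_right algebra_simps)
  qed
  show ?thesis
    unfolding 1 dir_deriv_commute[OF V q f2, of Y X] dir_deriv_commute[OF V q \<nu>2, of Y X] by simp
qed

lemma dir_deriv_l:
  assumes q: "q \<in> V"
  shows "dir_deriv l1 q X = fst (f q) * dir_deriv k1 q X + fst (T1 q X)"
    "dir_deriv l2 q X = fst (f q) * dir_deriv k2 q X + fst (T2 q X)"
proof -
  have "(l1 has_derivative (\<lambda>X. (fst (f q) * dir_deriv k1 q X + fst (dir_deriv f q X) * k1 q)
      + fst (dir_deriv \<nu> q X))) (at q)"
    unfolding l1_def[abs_def] by (intro has_derivative_add has_derivative_mult has_derivative_fst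
      D q)
  from dir_deriv_eqI[OF this, of X]
  show "dir_deriv l1 q X = fst (f q) * dir_deriv k1 q X + fst (T1 q X)" by (simp add: T1_def)
  have "(l2 has_derivative (\<lambda>X. (fst (f q) * dir_deriv k2 q X + fst (dir_deriv f q X) * k2 q)
      + fst (dir_deriv \<nu> q X))) (at q)"
    unfolding l2_def[abs_def] by (intro has_derivative_add has_derivative_mult has_derivative_fst
      D q)
  from dir_deriv_eqI[OF this, of X]
  show "dir_deriv l2 q X = fst (f q) * dir_deriv k2 q X + fst (T2 q X)" by (simp add: T2_def)
qed

lemma l_diff: "l2 q - l1 q = fst (f q) * (k2 q - k1 q)"
  by (simp add: l1_def l2_def algebra_simps)

lemma l_distinct: "q \<in> V \<Longrightarrow> l2 q - l1 q \<noteq> 0"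
  unfolding l_diff using pos[of q] distinct[of q] by simp

lemma gauss_curvature_eq_0_iff:
  assumes g: "\<And>q X Y. q \<in> V \<Longrightarrow> g q X Y = (det3 (\<nu> q) (dir_deriv f q X) (dir_deriv \<nu> q Y)
      + det3 (\<nu> q) (dir_deriv f q Y) (dir_deriv \<nu> q X)) / fst (f q)"
    and p: "p \<in> V"
  shows "gauss_curvature g p = 0 \<longleftrightarrow>
    dir_deriv l1 p (1, 0) * dir_deriv l2 p (0, 1) = dir_deriv l1 p (0, 1) * dir_deriv l2 p (1, 0)"
proof -
  \<comment> \<open>A constant parameter vector that is principal at \<open>p\<close>; \<open>T2\<close> does not annihilate it near \<open>p\<close>.\<close>
  obtain c where "c \<noteq> 0" "T1 p c = 0" using ev1[OF p] unfolding T1_def by blast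
  then have c: "T2 p c \<noteq> 0" using df_eq_T_diff[OF p, of c] inj[OF p \<open>c \<noteq> 0\<close>] distinct[OF p] by auto
  define W where "W = {q \<in> V. T2 q c \<noteq> 0}"
  have W: "open W"
    unfolding W_def
    using continuous_open_preimage[OF Ck_on_imp_continuous_on[OF T2_C2[of c]] V, of "- {0}"]
    by (simp add: vimage_def Int_def open_Compl)
  have WV: "W \<subseteq> V" and pW: "p \<in> W" using p c by (auto simp: W_def)
  have in_V: "q \<in> V" if "q \<in> W" for q using that WV by auto
  note fr = frame[OF in_V, of _ c]
  have frm: "e1 c q \<bullet> e1 c q = 1" "\<nu> q \<bullet> e1 c q = 0" "e2 c q \<bullet> e2 c q = 1" "e1 c q \<bullet> e2 c q = 0"
    "T2 q X = (e1 c q \<bullet> T2 q X) *\<^sub>R e1 c q" "T1 q X = (e2 c q \<bullet> T1 q X) *\<^sub>R e2 c q" if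
      "q \<in> W" for q X
    using fr[OF that] that by (auto simp: W_def)
  note CW = Ck_on_subset[OF WV]
  have e1: "Ck_on 2 (e1 c) W"
    unfolding e1_def[abs_def] norm_eq_sqrt_inner
    by (intro Ck_on_scaleR Ck_on_inverse Ck_on_sqrt Ck_on_inner W CW[OF T2_C2])
      (auto simp: W_def inner_eq_zero_iff)
  have e2: "Ck_on 2 (e2 c) W"
    unfolding e2_def[abs_def] by (intro Ck_on_bilinear[OF bounded_bilinear_cross] W e1 CW[OF \<nu>2])
  have e11: "Ck_on 1 (e1 c) W" "Ck_on 1 (e2 c) W"
    using Ck_on_mono[OF _ e1, of 1] Ck_on_mono[OF _ e2, of 1]
      by (simp_all del: Ck_on.simps One_nat_def)
  define \<alpha> where "\<alpha> q X = e1 c q \<bullet> T2 q X" for q X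
  define \<beta> where "\<beta> q X = e2 c q \<bullet> T1 q X" for q X
  define \<Delta> where "\<Delta> q = l2 q - l1 q" for q
  have \<Delta>0: "\<Delta> q \<noteq> 0" if "q \<in> W" for q using l_distinct[OF in_V[OF that]] by (simp add: \<Delta>_def)
  have \<Delta>2: "Ck_on 2 \<Delta> W" unfolding \<Delta>_def[abs_def] by (intro Ck_on_diff W CW l1_C2 l2_C2)
  have \<alpha>2: "Ck_on 2 (\<lambda>q. \<alpha> q X) W" for X
    unfolding \<alpha>_def by (intro Ck_on_inner W e1 CW T2_C2)
  have \<beta>2: "Ck_on 2 (\<lambda>q. \<beta> q X) W" for X
    unfolding \<beta>_def by (intro Ck_on_inner W e2 CW T1_C2)
  have e_df: "(k2 q - k1 q) * (e1 c q \<bullet> dir_deriv f q X) = \<alpha> q X"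
    "(k2 q - k1 q) * (e2 c q \<bullet> dir_deriv f q X) = - \<beta> q X" if "q \<in> W" for q X
  proof -
    have "(k2 q - k1 q) * (e \<bullet> dir_deriv f q X) = e \<bullet> T2 q X - e \<bullet> T1 q X" for e
      using arg_cong[OF df_eq_T_diff[OF in_V[OF that], of X], of
        "\<lambda>v. e \<bullet> v"] by (simp add: inner_diff_right)
    note * = this[of "e1 c q"] this[of "e2 c q"]
    have "e1 c q \<bullet> T1 q X = 0" by (subst frm(6)[OF that]) (simp add: frm(4)[OF that])
    moreover have "e2 c q \<bullet> T2 q X = 0"
      by (subst frm(5)[OF that]) (simp add: frm(4)[OF that] inner_commute)
    ultimately show "(k2 q - k1 q) * (e1 c q \<bullet> dir_deriv f q X) = \<alpha> q X"
      "(k2 q - k1 q) * (e2 c q \<bullet> dir_deriv f q X) = - \<beta> q X"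
      using * by (simp_all add: \<alpha>_def \<beta>_def)
  qed
  have d\<alpha>: "dir_deriv (\<lambda>q. \<alpha> q Y) q X - dir_deriv (\<lambda>q. \<alpha> q X) q Y
      = (dir_deriv l2 q X * \<alpha> q Y - dir_deriv l2 q Y * \<alpha> q X) / \<Delta> q" if q: "q \<in> W" for q X Y
  proof -
    have "dir_deriv (\<lambda>q. \<alpha> q Y) q X - dir_deriv (\<lambda>q. \<alpha> q X) q Y
      = dir_deriv k2 q X * (e1 c q \<bullet> dir_deriv f q Y)
        - dir_deriv k2 q Y * (e1 c q \<bullet> dir_deriv f q X)"
      unfolding \<alpha>_def
      by (rule codazzi[OF W WV q e11(1) frm(1) k2 T2_def frm(5)])
    then have "\<Delta> q * (dir_deriv (\<lambda>q. \<alpha> q Y) q X - dir_deriv (\<lambda>q. \<alpha> q X) q Y)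
      = fst (f q) * (dir_deriv k2 q X * ((k2 q - k1 q) * (e1 c q \<bullet> dir_deriv f q Y))
        - dir_deriv k2 q Y * ((k2 q - k1 q) * (e1 c q \<bullet> dir_deriv f q X)))"
      unfolding \<Delta>_def l_diff by (simp only:) (simp add: algebra_simps)
    also have "\<dots> = fst (f q) * (dir_deriv k2 q X * \<alpha> q Y - dir_deriv k2 q Y * \<alpha> q X)"
      unfolding e_df(1)[OF q] ..
    also have "fst (f q) * dir_deriv k2 q Z = dir_deriv l2 q Z - \<alpha> q Z * fst (e1 c q)" for Z
      using dir_deriv_l(2)[OF in_V[OF q], of Z] arg_cong[OF frm(5)[OF q, of Z], of fst]
        by (simp add: \<alpha>_def)
    note * = this
    have "fst (f q) * (dir_deriv k2 q X * \<alpha> q Y - dir_deriv k2 q Y * \<alpha> q X)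
      = (dir_deriv l2 q X * \<alpha> q Y - dir_deriv l2 q Y * \<alpha> q X)"
      unfolding right_diff_distrib mult.assoc[symmetric] * by (simp add: algebra_simps)
    finally show ?thesis using \<Delta>0[OF q] by (simp add: field_simps)
  qed
  have d\<beta>: "dir_deriv (\<lambda>q. \<beta> q Y) q X - dir_deriv (\<lambda>q. \<beta> q X) q Y
      = - (dir_deriv l1 q X * \<beta> q Y - dir_deriv l1 q Y * \<beta> q X) / \<Delta> q" if q: "q \<in> W" for q X Y
  proof -
    have "dir_deriv (\<lambda>q. \<beta> q Y) q X - dir_deriv (\<lambda>q. \<beta> q X) q Y
      = dir_deriv k1 q X * (e2 c q \<bullet> dir_deriv f q Y)
        - dir_deriv k1 q Y * (e2 c q \<bullet> dir_deriv f q X)"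
      unfolding \<beta>_def
      by (rule codazzi[OF W WV q e11(2) frm(3) k1 T1_def frm(6)])
    then have "\<Delta> q * (dir_deriv (\<lambda>q. \<beta> q Y) q X - dir_deriv (\<lambda>q. \<beta> q X) q Y)
      = fst (f q) * (dir_deriv k1 q X * ((k2 q - k1 q) * (e2 c q \<bullet> dir_deriv f q Y))
        - dir_deriv k1 q Y * ((k2 q - k1 q) * (e2 c q \<bullet> dir_deriv f q X)))"
      unfolding \<Delta>_def l_diff by (simp only:) (simp add: algebra_simps)
    also have "\<dots> = - (fst (f q) * (dir_deriv k1 q X * \<beta> q Y - dir_deriv k1 q Y * \<beta> q X))"
      unfolding e_df(2)[OF q] by (simp add: algebra_simps)
    also have "fst (f q) * dir_deriv k1 q Z = dir_deriv l1 q Z - \<beta> q Z * fst (e2 c q)" for Z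
      using dir_deriv_l(1)[OF in_V[OF q], of Z] arg_cong[OF frm(6)[OF q, of Z], of fst]
        by (simp add: \<beta>_def)
    note * = this
    have "fst (f q) * (dir_deriv k1 q X * \<beta> q Y - dir_deriv k1 q Y * \<beta> q X)
      = (dir_deriv l1 q X * \<beta> q Y - dir_deriv l1 q Y * \<beta> q X)"
      unfolding right_diff_distrib mult.assoc[symmetric] * by (simp add: algebra_simps)
    finally show ?thesis using \<Delta>0[OF q] by (simp add: field_simps)
  qed
  have metric: "g q X Y = \<alpha> q X * (\<beta> q Y / \<Delta> q) + \<alpha> q Y * (\<beta> q X / \<Delta> q)" if q: "q \<in> W" for q X Y
  proof -
    have 1: "(k2 q - k1 q) * det3 (\<nu> q) (dir_deriv f q X) (dir_deriv \<nu> q Y)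
        = \<alpha> q Y * \<beta> q X - (k2 q - k1 q) * (k2 q * det3 (\<nu> q) (dir_deriv f q X) (dir_deriv f q
          Y))" for X Y
    proof -
      have "dir_deriv \<nu> q Y = T2 q Y - k2 q *\<^sub>R dir_deriv f q Y" by (simp add: T2_def)
      also have "T2 q Y = \<alpha> q Y *\<^sub>R e1 c q" using frm(5)[OF q, of Y] unfolding \<alpha>_def .
      finally have A: "det3 (\<nu> q) (dir_deriv f q X) (dir_deriv \<nu> q Y)
        = \<alpha> q Y * det3 (\<nu> q) (dir_deriv f q X) (e1 c q)
          - k2 q * det3 (\<nu> q) (dir_deriv f q X) (dir_deriv f q Y)"
        by (simp add: det3_cross inner_diff_right)
      have B: "det3 (\<nu> q) (dir_deriv f q X) (e1 c q) = - (e2 c q \<bullet> dir_deriv f q X)"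
        unfolding e2_def det3_cross[symmetric] by (simp add: det3_def algebra_simps)
      have "\<beta> q X = - ((k2 q - k1 q) * (e2 c q \<bullet> dir_deriv f q X))"
        using e_df(2)[OF q, of X] by simp
      then show ?thesis unfolding A B by (simp only:) (simp add: algebra_simps)
    qed
    have "det3 (\<nu> q) (dir_deriv f q Y) (dir_deriv f q X)
      = - det3 (\<nu> q) (dir_deriv f q X) (dir_deriv f q Y)"
      by (simp add: det3_def algebra_simps)
    then have "(k2 q - k1 q) * (det3 (\<nu> q) (dir_deriv f q X) (dir_deriv \<nu> q Y)
      + det3 (\<nu> q) (dir_deriv f q Y) (dir_deriv \<nu> q X)) = \<alpha> q X * \<beta> q Y + \<alpha> q Y * \<beta> q X"
      unfolding distrib_left 1 by (simp add: algebra_simps)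
    moreover have "k2 q - k1 q \<noteq> 0" using distinct[OF in_V[OF q]] by simp
    ultimately have "det3 (\<nu> q) (dir_deriv f q X) (dir_deriv \<nu> q Y)
      + det3 (\<nu> q) (dir_deriv f q Y) (dir_deriv \<nu> q X)
      = (\<alpha> q X * \<beta> q Y + \<alpha> q Y * \<beta> q X) / (k2 q - k1 q)"
      by (metis nonzero_mult_div_cancel_left)
    then show ?thesis
      unfolding g[OF in_V[OF q]] \<Delta>_def l_diff by (simp add: add_divide_distrib mult.commute)
  qed
  have indep: "\<alpha> q (1, 0) * (\<beta> q (0, 1) / \<Delta> q) - \<alpha> q (0, 1) * (\<beta> q (1, 0) / \<Delta> q) \<noteq> 0" if q:
    "q \<in> W" for q
  proof
    assume "\<alpha> q (1, 0) * (\<beta> q (0, 1) / \<Delta> q) - \<alpha> q (0, 1) * (\<beta> q (1, 0) / \<Delta> q) = 0"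
    then have 0: "\<alpha> q (1, 0) * \<beta> q (0, 1) = \<alpha> q (0, 1) * \<beta> q (1, 0)" using \<Delta>0[OF q]
      by (simp add: field_simps)
    have lin: "linear (\<alpha> q)" "linear (\<beta> q)"
      unfolding \<alpha>_def[abs_def] \<beta>_def[abs_def]
      using linear_compose[OF linear_T(2)[OF in_V[OF q]] bounded_linear.linear[OF
        bounded_linear_inner_right[of "e1 c q"]]]
        linear_compose[OF linear_T(1)[OF in_V[OF q]] bounded_linear.linear[OF
          bounded_linear_inner_right[of "e2 c q"]]]
      by (simp_all add: o_def)
    have ker: "X = 0" if "\<alpha> q X = 0" "\<beta> q X = 0" for X
    proof (rule ccontr)
      assume "X \<noteq> 0"
      have "T2 q X = 0" "T1 q X = 0" using frm(5,6)[OF q, of X] that by (simp_all add: \<alpha>_def \<beta>_def)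
      then show False using df_eq_T_diff[OF in_V[OF q], of X] inj[OF in_V[OF q] \<open>X \<noteq> 0\<close>]
        distinct[OF in_V[OF q]] by simp
    qed
    have "(\<alpha> q (0, 1), - \<alpha> q (1, 0)) = 0" "(\<beta> q (0, 1), - \<beta> q (1, 0)) = 0"
      by (rule ker; subst linear_real_pair[OF lin(1)] linear_real_pair[OF lin(2)]; use 0 in \<open>simp
        add: algebra_simps\<close>)+
    then have "\<alpha> q (1, 0) = 0" "\<beta> q (1, 0) = 0" by (simp_all add: zero_prod_def)
    from ker[OF this] show False by (simp add: zero_prod_def)
  qed
  \<comment> \<open>The same form serves for both members of the coframe, as the factor \<open>1 / \<Delta>\<close> of \<open>\<beta>\<close>
    contributes \<open>- d\<Delta> / \<Delta>\<close> and thus exchanges \<open>l1\<close> for \<open>l2\<close>.\<close>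
  define w where "w q X = - dir_deriv l2 q X / \<Delta> q" for q X
  have D\<Delta>: "(\<Delta> has_derivative dir_deriv \<Delta> q) (at q)" if "q \<in> W" for q
    by (rule Ck_on_has_derivative[OF \<Delta>2 _ that]) simp
  have d\<Delta>: "dir_deriv \<Delta> q X = dir_deriv l2 q X - dir_deriv l1 q X" if q: "q \<in> W" for q X
    unfolding \<Delta>_def[abs_def] by (rule dir_deriv_eqI) (intro has_derivative_diff D in_V q)
  interpret N: null_coframe W g \<alpha> "\<lambda>q X. \<beta> q X / \<Delta> q" w
  proof (rule null_coframe.intro)
    show "open W" by (rule W)
    show "g q X Y = \<alpha> q X * (\<beta> q Y / \<Delta> q) + \<alpha> q Y * (\<beta> q X / \<Delta> q)" if "q \<in> W" for q X Y
      by (rule metric[OF that])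
    show "Ck_on 2 (\<lambda>q. \<alpha> q X) W" for X by (rule \<alpha>2)
    show "Ck_on 2 (\<lambda>q. \<beta> q X / \<Delta> q) W" for X by (intro Ck_on_divide W \<beta>2 \<Delta>2 \<Delta>0)
    show "\<alpha> q (1, 0) * (\<beta> q (0, 1) / \<Delta> q) - \<alpha> q (0, 1) * (\<beta> q (1, 0) / \<Delta> q) \<noteq> 0" if "q \<in> W" for q
      by (rule indep[OF that])
    show "linear (\<alpha> q)" if "q \<in> W" for q
      unfolding \<alpha>_def[abs_def]
      using linear_compose[OF linear_T(2)[OF in_V[OF that]] bounded_linear.linear[OF
        bounded_linear_inner_right[of "e1 c q"]]]
      by (simp add: o_def)
    show "linear (\<lambda>X. \<beta> q X / \<Delta> q)" if "q \<in> W" for q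
      unfolding \<beta>_def[abs_def]
      using linear_compose[OF linear_T(1)[OF in_V[OF that]] bounded_linear.linear[OF
        bounded_linear_compose[OF
            bounded_linear_divide[of "\<Delta> q"] bounded_linear_inner_right[of "e2 c q"]]]]
      by (simp add: o_def)
    show "Ck_on 1 (\<lambda>q. w q X) W" for X
    proof -
      have "Ck_on 1 \<Delta> W" using Ck_on_mono[OF _ \<Delta>2, of 1] by (simp del: Ck_on.simps One_nat_def)
      moreover have "Ck_on 1 (\<lambda>q. dir_deriv l2 q X) W"
        using CW[OF Ck_on_dir_deriv[of 1 l2 V X]] l2_C2
          by (simp del: Ck_on.simps add: numeral_2_eq_2)
      ultimately show ?thesis unfolding w_def by (intro Ck_on_divide Ck_on_minus W \<Delta>0)
    qed
    show "dir_deriv (\<lambda>q. \<alpha> q Y) q X - dir_deriv (\<lambda>q. \<alpha> q X) q Y = w q Y * \<alpha> q X - w q X * \<alpha> q Y"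
      if "q \<in> W" for q X Y
      unfolding d\<alpha>[OF that] w_def using \<Delta>0[OF that] by (simp add: field_simps)
    show "dir_deriv (\<lambda>q. \<beta> q Y / \<Delta> q) q X - dir_deriv (\<lambda>q. \<beta> q X / \<Delta> q) q Y
      = w q X * (\<beta> q Y / \<Delta> q) - w q Y * (\<beta> q X / \<Delta> q)" if q: "q \<in> W" for q X Y
    proof -
      have D\<beta>: "((\<lambda>q. \<beta> q Y) has_derivative dir_deriv (\<lambda>q. \<beta> q Y) q) (at q)" for Y
        by (rule Ck_on_has_derivative[OF \<beta>2 _ q]) simp
      have "((\<lambda>q. \<beta> q Y / \<Delta> q) has_derivative (\<lambda>h. (dir_deriv (\<lambda>q. \<beta> q Y) q h * \<Delta> q
          - \<beta> q Y * dir_deriv \<Delta> q h) / (\<Delta> q * \<Delta> q))) (at q)" for Y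
        by (rule has_derivative_divide'[OF D\<beta> D\<Delta>[OF q] \<Delta>0[OF q]])
      from dir_deriv_eqI[OF this] have *: "dir_deriv (\<lambda>q. \<beta> q Y / \<Delta> q) q X
        = (dir_deriv (\<lambda>q. \<beta> q Y) q X * \<Delta> q - \<beta> q Y * dir_deriv \<Delta> q X) / (\<Delta> q * \<Delta> q)" for X Y .
      have "dir_deriv (\<lambda>q. \<beta> q Y) q X = dir_deriv (\<lambda>q. \<beta> q X) q Y
        - (dir_deriv l1 q X * \<beta> q Y - dir_deriv l1 q Y * \<beta> q X) / \<Delta> q"
        using d\<beta>[OF q, of Y X] by (simp add: diff_divide_distrib)
      then show ?thesis
        unfolding * d\<Delta>[OF q] w_def using \<Delta>0[OF q] by (simp add: field_simps)
    qed
  qed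
  have "((\<lambda>q. w q Y) has_derivative (\<lambda>h. ((- dir_deriv (\<lambda>q. dir_deriv l2 q Y) p h) * \<Delta> p
      - (- dir_deriv l2 p Y) * dir_deriv \<Delta> p h) / (\<Delta> p * \<Delta> p))) (at p)" for Y
  proof -
    have "((\<lambda>q. dir_deriv l2 q Y) has_derivative dir_deriv (\<lambda>q. dir_deriv l2 q Y) p) (at p)"
      using Ck_on_has_derivative[OF Ck_on_dir_deriv[of 1 l2 V Y] _ p] l2_C2
      by (simp del: Ck_on.simps add: numeral_2_eq_2)
    then show ?thesis
      unfolding w_def by (intro has_derivative_divide' has_derivative_minus D\<Delta> \<Delta>0 pW)
  qed
  from dir_deriv_eqI[OF this] have *: "dir_deriv (\<lambda>q. w q Y) p X
    = (dir_deriv l2 p Y * dir_deriv \<Delta> p X - dir_deriv (\<lambda>q. dir_deriv l2 q Y) p X * \<Delta> p) / (\<Delta> p *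
      \<Delta> p)" for X Y
    by simp
  have "N.dw p (1, 0) (0, 1) = (dir_deriv l2 p (1, 0) * dir_deriv l1 p (0, 1)
      - dir_deriv l2 p (0, 1) * dir_deriv l1 p (1, 0)) / (\<Delta> p * \<Delta> p)"
    unfolding N.dw_def * d\<Delta>[OF pW] dir_deriv_commute_real[OF V p l2_C2, of "(1, 0)" "(0, 1)"]
    by (simp add: diff_divide_distrib[symmetric] algebra_simps)
  then show ?thesis
    unfolding N.gauss_curvature_eq_0_iff[OF pW] using \<Delta>0[OF pW] by (auto simp: algebra_simps)
qed

end

section \<open>Principal curvatures in the half-space\<close>

lemma dir_deriv_hyp_metric:
  assumes "fst p > 0"
  shows "dir_deriv (\<lambda>q. hyp_metric q v w) p x = - 2 * fst x * (v \<bullet> w) / fst p ^ 3"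
proof -
  have "((\<lambda>q. hyp_metric q v w) has_derivative
      (\<lambda>x. (0 * (fst p)\<^sup>2 - (v \<bullet> w) * (2 * fst x * fst p)) / ((fst p)\<^sup>2 * (fst p)\<^sup>2))) (at p)"
    unfolding hyp_metric_def using assms
    by (intro has_derivative_divide') (auto intro!: derivative_eq_intros)
  from dir_deriv_eqI[OF this] show ?thesis
    using assms by (simp add: power2_eq_square power3_eq_cube field_simps)
qed

lemma christoffel_hyp_metric:
  assumes p: "fst p > 0"
  shows "christoffel hyp_metric p v w
    = (- 1 / fst p) *\<^sub>R (fst v *\<^sub>R w + fst w *\<^sub>R v - (v \<bullet> w) *\<^sub>R (1, 0))"
  unfolding christoffel_def
proof (rule the_equality)
  let ?Z = "(- 1 / fst p) *\<^sub>R (fst v *\<^sub>R w + fst w *\<^sub>R v - (v \<bullet> w) *\<^sub>R (1, 0))"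
  have e: "(1, 0) \<bullet> x = fst x" for x :: "real \<times> complex" by (simp add: inner_prod_def)
  show koszul: "\<forall>x. 2 * hyp_metric p ?Z x = dir_deriv (\<lambda>q. hyp_metric q w x) p v
      + dir_deriv (\<lambda>q. hyp_metric q v x) p w - dir_deriv (\<lambda>q. hyp_metric q v w) p x"
    unfolding dir_deriv_hyp_metric[OF p]
    unfolding hyp_metric_def inner_scaleR_left inner_add_left inner_diff_left e
    using p by (simp add: power2_eq_square power3_eq_cube divide_simps)
  fix Z assume Z: "\<forall>x. 2 * hyp_metric p Z x = dir_deriv (\<lambda>q. hyp_metric q w x) p v
      + dir_deriv (\<lambda>q. hyp_metric q v x) p w - dir_deriv (\<lambda>q. hyp_metric q v w) p x"
  have "hyp_metric p Z x = hyp_metric p ?Z x" for x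
    using spec[OF koszul, of x] spec[OF Z, of x] by linarith
  moreover have "(fst p)\<^sup>2 \<noteq> 0" using p by simp
  ultimately have "\<forall>x. Z \<bullet> x = ?Z \<bullet> x" unfolding hyp_metric_def divide_cancel_right by blast
  then show "Z = ?Z" using vector_eq_rdot by blast
qed

lemma singular_2x2:
  fixes a b d :: real
  shows "(\<exists>x y. (x, y) \<noteq> (0, 0) \<and> a * x + b * y = 0 \<and> b * x + d * y = 0) \<longleftrightarrow> a * d = b\<^sup>2"
proof
  assume "\<exists>x y. (x, y) \<noteq> (0, 0) \<and> a * x + b * y = 0 \<and> b * x + d * y = 0"
  then obtain x y where "(x, y) \<noteq> (0, 0)" and 0: "a * x + b * y = 0" "b * x + d * y = 0" by blast
  moreover have "(a * d - b\<^sup>2) * x = 0" "(a * d - b\<^sup>2) * y = 0"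
    using 0 by algebra+
  ultimately show "a * d = b\<^sup>2" by auto
next
  assume ad: "a * d = b\<^sup>2"
  show "\<exists>x y. (x, y) \<noteq> (0, 0) \<and> a * x + b * y = 0 \<and> b * x + d * y = 0"
  proof (cases "a = 0")
    case True
    then have "b = 0" using ad by simp
    then show ?thesis using True by (metis mult_zero_left add.right_neutral mult_zero_right
      prod.inject zero_neq_one)
  next
    case False
    then have "(b, - a) \<noteq> (0, 0) \<and> a * b + b * (- a) = 0 \<and> b * b + d * (- a) = 0"
      using ad by (simp add: power2_eq_square algebra_simps)
    then show ?thesis by blast
  qed
qed

text \<open>Half the sum of the eigenvalues of \<open>J\<close> relative to \<open>I\<close>, and the square of half their
  difference.\<close>

definition mean_curv where
  "mean_curv I J = (I (1, 0) (1, 0) * J (0, 1) (0, 1) + I (0, 1) (0, 1) * J (1, 0) (1, 0)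
      - 2 * I (1, 0) (0, 1) * J (1, 0) (0, 1))
    / (2 * (I (1, 0) (1, 0) * I (0, 1) (0, 1) - I (1, 0) (0, 1) * I (1, 0) (0, 1)) :: real)"

definition discr where
  "discr I J = mean_curv I J * mean_curv I J
    - (J (1, 0) (1, 0) * J (0, 1) (0, 1) - J (1, 0) (0, 1) * J (1, 0) (0, 1))
      / (I (1, 0) (1, 0) * I (0, 1) (0, 1) - I (1, 0) (0, 1) * I (1, 0) (0, 1) :: real)"

text \<open>The eigenvalues are the roots of \<open>det (J - k I)\<close>. Up to a positive factor, the discriminant
  is the sum of squares in \<open>key\<close> below; this shows that the roots are real, and equal only if \<open>J\<close>
  is a multiple of \<open>I\<close>.\<close>

lemma form_pencil:
  fixes I J :: "real \<times> real \<Rightarrow> real \<times> real \<Rightarrow> real"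
  assumes I: "\<And>X Y. I X Y = fst X * fst Y * I (1, 0) (1, 0)
      + (fst X * snd Y + snd X * fst Y) * I (1, 0) (0, 1) + snd X * snd Y * I (0, 1) (0, 1)"
    and J: "\<And>X Y. J X Y = fst X * fst Y * J (1, 0) (1, 0)
      + (fst X * snd Y + snd X * fst Y) * J (1, 0) (0, 1) + snd X * snd Y * J (0, 1) (0, 1)"
    and pos: "\<And>X. X \<noteq> 0 \<Longrightarrow> I X X > 0"
  shows "I (1, 0) (1, 0) * I (0, 1) (0, 1) - I (1, 0) (0, 1) * I (1, 0) (0, 1) > 0"
    and "discr I J \<ge> 0"
    and "{k. \<exists>X. X \<noteq> 0 \<and> (\<forall>Y. J X Y = k * I X Y)}
      = {mean_curv I J - sqrt (discr I J), mean_curv I J + sqrt (discr I J)}"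
    and "discr I J = 0 \<Longrightarrow> J X Y = mean_curv I J * I X Y"
proof -
  define E F G L M N where d: "E = I (1, 0) (1, 0)" "F = I (1, 0) (0, 1)" "G = I (0, 1) (0, 1)"
    "L = J (1, 0) (1, 0)" "M = J (1, 0) (0, 1)" "N = J (0, 1) (0, 1)"
  note I' = I[folded d] and J' = J[folded d]
  define P where "P = E * G - F * F"
  define H where "H = mean_curv I J"
  have Hd: "H = (E * N + G * L - 2 * F * M) / (2 * P)" by (simp add: H_def mean_curv_def d P_def)
  have Dd: "discr I J = H * H - (L * N - M * M) / P" by (simp add: H_def discr_def d P_def)
  have E: "E > 0" using pos[of "(1, 0)"] by (simp add: d zero_prod_def)
  have "I (F, - E) (F, - E) > 0" using E by (intro pos) (simp add: zero_prod_def)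
  also have "I (F, - E) (F, - E) = E * P" unfolding I' by (simp add: P_def algebra_simps)
  finally have P: "P > 0" using E by (simp add: zero_less_mult_iff)
  then show "I (1, 0) (1, 0) * I (0, 1) (0, 1) - I (1, 0) (0, 1) * I (1, 0) (0, 1) > 0"
    by (simp add: P_def d)
  have H2: "2 * P * H = E * N + G * L - 2 * F * M" using P by (simp add: Hd)
  have D2: "P * discr I J = P * H * H - (L * N - M * M)" using P by (simp add: Dd field_simps)
  have "E\<^sup>2 * (4 * P * (P * discr I J)) = (E * (E * N - G * L) - 2 * F * (E * M - F * L))\<^sup>2
    + 4 * P * (E * M - F * L)\<^sup>2"
  proof -
    have "E\<^sup>2 * (4 * P * (P * discr I J)) = E\<^sup>2 * ((2 * P * H)\<^sup>2 - 4 * P * (L * N - M * M))"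
      unfolding D2 by (simp add: power2_eq_square algebra_simps)
    also have "\<dots> = (E * (E * N - G * L) - 2 * F * (E * M - F * L))\<^sup>2 + 4 * P * (E * M - F * L)\<^sup>2"
      unfolding H2 unfolding P_def by (simp add: power2_eq_square algebra_simps)
    finally show ?thesis .
  qed
  then have key: "(4 * E\<^sup>2 * P\<^sup>2) * discr I J
    = (E * (E * N - G * L) - 2 * F * (E * M - F * L))\<^sup>2 + 4 * P * (E * M - F * L)\<^sup>2"
    by (simp add: power2_eq_square algebra_simps)
  have "(4 * E\<^sup>2 * P\<^sup>2) * discr I J \<ge> 0" unfolding key using P by simp
  moreover have "4 * E\<^sup>2 * P\<^sup>2 > 0" using E P by simp
  ultimately show D: "discr I J \<ge> 0" using zero_le_mult_iff[of "4 * E\<^sup>2 * P\<^sup>2"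
    "discr I J"] by linarith
  have "(\<exists>X. X \<noteq> 0 \<and> (\<forall>Y. J X Y = k * I X Y)) \<longleftrightarrow> k = H - sqrt (discr I J) \<or> k
    = H + sqrt (discr I J)" for k
  proof -
    have "(\<forall>Y. J X Y = k * I X Y) \<longleftrightarrow> (L - k * E) * fst X + (M - k * F) * snd X = 0
        \<and> (M - k * F) * fst X + (N - k * G) * snd X = 0" for X
    proof
      assume *: "\<forall>Y. J X Y = k * I X Y"
      show "(L - k * E) * fst X + (M - k * F) * snd X = 0
        \<and> (M - k * F) * fst X + (N - k * G) * snd X = 0"
        using spec[OF *, of "(1, 0)"] spec[OF *, of "(0, 1)"] unfolding I'[of X] J'[of X]
        by (simp add: algebra_simps)
    next
      assume *: "(L - k * E) * fst X + (M - k * F) * snd X = 0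
        \<and> (M - k * F) * fst X + (N - k * G) * snd X = 0"
      have "J X Y - k * I X Y = fst Y * ((L - k * E) * fst X + (M - k * F) * snd X)
          + snd Y * ((M - k * F) * fst X + (N - k * G) * snd X)" for Y
        unfolding I'[of X] J'[of X] by (simp add: algebra_simps)
      then show "\<forall>Y. J X Y = k * I X Y" using * by simp
    qed
    then have "(\<exists>X. X \<noteq> 0 \<and> (\<forall>Y. J X Y = k * I X Y)) \<longleftrightarrow>
        (\<exists>x y. (x, y) \<noteq> (0, 0) \<and> (L - k * E) * x + (M - k * F) * y = 0
          \<and> (M - k * F) * x + (N - k * G) * y = 0)"
      by (simp add: zero_prod_def)
    also have "\<dots> \<longleftrightarrow> (L - k * E) * (N - k * G) = (M - k * F)\<^sup>2" by (rule singular_2x2)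
    also have "\<dots> \<longleftrightarrow> P * (k - H)\<^sup>2 = P * discr I J"
    proof -
      have "(L - k * E) * (N - k * G) - (M - k * F)\<^sup>2
        = P * k * k - k * (2 * P * H) + (L * N - M * M)"
        unfolding H2 by (simp add: P_def power2_eq_square algebra_simps)
      also have "\<dots> = P * (k - H)\<^sup>2 - P * discr I J"
        unfolding D2 by (simp add: power2_eq_square algebra_simps)
      finally show ?thesis by auto
    qed
    also have "\<dots> \<longleftrightarrow> (k - H)\<^sup>2 = (sqrt (discr I J))\<^sup>2" using P D by simp
    also have "\<dots> \<longleftrightarrow> k = H - sqrt (discr I J) \<or> k = H + sqrt (discr I J)"
      unfolding power2_eq_iff by auto
    finally show ?thesis .
  qed
  then show "{k. \<exists>X. X \<noteq> 0 \<and> (\<forall>Y. J X Y = k * I X Y)}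
      = {mean_curv I J - sqrt (discr I J), mean_curv I J + sqrt (discr I J)}"
    by (auto simp: H_def)
  show "J X Y = mean_curv I J * I X Y" if "discr I J = 0"
  proof -
    have "(E * (E * N - G * L) - 2 * F * (E * M - F * L))\<^sup>2 = 0 \<and> 4 * P * (E * M - F * L)\<^sup>2 = 0"
      using key P unfolding that mult_zero_right
      by (intro add_nonneg_eq_0_iff[THEN iffD1]) auto
    then have 1: "E * M = F * L" "E * N = G * L" using P E by auto
    have "E * (2 * P * H) = 2 * P * L" unfolding H2 using 1 by (simp add: P_def) algebra
    then have "L = E * H" using P by simp
    moreover from this have "E * M = E * (F * H)" "E * N = E * (G * H)" using 1 by simp_all
    ultimately have "L = E * H" "M = F * H" "N = G * H" using E by simp_all
    then show ?thesis unfolding I'[of X] J'[of X] H_def[symmetric] by (simp add: algebra_simps)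
  qed
qed

text \<open>Up to a sign, which is locally constant by continuity, the normal is the normalized cross
  product of the coordinate vectors.\<close>

lemma C3_unit_normal:
  fixes f \<nu> :: "real \<times> real \<Rightarrow> real \<times> complex"
  assumes U: "open U" "p \<in> U" and f: "Ck_on 4 f U" and \<nu>: "continuous_on U \<nu>"
    and unit: "\<And>q. q \<in> U \<Longrightarrow> \<nu> q \<bullet> \<nu> q = 1"
    and tangent: "\<And>q X. q \<in> U \<Longrightarrow> \<nu> q \<bullet> dir_deriv f q X = 0"
    and inj: "\<And>q X. q \<in> U \<Longrightarrow> X \<noteq> 0 \<Longrightarrow> dir_deriv f q X \<noteq> 0"
  obtains V where "open V" "p \<in> V" "V \<subseteq> U" "Ck_on 3 \<nu> V"
proof -
  define c where "c q = cross (dir_deriv f q (1, 0)) (dir_deriv f q (0, 1))" for q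
  have df: "Ck_on 3 (\<lambda>q. dir_deriv f q X) U" for X
    using Ck_on_dir_deriv[of 3 f U X] f by (simp del: Ck_on.simps add: eval_nat_numeral)
  have c3: "Ck_on 3 c U"
    unfolding c_def[abs_def] by (intro Ck_on_bilinear[OF bounded_bilinear_cross] U df)
  define s where "s q = \<nu> q \<bullet> c q" for q
  have cs: "c q = s q *\<^sub>R \<nu> q" if "q \<in> U" for q
    unfolding s_def c_def by (rule parallel_normal[OF unit tangent tangent]; rule that)
  have c0: "c q \<noteq> 0" if q: "q \<in> U" for q
  proof
    assume "c q = 0"
    let ?v = "dir_deriv f q (1, 0)" and ?w = "dir_deriv f q (0, 1)"
    have "linear (dir_deriv f q)"
      using Ck_on_has_derivative[OF f _ q] has_derivative_linear by auto
    then have lin: "dir_deriv f q (x, y) = x *\<^sub>R ?v + y *\<^sub>R ?w" for x y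
      using linear_add[of "dir_deriv f q" "x *\<^sub>R (1, 0)" "y *\<^sub>R (0, 1)"]
        linear_scale[of "dir_deriv f q" x "(1, 0)"] linear_scale[of "dir_deriv f q" y
          "(0, 1)"] by simp
    have "cross ?v (cross ?v ?w) = 0" using \<open>c q = 0\<close> by (simp add: c_def cross_zero)
    then have "dir_deriv f q (?v \<bullet> ?w, - (?v \<bullet> ?v)) = 0"
      unfolding cross_cross lin[of "?v \<bullet> ?w" "- (?v \<bullet> ?v)"] by simp
    then have "(?v \<bullet> ?w, - (?v \<bullet> ?v)) = 0" using inj[OF q] by blast
    then have "?v = 0" by (simp add: zero_prod_def)
    then show False using inj[OF q, of "(1, 0)"] by (simp add: zero_prod_def)
  qed
  have s0: "s q \<noteq> 0" if "q \<in> U" for q using cs[OF that] c0[OF that] by auto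
  have cont: "continuous_on U (\<lambda>q. s q * s p)"
    unfolding s_def using Ck_on_imp_continuous_on[OF c3] \<nu> by (intro continuous_intros)
  define V where "V = U \<inter> (\<lambda>q. s q * s p) -` {0<..}"
  have V: "open V" unfolding V_def by (rule continuous_open_preimage[OF cont U(1)]) simp
  have VU: "V \<subseteq> U" and pV: "p \<in> V" using s0[OF U(2)] U(2) by (auto simp: V_def zero_less_mult_iff)
  have *: "(sgn (s p) * inverse (sqrt (c q \<bullet> c q))) *\<^sub>R c q = \<nu> q" if "q \<in> V" for q
  proof -
    have q: "q \<in> U" using that VU by auto
    have "sqrt (c q \<bullet> c q) = \<bar>s q\<bar>" unfolding cs[OF q] using unit[OF q] by simp
    moreover have "sgn (s p) * \<bar>s q\<bar> = s q"
      using that by (auto simp: V_def zero_less_mult_iff sgn_if abs_if)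
    ultimately have "sgn (s p) * inverse (sqrt (c q \<bullet> c q)) * s q = 1"
      using s0[OF q] s0[OF U(2)] by (auto simp: field_simps sgn_if abs_if split: if_splits)
    then show ?thesis by (subst cs[OF q]) simp
  qed
  have "Ck_on 3 (\<lambda>q. (sgn (s p) * inverse (sqrt (c q \<bullet> c q))) *\<^sub>R c q) V"
    by (intro Ck_on_scaleR Ck_on_mult Ck_on_const Ck_on_inverse Ck_on_sqrt Ck_on_inner V
        Ck_on_subset[OF VU c3]) (use c0 VU in auto)
  then have "Ck_on 3 \<nu> V" by (rule Ck_on_cong[OF V *, rotated])
  with V pV VU show thesis by (rule that)
qed

section \<open>Weingarten surfaces and flat congruences\<close>

text \<open>A surface and its normal geodesics in one chart \<open>(U, \<phi>)\<close>: \<open>f\<close>, \<open>n\<close> and \<open>\<gamma>\<close> are the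
  immersion, the unit normal and the normal geodesics in the parameters.\<close>

locale patch =
  fixes U :: "(real \<times> real) set" and f n :: "real \<times> real \<Rightarrow> real \<times> complex"
    and \<gamma> :: "real \<times> real \<Rightarrow> complex option \<times> complex option"
  assumes U: "open U" and f4: "Ck_on 4 f U" and n: "continuous_on U n"
    and pos: "\<And>u. u \<in> U \<Longrightarrow> fst (f u) > 0"
    and inj_df: "\<And>u. u \<in> U \<Longrightarrow> inj (dir_deriv f u)"
    and unit_n: "\<And>u. u \<in> U \<Longrightarrow> hyp_metric (f u) (n u) (n u) = 1"
    and normal_n: "\<And>u X. u \<in> U \<Longrightarrow> hyp_metric (f u) (dir_deriv f u X) (n u) = 0"
    and \<gamma>: "\<And>u. u \<in> U \<Longrightarrow> \<gamma> u \<in> LH3"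
      "\<And>u. u \<in> U \<Longrightarrow> \<exists>r. geodesic (\<gamma> u) r = f u \<and> (geodesic (\<gamma> u) has_vector_derivative n u) (at r)"
    and nondeg: "\<And>u. u \<in> U \<Longrightarrow> nondegenerate (induced_metric \<gamma> u)"
begin

definition \<nu> where "\<nu> u = n u /\<^sub>R fst (f u)"

lemma n_eq: "u \<in> U \<Longrightarrow> n u = fst (f u) *\<^sub>R \<nu> u"
  using pos[of u] by (simp add: \<nu>_def)

lemma unit: "u \<in> U \<Longrightarrow> \<nu> u \<bullet> \<nu> u = 1"
  using unit_n[of u] pos[of u] by (auto simp: hyp_metric_def \<nu>_def power2_eq_square field_simps)

lemma tangent: "u \<in> U \<Longrightarrow> \<nu> u \<bullet> dir_deriv f u X = 0"
  using normal_n[of u X] pos[of u] by (simp add: hyp_metric_def \<nu>_def inner_commute)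

lemma D_f: "u \<in> U \<Longrightarrow> (f has_derivative dir_deriv f u) (at u)"
  by (rule Ck_on_has_derivative[OF f4]) auto

lemma linear_df: "u \<in> U \<Longrightarrow> linear (dir_deriv f u)"
  using D_f has_derivative_linear by blast

lemma inj: "u \<in> U \<Longrightarrow> X \<noteq> 0 \<Longrightarrow> dir_deriv f u X \<noteq> 0"
  using inj_df[of u] linear_injective_0[OF linear_df[of u]] by blast

lemma continuous_\<nu>: "continuous_on U \<nu>"
  unfolding \<nu>_def[abs_def] using n Ck_on_imp_continuous_on[OF f4] pos
  by (intro continuous_intros) (auto simp: less_imp_neq[symmetric])

lemma metric:
  assumes u: "u \<in> U" and \<nu>: "(\<nu> has_derivative dir_deriv \<nu> u) (at u)"
  shows "induced_metric \<gamma> u X Y = (det3 (\<nu> u) (dir_deriv f u X) (dir_deriv \<nu> u Y)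
    + det3 (\<nu> u) (dir_deriv f u Y) (dir_deriv \<nu> u X)) / fst (f u)"
  by (rule induced_metric_eq[OF U u D_f[OF u] \<nu> pos unit tangent[OF u] \<gamma>(1)])
    (use \<gamma>(2) n_eq in auto)

lemma weingarten_iff_flat:
  assumes p: "p \<in> U"
  shows "(\<exists>D1 D2. (lambda1 f n has_derivative D1) (at p) \<and> (lambda2 f n has_derivative D2) (at p) \<and>
      (\<forall>X Y. D1 X * D2 Y - D1 Y * D2 X = 0))
    \<longleftrightarrow> gauss_curvature (induced_metric \<gamma>) p = 0"
proof -
  obtain V where V: "open V" "p \<in> V" "V \<subseteq> U" and \<nu>3: "Ck_on 3 \<nu> V"
    using C3_unit_normal[OF U p f4 continuous_\<nu> unit tangent inj] by metis
  have in_U: "u \<in> U" if "u \<in> V" for u using that V by auto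
  have f4V: "Ck_on 4 f V" by (rule Ck_on_subset[OF V(3) f4])
  have df: "Ck_on 3 (\<lambda>q. dir_deriv f q X) V" for X
    using Ck_on_dir_deriv[of 3 f V X] f4V by (simp del: Ck_on.simps add: eval_nat_numeral)
  have d\<nu>: "Ck_on 2 (\<lambda>q. dir_deriv \<nu> q X) V" for X
    using Ck_on_dir_deriv[of 2 \<nu> V X] \<nu>3 by (simp del: Ck_on.simps add: eval_nat_numeral)
  have f2: "Ck_on 2 f V" and df2: "Ck_on 2 (\<lambda>q. dir_deriv f q X) V" and \<nu>2: "Ck_on 2 \<nu> V" for X
    using Ck_on_mono[OF _ f4V, of 2] Ck_on_mono[OF _ df, of 2] Ck_on_mono[OF _ \<nu>3, of 2]
    by (simp_all del: Ck_on.simps)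
  have D\<nu>: "(\<nu> has_derivative dir_deriv \<nu> u) (at u)" if "u \<in> V" for u
    by (rule Ck_on_has_derivative[OF \<nu>2 _ that]) simp
  have lin\<nu>: "linear (dir_deriv \<nu> u)" if "u \<in> V" for u
    using D\<nu>[OF that] has_derivative_linear by blast
  note linf = linear_df[OF in_U]
  have \<nu>_d\<nu>: "\<nu> u \<bullet> dir_deriv \<nu> u X = 0" if "u \<in> V" for u X
  proof -
    have "((\<lambda>q. \<nu> q \<bullet> \<nu> q) has_derivative (\<lambda>X. \<nu> u \<bullet> dir_deriv \<nu> u X
      + dir_deriv \<nu> u X \<bullet> \<nu> u)) (at u)"
      by (intro has_derivative_inner D\<nu> that)
    moreover have "dir_deriv (\<lambda>q. \<nu> q \<bullet> \<nu> q) u X = dir_deriv (\<lambda>q. 1::real) u X"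
      by (rule dir_deriv_cong[OF V(1) that]) (rule unit[OF in_U])
    ultimately show ?thesis by (simp add: dir_deriv_eqI inner_commute)
  qed
  \<comment> \<open>The hyperbolic fundamental forms in Euclidean terms.\<close>
  define I where "I u X Y = (dir_deriv f u X \<bullet> dir_deriv f u Y) / (fst (f u) * fst (f u))" for u X Y
  define J where "J u X Y = (fst (\<nu> u) * (dir_deriv f u X \<bullet> dir_deriv f u Y)
      - fst (f u) * (dir_deriv \<nu> u X \<bullet> dir_deriv f u Y)) / (fst (f u) * fst (f u))" for u X Y
  have first: "first_form f u X Y = I u X Y" for u X Y
    by (simp add: first_form_def hyp_metric_def I_def power2_eq_square)
  have d2: "dir_deriv \<nu> u X \<bullet> dir_deriv f u Y = - (\<nu> u \<bullet> dir_deriv (\<lambda>q. dir_deriv f q Y) u X)"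
    if u: "u \<in> V" for u X Y
  proof -
    have "((\<lambda>q. dir_deriv f q Y) has_derivative dir_deriv (\<lambda>q. dir_deriv f q Y) u) (at u)"
      by (rule Ck_on_has_derivative[OF df2 _ u]) simp
    from has_derivative_inner[OF D\<nu>[OF u] this]
    have "dir_deriv (\<lambda>q. \<nu> q \<bullet> dir_deriv f q Y) u X
        = \<nu> u \<bullet> dir_deriv (\<lambda>q. dir_deriv f q Y) u X + dir_deriv \<nu> u X \<bullet> dir_deriv f u Y"
      by (rule dir_deriv_eqI)
    moreover have "dir_deriv (\<lambda>q. \<nu> q \<bullet> dir_deriv f q Y) u X = dir_deriv (\<lambda>q. 0::real) u X"
      by (rule dir_deriv_cong[OF V(1) u]) (rule tangent[OF in_U])
    ultimately show ?thesis by simp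
  qed
  have second: "second_form f n u X Y = J u X Y" if u: "u \<in> V" for u X Y
  proof -
    have t: "fst (f u) > 0" by (rule pos[OF in_U[OF u]])
    have "dir_deriv f u Z \<bullet> \<nu> u = 0" for Z using tangent[OF in_U[OF u]] by (simp add: inner_commute)
    moreover have "dir_deriv (\<lambda>q. dir_deriv f q Y) u X \<bullet> \<nu> u
      = - (dir_deriv \<nu> u X \<bullet> dir_deriv f u Y)"
      using d2[OF u, of X Y] by (simp add: inner_commute)
    moreover have "(c, 0) \<bullet> \<nu> u = c * fst (\<nu> u)" for c by (simp add: inner_prod_def)
    ultimately show ?thesis
      unfolding second_form_def hyp_metric_def christoffel_hyp_metric[OF t] n_eq[OF in_U[OF u]]
        J_def
      using t by (simp add: inner_add_left inner_diff_left power2_eq_square field_simps)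
  qed
  have expI: "I u X Y = fst X * fst Y * I u (1, 0) (1, 0)
      + (fst X * snd Y + snd X * fst Y) * I u (1, 0) (0, 1) + snd X * snd Y * I u (0, 1) (0, 1)"
    and expJ: "J u X Y = fst X * fst Y * J u (1, 0) (1, 0)
      + (fst X * snd Y + snd X * fst Y) * J u (1, 0) (0, 1) + snd X * snd Y * J u (0, 1) (0, 1)"
    if u: "u \<in> V" for u X Y
  proof -
    have sp: "X = fst X *\<^sub>R (1, 0) + snd X *\<^sub>R (0, 1)" for X ::
      "real \<times> real" by (simp add: prod_eq_iff)
    have lf: "dir_deriv f u X = fst X *\<^sub>R dir_deriv f u (1, 0)
      + snd X *\<^sub>R dir_deriv f u (0, 1)" for X
      by (subst sp, unfold linear_add[OF linf[OF u]] linear_scale[OF linf[OF u]], rule refl)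
    have ln: "dir_deriv \<nu> u X = fst X *\<^sub>R dir_deriv \<nu> u (1, 0)
      + snd X *\<^sub>R dir_deriv \<nu> u (0, 1)" for X
      by (subst sp, unfold linear_add[OF lin\<nu>[OF u]] linear_scale[OF lin\<nu>[OF u]], rule refl)
    have sym: "dir_deriv \<nu> u (0, 1) \<bullet> dir_deriv f u (1, 0)
      = dir_deriv \<nu> u (1, 0) \<bullet> dir_deriv f u (0, 1)"
      unfolding d2[OF u] dir_deriv_commute[OF V(1) u f2, of "(1, 0)" "(0, 1)"] ..
    show "I u X Y = fst X * fst Y * I u (1, 0) (1, 0)
      + (fst X * snd Y + snd X * fst Y) * I u (1, 0) (0, 1) + snd X * snd Y * I u (0, 1) (0, 1)"
      unfolding I_def lf[of X] lf[of Y]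
      by (simp add: inner_add_left inner_add_right inner_commute[of "dir_deriv f u (0, 1)"
        "dir_deriv f u (1, 0)"]
          add_divide_distrib algebra_simps)
    show "J u X Y = fst X * fst Y * J u (1, 0) (1, 0)
      + (fst X * snd Y + snd X * fst Y) * J u (1, 0) (0, 1) + snd X * snd Y * J u (0, 1) (0, 1)"
      unfolding J_def lf[of X] lf[of Y] ln[of X]
      by (simp add: inner_add_left inner_add_right sym inner_commute[of "dir_deriv f u (0, 1)"
        "dir_deriv f u (1, 0)"]
          add_divide_distrib diff_divide_distrib algebra_simps)
  qed
  have posI: "I u X X > 0" if "u \<in> V" "X \<noteq> 0" for u X
    using inj[OF in_U[OF that(1)] that(2)] pos[OF in_U[OF that(1)]] by (simp add: I_def)
  note pencil = form_pencil[of "I u" "J u" for u, OF expI expJ posI]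
  have \<nu>_df: "dir_deriv f u X \<bullet> \<nu> u = 0" "dir_deriv \<nu> u X \<bullet> \<nu> u = 0" if "u \<in> V" for u X
    using tangent[OF in_U[OF that], of X] \<nu>_d\<nu>[OF that, of X] by (simp_all add: inner_commute)
  \<comment> \<open>The Euclidean principal curvature that corresponds to a hyperbolic one.\<close>
  define \<kappa> where "\<kappa> u l = (l - fst (\<nu> u)) / fst (f u)" for u l
  \<comment> \<open>The shape operator takes values in the tangent plane, and a tangent vector orthogonal to
    the tangent plane vanishes; so an eigenvector of the pencil solves Rodrigues' equation.\<close>
  have eig: "(\<forall>Y. J u X Y = l * I u X Y) \<longleftrightarrow> \<kappa> u l *\<^sub>R dir_deriv f u X + dir_deriv \<nu> u X = 0"
    if u: "u \<in> V" for u X l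
  proof -
    let ?T = "\<kappa> u l *\<^sub>R dir_deriv f u X + dir_deriv \<nu> u X"
    have t: "fst (f u) > 0" by (rule pos[OF in_U[OF u]])
    have "J u X Y - l * I u X Y = - (?T \<bullet> dir_deriv f u Y) / fst (f u)" for Y
      unfolding J_def I_def \<kappa>_def using t by (simp add: inner_add_left field_simps)
    then have *: "(\<forall>Y. J u X Y = l * I u X Y) \<longleftrightarrow> (\<forall>Y. ?T \<bullet> dir_deriv f u Y = 0)"
      using t by (smt (verit, ccfv_threshold) divide_eq_0_iff)
    have "?T = 0" if 0: "\<forall>Y. ?T \<bullet> dir_deriv f u Y = 0"
    proof -
      let ?v = "dir_deriv f u (1, 0)" and ?w = "dir_deriv f u (0, 1)"
      let ?s = "\<nu> u \<bullet> cross ?v ?w"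
      have c: "cross ?v ?w = ?s *\<^sub>R \<nu> u"
        by (rule parallel_normal[OF unit tangent tangent]; rule in_U[OF u])
      have "cross ?v ?w \<bullet> cross ?v ?w
          = (I u (1, 0) (1, 0) * I u (0, 1) (0, 1)
            - I u (1, 0) (0, 1) * I u (1, 0) (0, 1)) * fst (f u) ^ 4"
        unfolding cross_norm I_def using t by (simp add: field_simps power2_eq_square
          power_numeral_reduce)
      then have "cross ?v ?w \<noteq> 0" using pencil(1)[OF u u u] t by auto
      then have s: "?s \<noteq> 0" using c by auto
      have "?s *\<^sub>R cross (\<nu> u) ?T = cross (cross ?v ?w) ?T"
        using c bounded_bilinear.scaleR_left[OF bounded_bilinear_cross, of ?s "\<nu> u" ?T] by simp
      also have "\<dots> = - cross ?T (cross ?v ?w)" by (rule cross_minus)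
      also have "cross ?T (cross ?v ?w) = 0" unfolding cross_cross using 0 by simp
      finally have "cross (\<nu> u) ?T = 0" using s by simp
      then have "cross (\<nu> u) (cross (\<nu> u) ?T) = 0" by (simp add: cross_zero)
      moreover have "\<nu> u \<bullet> ?T = 0" using \<nu>_df[OF u, of X]
        by (simp add: inner_commute inner_add_right)
      moreover have "T = 0" if "cross (\<nu> u) (cross (\<nu> u) T) = 0" "\<nu> u \<bullet> T = 0" for T
        using that unfolding cross_cross unit[OF in_U[OF u]] by simp
      ultimately show "?T = 0" by blast
    qed
    then show ?thesis unfolding * by auto
  qed
  define H where "H u = mean_curv (I u) (J u)" for u
  define S where "S u = discr (I u) (J u)" for u
  \<comment> \<open>At an umbilic point \<open>d\<nu>\<close> would be a multiple of \<open>df\<close>, and the induced metric would vanish.\<close>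
  have S: "S u > 0" if u: "u \<in> V" for u
  proof (rule ccontr)
    assume "\<not> S u > 0"
    then have "discr (I u) (J u) = 0" using pencil(2)[OF u u u] by (simp add: S_def)
    then have "J u X Y = H u * I u X Y" for X Y using pencil(4)[OF u u u] by (simp add: H_def)
    then have "dir_deriv \<nu> u X = - (\<kappa> u (H u) *\<^sub>R dir_deriv f u X)" for X
      using eig[OF u, of X "H u"] by (simp add: eq_neg_iff_add_eq_0 add.commute)
    then have "induced_metric \<gamma> u X Y = 0" for X Y
      unfolding metric[OF in_U[OF u] D\<nu>[OF u]] by (simp add: det3_def algebra_simps)
    then have "(1::real, 0::real) = 0" using nondeg[OF in_U[OF u]] unfolding nondegenerate_def
      by blast
    then show False by (simp add: zero_prod_def)
  qed
  have pc: "principal_curvatures f n u = {H u - sqrt (S u), H u + sqrt (S u)}" if u: "u \<in> V" for u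
    using pencil(3)[OF u u u] unfolding principal_curvatures_def second[OF u] first H_def S_def
      by blast
  define L1 where "L1 u = H u + sqrt (S u)" for u
  define L2 where "L2 u = H u - sqrt (S u)" for u
  have lam: "lambda1 f n u = L1 u" "lambda2 f n u = L2 u" if u: "u \<in> V" for u
    using S[OF u] unfolding lambda1_def lambda2_def pc[OF u] L1_def L2_def by simp_all
  have tt: "fst (f u) * fst (f u) \<noteq> 0" if "u \<in> V" for u using pos[OF in_U[OF that]] by simp
  have I2: "Ck_on 2 (\<lambda>u. I u X Y) V" for X Y
    unfolding I_def by (intro Ck_on_divide Ck_on_inner Ck_on_mult Ck_on_fst V(1) df2 f2 tt)
  have J2: "Ck_on 2 (\<lambda>u. J u X Y) V" for X Y
    unfolding J_def by (intro Ck_on_divide Ck_on_diff Ck_on_inner Ck_on_mult Ck_on_fst V(1) df2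
      d\<nu> f2 \<nu>2 tt)
  have det0: "I u (1, 0) (1, 0) * I u (0, 1) (0, 1)
    - I u (1, 0) (0, 1) * I u (1, 0) (0, 1) \<noteq> 0" if "u \<in> V" for u
    using pencil(1)[OF that that that] by (simp add: less_imp_neq[symmetric])
  have H2: "Ck_on 2 H V"
    unfolding H_def[abs_def] mean_curv_def
    by (intro Ck_on_divide Ck_on_add Ck_on_diff Ck_on_mult Ck_on_const V(1) I2 J2) (use det0 in
      simp)
  have S2: "Ck_on 2 S V"
    unfolding S_def[abs_def] discr_def H_def[symmetric]
    by (intro Ck_on_divide Ck_on_diff Ck_on_mult V(1) I2 J2 H2 det0)
  have L2: "Ck_on 2 L1 V" "Ck_on 2 L2 V"
    unfolding L1_def[abs_def] L2_def[abs_def]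
      by (rule Ck_on_add Ck_on_diff Ck_on_sqrt V(1) H2 S2 S | assumption)+
  have ev: "\<exists>X. X \<noteq> 0 \<and> \<kappa> u (L1 u) *\<^sub>R dir_deriv f u X + dir_deriv \<nu> u X = 0"
    "\<exists>X. X \<noteq> 0 \<and> \<kappa> u (L2 u) *\<^sub>R dir_deriv f u X + dir_deriv \<nu> u X = 0" if u: "u \<in> V" for u
  proof -
    have "L1 u \<in> principal_curvatures f n u" "L2 u \<in> principal_curvatures f n u"
      by (simp_all add: pc[OF u] L1_def L2_def)
    then show "\<exists>X. X \<noteq> 0 \<and> \<kappa> u (L1 u) *\<^sub>R dir_deriv f u X + dir_deriv \<nu> u X = 0"
      "\<exists>X. X \<noteq> 0 \<and> \<kappa> u (L2 u) *\<^sub>R dir_deriv f u X + dir_deriv \<nu> u X = 0"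
      unfolding principal_curvatures_def second[OF u] first eig[OF u] by blast+
  qed
  interpret pp: principal_patch V f \<nu> "\<lambda>u. \<kappa> u (L1 u)" "\<lambda>u. \<kappa> u (L2 u)"
  proof (rule principal_patch.intro)
    show "open V" "Ck_on 3 \<nu> V" by fact+
    show "Ck_on 3 f V" using Ck_on_mono[OF _ f4V, of 3] by (simp del: Ck_on.simps)
    show "Ck_on 2 (\<lambda>u. \<kappa> u (L1 u)) V" "Ck_on 2 (\<lambda>u. \<kappa> u (L2 u)) V"
      unfolding \<kappa>_def using tt
      by (intro Ck_on_divide Ck_on_diff Ck_on_fst V(1) L2 \<nu>2 f2; auto)+
    show "\<kappa> u (L1 u) \<noteq> \<kappa> u (L2 u)" if "u \<in> V" for u
      using S[OF that] pos[OF in_U[OF that]] by (simp add: \<kappa>_def L1_def L2_def)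
  qed (use pos inj unit tangent in_U ev in blast)+
  have l: "pp.l1 u = L1 u" "pp.l2 u = L2 u" if "u \<in> V" for u
    using pos[OF in_U[OF that]] unfolding pp.l1_def pp.l2_def by (simp_all add: \<kappa>_def)
  have flat: "gauss_curvature (induced_metric \<gamma>) p = 0 \<longleftrightarrow>
      dir_deriv pp.l1 p (1, 0) * dir_deriv pp.l2 p (0, 1)
        = dir_deriv pp.l1 p (0, 1) * dir_deriv pp.l2 p (1, 0)"
    by (rule pp.gauss_curvature_eq_0_iff[OF metric[OF in_U D\<nu>] V(2)])
  have D: "(lambda1 f n has_derivative dir_deriv pp.l1 p) (at p)"
    "(lambda2 f n has_derivative dir_deriv pp.l2 p) (at p)"
    by (rule has_derivative_transform_within_open[OF pp.D(7)[OF V(2)] V(1,2)], simp add: lam l)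
      (rule has_derivative_transform_within_open[OF pp.D(8)[OF V(2)] V(1,2)], simp add: lam l)
  show ?thesis
  proof
    assume "\<exists>D1 D2. (lambda1 f n has_derivative D1) (at p)
      \<and> (lambda2 f n has_derivative D2) (at p) \<and>
      (\<forall>X Y. D1 X * D2 Y - D1 Y * D2 X = 0)"
    then obtain D1 D2 where *: "(lambda1 f n has_derivative D1) (at p)"
      "(lambda2 f n has_derivative D2) (at p)"
      "\<And>X Y. D1 X * D2 Y - D1 Y * D2 X = 0" by blast
    have "D1 = dir_deriv pp.l1 p" "D2 = dir_deriv pp.l2 p"
      using has_derivative_unique *(1,2) D by blast+
    then show "gauss_curvature (induced_metric \<gamma>) p = 0"
      unfolding flat using *(3)[of "(1, 0)" "(0, 1)"] by simp
  next
    assume "gauss_curvature (induced_metric \<gamma>) p = 0"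
    note 0 = this[unfolded flat]
    have "dir_deriv pp.l1 p X * dir_deriv pp.l2 p Y - dir_deriv pp.l1 p Y * dir_deriv pp.l2 p X
      = 0" for X Y
    proof -
      note e = linear_real_pair[OF pp.linear_D(3)[OF V(2)]] linear_real_pair[OF pp.linear_D(4)[OF
        V(2)]]
      have "dir_deriv pp.l1 p X * dir_deriv pp.l2 p Y - dir_deriv pp.l1 p Y * dir_deriv pp.l2 p X
        = (fst X * snd Y - snd X * fst Y) * (dir_deriv pp.l1 p (1, 0) * dir_deriv pp.l2 p (0, 1)
          - dir_deriv pp.l1 p (0, 1) * dir_deriv pp.l2 p (1, 0))"
        unfolding e(1)[of X] e(1)[of Y] e(2)[of X] e(2)[of Y] by (simp add: algebra_simps)
      then show ?thesis using 0 by simp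
    qed
    then show "\<exists>D1 D2. (lambda1 f n has_derivative D1) (at p)
      \<and> (lambda2 f n has_derivative D2) (at p) \<and>
      (\<forall>X Y. D1 X * D2 Y - D1 Y * D2 X = 0)" using D by blast
  qed
qed

end

theorem mainTheorem1:
  fixes M :: "'m topology" and A :: "'m surface_chart set"
    and F N :: "'m \<Rightarrow> real \<times> complex"
    and \<Gamma> :: "'m \<Rightarrow> complex option \<times> complex option"
  assumes "oriented_C4_immersion M A F N"
    and "normal_geodesics M F N \<Gamma>"
    and "\<forall>(U, \<phi>)\<in>A. \<forall>u\<in>U. nondegenerate (induced_metric (\<Gamma> \<circ> \<phi>) u)"
  shows "weingarten A F N \<longleftrightarrow>
    (\<forall>(U, \<phi>)\<in>A. \<forall>u\<in>U. gauss_curvature (induced_metric (\<Gamma> \<circ> \<phi>)) u = 0)"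
proof -
  interpret S: oriented_C4_immersion M A F N by (rule assms(1))
  have "patch U (F \<circ> \<phi>) (N \<circ> \<phi>) (\<Gamma> \<circ> \<phi>)" if c: "(U, \<phi>) \<in> A" for U \<phi>
  proof (rule patch.intro)
    have emb: "open U" "embedding_map (top_of_set U) M \<phi>" using S.chart[OF c] by auto
    then have cont: "continuous_map (top_of_set U) M \<phi>"
      unfolding embedding_map_def
      using homeomorphic_imp_continuous_map continuous_map_into_fulltopology by blast
    have in_M: "\<phi> u \<in> topspace M" if "u \<in> U" for u
      using cont that by (auto simp: continuous_map_def)
    show "open U" by (rule emb)
    show "Ck_on 4 (F \<circ> \<phi>) U" by (rule S.C4[OF c])
    show "continuous_on U (N \<circ> \<phi>)"
      using continuous_map_compose[OF cont S.N_continuous] by simp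
    show "fst ((F \<circ> \<phi>) u) > 0" if "u \<in> U" for u using S.in_H3[OF in_M[OF that]]
      by (simp add: H3_def)
    show "inj (dir_deriv (F \<circ> \<phi>) u)" if "u \<in> U" for u by (rule S.immersion[OF c that])
    show "hyp_metric ((F \<circ> \<phi>) u) ((N \<circ> \<phi>) u) ((N \<circ> \<phi>) u) = 1" if "u \<in> U" for u
      using S.N_unit[OF in_M[OF that]] by simp
    show "hyp_metric ((F \<circ> \<phi>) u) (dir_deriv (F \<circ> \<phi>) u X) ((N \<circ> \<phi>) u) = 0" if "u \<in> U" for u X
      using S.N_normal[OF c that] by simp
    show "(\<Gamma> \<circ> \<phi>) u \<in> LH3" "\<exists>r. geodesic ((\<Gamma> \<circ> \<phi>) u) r = (F \<circ> \<phi>) u \<and>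
        (geodesic ((\<Gamma> \<circ> \<phi>) u) has_vector_derivative (N \<circ> \<phi>) u) (at r)" if "u \<in> U" for u
      using assms(2) in_M[OF that] by (auto simp: normal_geodesics_def)
    show "nondegenerate (induced_metric (\<Gamma> \<circ> \<phi>) u)" if "u \<in> U" for u
      using assms(3) c that by blast
  qed
  note flat = patch.weingarten_iff_flat[OF this]
  show ?thesis unfolding weingarten_def using flat by (simp add: split_beta Ball_def)
qed

end
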